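(* Let $(\mathbf A_n)_{n\in\mathbb N}$ be a sequence of base structures and $(\mathbf G_n)_{n\in\mathbb N}$ an elementarily convergent sequence of gadgets. Let $\sigma$ be the equivalence on $\{1,\dots,\mathrm{ar}(R)\}$ given by $(i,j)\in\sigma\iff\lim_{n\to\infty}\mathrm{dist}_{\mathbf G_n}(z_i^{\mathbf G_n},z_j^{\mathbf G_n})<\infty$. If the sequence $(\mathbf A_n^\sigma)_n$ of fragmented base structures is elementarily convergent, then the sequence $(\mathbf A_n*\mathbf G_n)_n$ is elementarily convergent and \[ \operatorname{el-lim}(\mathbf A_n*\mathbf G_n)\equiv(\operatorname{el-lim}\mathbf A_n^\sigma)*_\sigma(\operatorname{el-lim}\mathbf G_n), \] where $\operatorname{el-lim}$ denotes any choice of an elementary limit and $\equiv$ is elementary equivalence.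
   Context: Fix a finite purely relational first-order language $L$ (with equality, positive arities) and a relation symbol $R\notin L$ of arity $\mathrm{ar}(R)\ge 1$. Structures are nonempty and of arbitrary cardinality; $V(\mathbf A)$ is the universe of $\mathbf A$. $\mathrm{dist}_{\mathbf A}$ is the distance in the Gaifman graph of $\mathbf A$ ($+\infty$ for unreachable pairs), and connected components are those of the Gaifman graph. Base structures and gadgets. $L_R=L\cup\{R\}$; a base structure is an $L_R$-structure. $L_G$ is $L$ extended by constants $z_1,\dots,z_{\mathrm{ar}(R)}$; a gadget is an $L_G$-structure $\mathbf G$ in which the vertices $z_i^{\mathbf G}$ (the roots) are pairwise distinct. Gadget construction. $\mathbf A*\mathbf G$ is the $L$-structure with universe $\big(V(\mathbf A)\sqcup(R^{\mathbf A}\times V(\mathbf G))\big)/\!\sim$, where $\sim$ is generated by $e_i\sim(\boldsymbol e,z_i^{\mathbf G})$ for $\boldsymbol e\in R^{\mathbf A}$, $1\le i\le\mathrm{ar}(R)$. For $S\in L$ of arity $s$, $S^{\mathbf A*\mathbf G}=\{([a_1],\dots,[a_s]):(a_1,\dots,a_s)\in S^{\mathbf A}\}\cup\{([(\boldsymbol e,v_1)],\dots,[(\boldsymbol e,v_s)]):\boldsymbol e\in R^{\mathbf A},(v_1,\dots,v_s)\in S^{\mathbf G}\}$. The same construction is used with any other purely relational language in place of $L$ and any other relation symbol in place of $R$. Elementary convergence. A sequence of structures in a fixed language is elementarily convergent if for every sentence $\phi$ either all but finitely many members satisfy $\phi$, or all but finitely many satisfy $\neg\phi$. An elementary limit of it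 is any structure $\mathbf M$ in the same language such that $\mathbf M\models\phi$ iff all but finitely many members satisfy $\phi$, for every sentence $\phi$; it exists and is unique up to elementary equivalence. For an elementarily convergent sequence of gadgets the limits of distances of roots exist in $[0,\infty]$, and $(i,j)\in\sigma$ iff $z_i,z_j$ lie in the same connected component of $\operatorname{el-lim}\mathbf G_n$. Fragmentation. Let $X_1,\dots,X_\ell$ be the classes of $\sigma$ and put $X_0=\emptyset$. $L_\sigma$ is $L$ extended by relation symbols $R_0,\dots,R_\ell$, with $R_i$ of arity $|X_i|+1$. $\mathrm{Gad}(\sigma)$ is the gadget in language $L_\sigma$ plus constants $z_1,\dots,z_{\mathrm{ar}(R)}$, with vertex set $\{z_1,\dots,z_{\mathrm{ar}(R)}\}\cup\{x_0,\dots,x_\ell\}$ (all distinct, roots $z_j$), whose only edges are, for each $i\in\{0,\dots,\ell\}$, one $R_i$-edge consisting of the vertices $z_j$, $j\in X_i$ (in increasing order of $j$), followed by $x_i$. For a base structure $\mathbf A$, $\mathbf A^\sigma=\mathbf A*\mathrm{Gad}(\sigma)$, an $L_\sigma$-structure ($R$-edges are replaced). The copies of $x_0,\dots,x_\ell$ are the auxiliary vertices; they are exactly the vertices occurring as the last coordinate of an $R_i$-edge for some $i$, and this also describes the auxiliary vertices of an elementary limit of structures $\mathbf A_n^\sigma$. The operation $*_\sigma$. For $\mathbf B=\operatorname{el-lim}\mathbf A_n^\sigma$ and $\mathbf H=\operatorname{el-lim}\mathbf G_n$, the $L$-structure $\mathbf B*_\sigma\mathbf H$ is obtained from $\mathbf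 B$ by replacing, for each $i$, every $R_i$-edge by a new disjoint copy of $\mathbf H_i$, where for $i\ge1$ $\mathbf H_i$ is the connected component of $\mathbf H$ containing the roots $z_j$, $j\in X_i$ (these roots being identified, in increasing order of $j$, with the non-last vertices of the $R_i$-edge), and $\mathbf H_0$ is the (possibly empty) union of the connected components of $\mathbf H$ containing no root; the auxiliary vertices of $\mathbf B$ are removed. *)

theory Defs
  imports "HOL-Library.Extended_Real"
begin

section \<open>First-order logic over relation symbols and constants\<close>

record 'r lang =
  syms :: "'r set"
  arity :: "'r \<Rightarrow> nat"
  csts :: "nat set"

record ('a, 'r) fo_struct =
  universe :: "'a set"
  rel :: "'r \<Rightarrow> 'a list set"
  cst :: "nat \<Rightarrow> 'a"

text \<open>The interpretation of symbols and constants outside the language is arbitrary and never used.\<close>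

definition fo_structure :: "'r lang \<Rightarrow> ('a, 'r) fo_struct \<Rightarrow> bool" where
  "fo_structure L M \<longleftrightarrow>
     universe M \<noteq> {} \<and>
     (\<forall>S\<in>syms L. \<forall>t\<in>rel M S. length t = arity L S \<and> set t \<subseteq> universe M) \<and>
     (\<forall>c\<in>csts L. cst M c \<in> universe M)"

definition relational_lang :: "'r lang \<Rightarrow> bool" where
  "relational_lang L \<longleftrightarrow> csts L = {} \<and> (\<forall>S\<in>syms L. arity L S \<ge> 1)"

datatype fo_term = Var nat | Cst nat

datatype 'r fo_formula =
    Eq fo_term fo_term
  | Rel 'r "fo_term list"
  | Neg "'r fo_formula"
  | Conj "'r fo_formula" "'r fo_formula"
  | Ex nat "'r fo_formula"

fun term_vars :: "fo_term \<Rightarrow> nat set" where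
  "term_vars (Var x) = {x}"
| "term_vars (Cst c) = {}"

fun wf_term :: "'r lang \<Rightarrow> fo_term \<Rightarrow> bool" where
  "wf_term L (Var x) \<longleftrightarrow> True"
| "wf_term L (Cst c) \<longleftrightarrow> c \<in> csts L"

fun free_vars :: "'r fo_formula \<Rightarrow> nat set" where
  "free_vars (Eq s t) = term_vars s \<union> term_vars t"
| "free_vars (Rel S ts) = (\<Union>t\<in>set ts. term_vars t)"
| "free_vars (Neg \<phi>) = free_vars \<phi>"
| "free_vars (Conj \<phi> \<psi>) = free_vars \<phi> \<union> free_vars \<psi>"
| "free_vars (Ex x \<phi>) = free_vars \<phi> - {x}"

fun wf_formula :: "'r lang \<Rightarrow> 'r fo_formula \<Rightarrow> bool" where
  "wf_formula L (Eq s t) \<longleftrightarrow> wf_term L s \<and> wf_term L t"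
| "wf_formula L (Rel S ts) \<longleftrightarrow> S \<in> syms L \<and> length ts = arity L S \<and> (\<forall>t\<in>set ts. wf_term L t)"
| "wf_formula L (Neg \<phi>) \<longleftrightarrow> wf_formula L \<phi>"
| "wf_formula L (Conj \<phi> \<psi>) \<longleftrightarrow> wf_formula L \<phi> \<and> wf_formula L \<psi>"
| "wf_formula L (Ex x \<phi>) \<longleftrightarrow> wf_formula L \<phi>"

definition sentences :: "'r lang \<Rightarrow> 'r fo_formula set" where
  "sentences L = {\<phi>. wf_formula L \<phi> \<and> free_vars \<phi> = {}}"

fun eval_term :: "('a, 'r) fo_struct \<Rightarrow> (nat \<Rightarrow> 'a) \<Rightarrow> fo_term \<Rightarrow> 'a" where
  "eval_term M v (Var x) = v x"
| "eval_term M v (Cst c) = cst M c"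

fun sat :: "('a, 'r) fo_struct \<Rightarrow> (nat \<Rightarrow> 'a) \<Rightarrow> 'r fo_formula \<Rightarrow> bool" where
  "sat M v (Eq s t) \<longleftrightarrow> eval_term M v s = eval_term M v t"
| "sat M v (Rel S ts) \<longleftrightarrow> map (eval_term M v) ts \<in> rel M S"
| "sat M v (Neg \<phi>) \<longleftrightarrow> \<not> sat M v \<phi>"
| "sat M v (Conj \<phi> \<psi>) \<longleftrightarrow> sat M v \<phi> \<and> sat M v \<psi>"
| "sat M v (Ex x \<phi>) \<longleftrightarrow> (\<exists>a\<in>universe M. sat M (v(x := a)) \<phi>)"

definition models :: "('a, 'r) fo_struct \<Rightarrow> 'r fo_formula \<Rightarrow> bool" (infix \<open>\<Turnstile>\<close> 50) where
  "M \<Turnstile> \<phi> \<longleftrightarrow> (\<forall>v. range v \<subseteq> universe M \<longrightarrow> sat M v \<phi>)"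

definition elem_equiv :: "'r lang \<Rightarrow> ('a, 'r) fo_struct \<Rightarrow> ('b, 'r) fo_struct \<Rightarrow> bool" where
  "elem_equiv L M N \<longleftrightarrow>
     fo_structure L M \<and> fo_structure L N \<and> (\<forall>\<phi>\<in>sentences L. M \<Turnstile> \<phi> \<longleftrightarrow> N \<Turnstile> \<phi>)"

definition el_convergent :: "'r lang \<Rightarrow> (nat \<Rightarrow> ('a, 'r) fo_struct) \<Rightarrow> bool" where
  "el_convergent L M \<longleftrightarrow>
     (\<forall>n. fo_structure L (M n)) \<and>
     (\<forall>\<phi>\<in>sentences L. (\<forall>\<^sub>F n in sequentially. M n \<Turnstile> \<phi>) \<or> (\<forall>\<^sub>F n in sequentially. M n \<Turnstile> Neg \<phi>))"

definition el_limit :: "'r lang \<Rightarrow> (nat \<Rightarrow> ('a, 'r) fo_struct) \<Rightarrow> ('b, 'r) fo_struct \<Rightarrow> bool" where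
  "el_limit L M N \<longleftrightarrow>
     fo_structure L N \<and> (\<forall>\<phi>\<in>sentences L. N \<Turnstile> \<phi> \<longleftrightarrow> (\<forall>\<^sub>F n in sequentially. M n \<Turnstile> \<phi>))"


section \<open>Gaifman graph\<close>

definition gaifman :: "'r lang \<Rightarrow> ('a, 'r) fo_struct \<Rightarrow> ('a \<times> 'a) set" where
  "gaifman L M = {(x, y). x \<noteq> y \<and> (\<exists>S\<in>syms L. \<exists>t\<in>rel M S. x \<in> set t \<and> y \<in> set t)}"

text \<open>The infimum of the empty set in \<^typ>\<open>enat\<close> is \<^term>\<open>\<infinity> :: enat\<close>.\<close>

definition gaifman_dist :: "'r lang \<Rightarrow> ('a, 'r) fo_struct \<Rightarrow> 'a \<Rightarrow> 'a \<Rightarrow> enat" where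
  "gaifman_dist L M x y = (INF d\<in>{d. (x, y) \<in> gaifman L M ^^ d}. enat d)"

definition component :: "'r lang \<Rightarrow> ('a, 'r) fo_struct \<Rightarrow> 'a \<Rightarrow> 'a set" where
  "component L M x = {y \<in> universe M. (x, y) \<in> (gaifman L M)\<^sup>*}"


section \<open>Base structures, gadgets and the gadget construction\<close>

text \<open>
  Throughout, \<open>k\<close> is the arity of the replaced symbol \<open>R\<close>. Roots and coordinates of tuples are
  numbered from 0, so the roots of a gadget are the constants \<open>0, \<dots>, k - 1\<close>.
\<close>

definition base_lang :: "'r lang \<Rightarrow> 'r \<Rightarrow> nat \<Rightarrow> 'r lang" where
  "base_lang L R k = L\<lparr>syms := insert R (syms L), arity := (arity L)(R := k)\<rparr>"

definition gadget_lang :: "'r lang \<Rightarrow> nat \<Rightarrow> 'r lang" where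
  "gadget_lang L k = L\<lparr>csts := {..<k}\<rparr>"

definition base_structure :: "'r lang \<Rightarrow> 'r \<Rightarrow> nat \<Rightarrow> ('a, 'r) fo_struct \<Rightarrow> bool" where
  "base_structure L R k A \<longleftrightarrow> fo_structure (base_lang L R k) A"

definition gadget :: "'r lang \<Rightarrow> nat \<Rightarrow> ('g, 'r) fo_struct \<Rightarrow> bool" where
  "gadget L k G \<longleftrightarrow> fo_structure (gadget_lang L k) G \<and> inj_on (cst G) {..<k}"

definition eq_class :: "('a \<Rightarrow> 'a \<Rightarrow> bool) \<Rightarrow> 'a \<Rightarrow> 'a set" where
  "eq_class r x = {y. equivclp r x y}"

definition glue ::
  "'r \<Rightarrow> nat \<Rightarrow> ('a, 'r) fo_struct \<Rightarrow> ('g, 'r) fo_struct \<Rightarrow> 'a + 'a list \<times> 'g \<Rightarrow> 'a + 'a list \<times> 'g \<Rightarrow> bool"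
  where
  "glue R k A G x y \<longleftrightarrow> (\<exists>e\<in>rel A R. \<exists>i<k. x = Inl (e ! i) \<and> y = Inr (e, cst G i))"

definition gadget_product ::
  "'r lang \<Rightarrow> 'r \<Rightarrow> nat \<Rightarrow> ('a, 'r) fo_struct \<Rightarrow> ('g, 'r) fo_struct \<Rightarrow> (('a + 'a list \<times> 'g) set, 'r) fo_struct"
  where
  "gadget_product L R k A G =
     (let cls = eq_class (glue R k A G) in
      \<lparr>universe = cls ` (Inl ` universe A \<union> Inr ` (rel A R \<times> universe G)),
       rel = (\<lambda>S. if S \<in> syms L
                  then {map (\<lambda>a. cls (Inl a)) t |t. t \<in> rel A S} \<union>
                       {map (\<lambda>v. cls (Inr (e, v))) t |e t. e \<in> rel A R \<and> t \<in> rel G S}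
                  else {}),
       cst = (\<lambda>_. undefined)\<rparr>)"


section \<open>Fragmentation\<close>

text \<open>
  The symbols \<open>R\<^sub>0, \<dots>, R\<^sub>l\<close> are indexed by the sets \<open>X\<^sub>0 = {}, X\<^sub>1, \<dots>, X\<^sub>l\<close> themselves
  instead of by a numbering of the classes of \<open>\<sigma>\<close>; the classes are nonempty, so these indices are distinct.
\<close>

datatype 'r frag_sym = Orig 'r | Frag "nat set"

definition frag_index :: "nat \<Rightarrow> (nat \<times> nat) set \<Rightarrow> nat set set" where
  "frag_index k \<sigma> = insert {} ({..<k} // \<sigma>)"

definition frag_lang :: "'r lang \<Rightarrow> nat \<Rightarrow> (nat \<times> nat) set \<Rightarrow> 'r frag_sym lang" where
  "frag_lang L k \<sigma> =
     \<lparr>syms = Orig ` syms L \<union> Frag ` frag_index k \<sigma>,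
      arity = (\<lambda>T. case T of Orig S \<Rightarrow> arity L S | Frag X \<Rightarrow> card X + 1),
      csts = {}\<rparr>"

datatype gad_vertex = Root nat | AuxVertex "nat set"

definition Gad :: "nat \<Rightarrow> (nat \<times> nat) set \<Rightarrow> (gad_vertex, 'r frag_sym) fo_struct" where
  "Gad k \<sigma> =
     \<lparr>universe = Root ` {..<k} \<union> AuxVertex ` frag_index k \<sigma>,
      rel = (\<lambda>T. case T of
               Orig S \<Rightarrow> {}
             | Frag X \<Rightarrow> if X \<in> frag_index k \<sigma>
                         then {map Root (sorted_list_of_set X) @ [AuxVertex X]} else {}),
      cst = Root\<rparr>"

text \<open>A base structure over \<open>L\<close> and \<open>R\<close>, read as one over the fragmented language and \<open>R\<close>.\<close>

definition embed_base :: "('a, 'r) fo_struct \<Rightarrow> ('a, 'r frag_sym) fo_struct" where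
  "embed_base A =
     \<lparr>universe = universe A,
      rel = (\<lambda>T. case T of Orig S \<Rightarrow> rel A S | Frag X \<Rightarrow> {}),
      cst = cst A\<rparr>"

definition fragmentation ::
  "'r lang \<Rightarrow> 'r \<Rightarrow> nat \<Rightarrow> (nat \<times> nat) set \<Rightarrow> ('a, 'r) fo_struct \<Rightarrow>
   (('a + 'a list \<times> gad_vertex) set, 'r frag_sym) fo_struct"
  where
  "fragmentation L R k \<sigma> A = gadget_product (frag_lang L k \<sigma>) (Orig R) k (embed_base A) (Gad k \<sigma>)"


section \<open>Replacing the edges of a fragmented structure\<close>

definition aux_vertices :: "nat \<Rightarrow> (nat \<times> nat) set \<Rightarrow> ('b, 'r frag_sym) fo_struct \<Rightarrow> 'b set" where
  "aux_vertices k \<sigma> B = {last e |X e. X \<in> frag_index k \<sigma> \<and> e \<in> rel B (Frag X)}"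

text \<open>
  The vertex set of the part of \<open>H\<close> belonging to \<open>X\<close>. When the roots in a nonempty \<open>X\<close> lie in
  one component of \<open>H\<close>, the union below is that component.
\<close>

definition frag_part :: "'r lang \<Rightarrow> nat \<Rightarrow> ('h, 'r) fo_struct \<Rightarrow> nat set \<Rightarrow> 'h set" where
  "frag_part L k H X =
     (if X = {} then {v \<in> universe H. \<forall>j<k. v \<notin> component L H (cst H j)}
      else (\<Union>j\<in>X. component L H (cst H j)))"

definition frag_glue ::
  "nat \<Rightarrow> (nat \<times> nat) set \<Rightarrow> ('b, 'r frag_sym) fo_struct \<Rightarrow> ('h, 'r) fo_struct \<Rightarrow>
   'b + nat set \<times> 'b list \<times> 'h \<Rightarrow> 'b + nat set \<times> 'b list \<times> 'h \<Rightarrow> bool"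
  where
  "frag_glue k \<sigma> B H x y \<longleftrightarrow>
     (\<exists>X\<in>frag_index k \<sigma>. \<exists>e\<in>rel B (Frag X). \<exists>p<card X.
        x = Inl (e ! p) \<and> y = Inr (X, e, cst H (sorted_list_of_set X ! p)))"

definition frag_product ::
  "'r lang \<Rightarrow> nat \<Rightarrow> (nat \<times> nat) set \<Rightarrow> ('b, 'r frag_sym) fo_struct \<Rightarrow> ('h, 'r) fo_struct \<Rightarrow>
   (('b + nat set \<times> 'b list \<times> 'h) set, 'r) fo_struct"
  where
  "frag_product L k \<sigma> B H =
     (let cls = eq_class (frag_glue k \<sigma> B H); aux = aux_vertices k \<sigma> B in
      \<lparr>universe = cls ` (Inl ` (universe B - aux) \<union>
                {Inr (X, e, v) |X e v. X \<in> frag_index k \<sigma> \<and> e \<in> rel B (Frag X) \<and> v \<in> frag_part L k H X}),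
       rel = (\<lambda>S. if S \<in> syms L
                  then {map (\<lambda>b. cls (Inl b)) t |t. t \<in> rel B (Orig S) \<and> set t \<inter> aux = {}} \<union>
                       {map (\<lambda>v. cls (Inr (X, e, v))) t |X e t.
                          X \<in> frag_index k \<sigma> \<and> e \<in> rel B (Frag X) \<and>
                          t \<in> rel H S \<and> set t \<subseteq> frag_part L k H X}
                  else {}),
       cst = (\<lambda>_. undefined)\<rparr>)"

end

theory Submission
  imports Defs "HOL-Library.Countable_Set"
begin

text \<open>
  Pass to ultraproducts. Along a free ultrafilter the structures \<open>A\<^sub>n * G\<^sub>n\<close> become the structure glued from
  the ultraproducts of the \<open>A\<^sub>n\<^sup>\<sigma>\<close> and of the \<open>G\<^sub>n\<close>, because in the latter roots from different classes of
  \<open>\<sigma>\<close> are no longer connected; an ultrapower of \<open>B *\<^sub>\<sigma> H\<close> is glued from ultrapowers of \<open>B\<close> and \<open>H\<close>, but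
  components of \<open>H\<close> without roots may be attached to any class. Ultraproducts are saturated, so
  elementary equivalence of the ingredients gives back-and-forth systems between them, and these combine
  to one between the glued structures: components with roots follow the game on the
  fragmented base structures, while a component without roots is answered by any unused component of the
  same type. The latter exists because all sorts of edges \<open>R\<^sub>i\<close> occur equally often, so both glued
  structures have the same number of components of each type, up to infinity.
\<close>

section \<open>Back-and-forth systems\<close>

text \<open>The obstacle is that lying in a common component is not first-order: a game with
  finitely many rounds on the original sequences would have to balance radii and counting thresholds
  against the rounds that remain. In saturated structures the game may be infinite, and an infinite
  game preserves connectivity outright (\<open>bf_connected\<close>), so positions carry no rank and
  no radius. Saturation for countable types is enough, since the languages are finite. The price is
  that an ultrapower of \<open>H\<close> has components without roots that \<open>H\<close> itself
  may lack: they consist of sequences that stay in a rooted component of \<open>H\<close> but run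
  away from its roots. The product formed from \<open>H\<close> still attaches such a component to
  the class it came from, while the other side has no trace of this class. Hence rootless components
  cannot be matched sort by sort, and only their total number over all sorts is comparable.
  Convergence itself is obtained by comparing two ultrafilters: a sentence that is not eventually
  decided holds along one free ultrafilter and fails along another.\<close>

lemma eval_term_cong:
  "(\<And>x. x \<in> term_vars s \<Longrightarrow> v x = w x) \<Longrightarrow> eval_term M v s = eval_term M w s"
  by (cases s) auto

lemma sat_cong:
  "(\<And>x. x \<in> free_vars \<phi> \<Longrightarrow> v x = w x) \<Longrightarrow> sat M v \<phi> \<longleftrightarrow> sat M w \<phi>"
proof (induction \<phi> arbitrary: v w)
  case (Eq s t)
  then show ?case using eval_term_cong[of s v w M] eval_term_cong[of t v w M] by simp
next
  case (Rel S ts)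
  have "map (eval_term M v) ts = map (eval_term M w) ts"
    using Rel by (intro map_cong refl eval_term_cong) auto
  then show ?case by (simp only: sat.simps)
next
  case (Neg \<phi>)
  then have "sat M v \<phi> \<longleftrightarrow> sat M w \<phi>" by (intro Neg.IH) auto
  then show ?case by simp
next
  case (Conj \<phi> \<psi>)
  have "sat M v \<phi> \<longleftrightarrow> sat M w \<phi>" "sat M v \<psi> \<longleftrightarrow> sat M w \<psi>"
    by (rule Conj.IH, simp add: Conj.prems)+
  then show ?case by simp
next
  case (Ex x \<phi>)
  have "sat M (v(x := a)) \<phi> \<longleftrightarrow> sat M (w(x := a)) \<phi>" for a
    using Ex.prems by (intro Ex.IH) auto
  then show ?case by simp
qed

lemma models_sentence:
  assumes "free_vars \<phi> = {}" "universe M \<noteq> {}"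
  shows "M \<Turnstile> \<phi> \<longleftrightarrow> sat M v \<phi>"
proof -
  obtain a where "a \<in> universe M" using assms(2) by auto
  then have "range (\<lambda>_::nat. a) \<subseteq> universe M" by auto
  then show ?thesis unfolding models_def using assms(1) sat_cong[of \<phi>] by (metis empty_iff)
qed

lemma models_Neg:
  assumes "free_vars \<phi> = {}" "universe M \<noteq> {}"
  shows "M \<Turnstile> Neg \<phi> \<longleftrightarrow> \<not> M \<Turnstile> \<phi>"
  using models_sentence[of \<phi> M undefined] models_sentence[of "Neg \<phi>" M undefined] assms by simp

text \<open>Positions are relations closed under subsets, so they may be thinned out freely.
  Constants are compared with played points only, instead of being put into every position; thus a
  game can begin at \<open>{}\<close>.\<close>

definition bf_system ::
  "'r lang \<Rightarrow> ('a, 'r) fo_struct \<Rightarrow> ('b, 'r) fo_struct \<Rightarrow> ('a \<times> 'b) set set \<Rightarrow> bool" where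
  "bf_system L M N Q \<longleftrightarrow> (\<forall>q\<in>Q.
     q \<subseteq> universe M \<times> universe N \<and>
     (\<forall>q'. q' \<subseteq> q \<longrightarrow> q' \<in> Q) \<and>
     (\<forall>a a' b b'. (a, a') \<in> q \<longrightarrow> (b, b') \<in> q \<longrightarrow> (a = b \<longleftrightarrow> a' = b')) \<and>
     (\<forall>S\<in>syms L. \<forall>t t'. length t = length t' \<longrightarrow> set (zip t t') \<subseteq> q \<longrightarrow>
        (t \<in> rel M S \<longleftrightarrow> t' \<in> rel N S)) \<and>
     (\<forall>c\<in>csts L. \<forall>a a'. (a, a') \<in> q \<longrightarrow> (a = cst M c \<longleftrightarrow> a' = cst N c)) \<and>
     (\<forall>a\<in>universe M. \<exists>a'. insert (a, a') q \<in> Q) \<and>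
     (\<forall>a'\<in>universe N. \<exists>a. insert (a, a') q \<in> Q))"

text \<open>Lying in some system amounts to a winning strategy for the answering player in the game
  of infinite length that starts at \<open>q\<close>.\<close>

definition bf ::
  "'r lang \<Rightarrow> ('a, 'r) fo_struct \<Rightarrow> ('b, 'r) fo_struct \<Rightarrow> ('a \<times> 'b) set \<Rightarrow> bool" where
  "bf L M N q \<longleftrightarrow> (\<exists>Q. bf_system L M N Q \<and> q \<in> Q)"

lemma bf_systemD:
  assumes "bf_system L M N Q" "q \<in> Q"
  shows "q \<subseteq> universe M \<times> universe N"
    and "\<And>q'. q' \<subseteq> q \<Longrightarrow> q' \<in> Q"
    and "\<And>a a' b b'. (a, a') \<in> q \<Longrightarrow> (b, b') \<in> q \<Longrightarrow> a = b \<longleftrightarrow> a' = b'"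
    and "\<And>S t t'. S \<in> syms L \<Longrightarrow> length t = length t' \<Longrightarrow> set (zip t t') \<subseteq> q \<Longrightarrow>
        t \<in> rel M S \<longleftrightarrow> t' \<in> rel N S"
    and "\<And>c a a'. c \<in> csts L \<Longrightarrow> (a, a') \<in> q \<Longrightarrow> a = cst M c \<longleftrightarrow> a' = cst N c"
    and "\<And>a. a \<in> universe M \<Longrightarrow> \<exists>a'. insert (a, a') q \<in> Q"
    and "\<And>a'. a' \<in> universe N \<Longrightarrow> \<exists>a. insert (a, a') q \<in> Q"
  using assms(1)[unfolded bf_system_def, rule_format, OF assms(2)] by simp_all

lemma bf_systemI:
  assumes "\<And>q. q \<in> Q \<Longrightarrow> q \<subseteq> universe M \<times> universe N"
    and "\<And>q q'. q \<in> Q \<Longrightarrow> q' \<subseteq> q \<Longrightarrow> q' \<in> Q"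
    and "\<And>q a a' b b'. q \<in> Q \<Longrightarrow> (a, a') \<in> q \<Longrightarrow> (b, b') \<in> q \<Longrightarrow> a = b \<longleftrightarrow> a' = b'"
    and "\<And>q S t t'. q \<in> Q \<Longrightarrow> S \<in> syms L \<Longrightarrow> length t = length t' \<Longrightarrow> set (zip t t') \<subseteq> q \<Longrightarrow>
        t \<in> rel M S \<longleftrightarrow> t' \<in> rel N S"
    and "\<And>q c a a'. q \<in> Q \<Longrightarrow> c \<in> csts L \<Longrightarrow> (a, a') \<in> q \<Longrightarrow> a = cst M c \<longleftrightarrow> a' = cst N c"
    and "\<And>q a. q \<in> Q \<Longrightarrow> a \<in> universe M \<Longrightarrow> \<exists>a'. insert (a, a') q \<in> Q"
    and "\<And>q a'. q \<in> Q \<Longrightarrow> a' \<in> universe N \<Longrightarrow> \<exists>a. insert (a, a') q \<in> Q"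
  shows "bf_system L M N Q"
  unfolding bf_system_def by (intro ballI conjI allI impI) (fact assms)+

lemma bf_universe: "bf L M N q \<Longrightarrow> (a, a') \<in> q \<Longrightarrow> a \<in> universe M \<and> a' \<in> universe N"
  unfolding bf_def by (auto dest!: bf_systemD(1))

lemma bf_mono: "bf L M N q \<Longrightarrow> q' \<subseteq> q \<Longrightarrow> bf L M N q'"
  unfolding bf_def using bf_systemD(2) by blast

lemma bf_eq: "bf L M N q \<Longrightarrow> (a, a') \<in> q \<Longrightarrow> (b, b') \<in> q \<Longrightarrow> a = b \<longleftrightarrow> a' = b'"
  unfolding bf_def using bf_systemD(3) by fast

lemma bf_rel:
  "bf L M N q \<Longrightarrow> S \<in> syms L \<Longrightarrow> length t = length t' \<Longrightarrow> set (zip t t') \<subseteq> q \<Longrightarrow>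
   t \<in> rel M S \<longleftrightarrow> t' \<in> rel N S"
  unfolding bf_def by (auto dest: bf_systemD(4))

lemma bf_cst: "bf L M N q \<Longrightarrow> c \<in> csts L \<Longrightarrow> (a, a') \<in> q \<Longrightarrow> a = cst M c \<longleftrightarrow> a' = cst N c"
  unfolding bf_def using bf_systemD(5) by fast

lemma bf_forth: "bf L M N q \<Longrightarrow> a \<in> universe M \<Longrightarrow> \<exists>a'. bf L M N (insert (a, a') q)"
  unfolding bf_def using bf_systemD(6) by fast

lemma bf_back: "bf L M N q \<Longrightarrow> a' \<in> universe N \<Longrightarrow> \<exists>a. bf L M N (insert (a, a') q)"
  unfolding bf_def using bf_systemD(7) by fast

lemma set_zip_converse: "(set (zip t t'))\<inverse> = set (zip t' t)"
  by (auto simp: set_zip)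

lemma bf_system_converse:
  assumes "bf_system L M N Q"
  shows "bf_system L N M {q. q\<inverse> \<in> Q}"
proof (rule bf_systemI)
  fix q assume "q \<in> {q. q\<inverse> \<in> Q}"
  then have q: "q\<inverse> \<in> Q" by simp
  note D = bf_systemD[OF assms q]
  have ins: "insert (a, b) (q\<inverse>) = (insert (b, a) q)\<inverse>" for a b by auto
  show "q \<subseteq> universe N \<times> universe M" using D(1) by auto
  show "q' \<in> {q. q\<inverse> \<in> Q}" if "q' \<subseteq> q" for q' using D(2)[of "q'\<inverse>"] that by simp
  show "a = b \<longleftrightarrow> a' = b'" if "(a, a') \<in> q" "(b, b') \<in> q" for a a' b b' using D(3) that by auto
  show "t \<in> rel N S \<longleftrightarrow> t' \<in> rel M S"
    if "S \<in> syms L" "length t = length t'" "set (zip t t') \<subseteq> q" for S t t'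
  proof -
    have "set (zip t' t) \<subseteq> q\<inverse>" using that(3) set_zip_converse by fastforce
    then show ?thesis using D(4)[OF that(1), of t' t] that(2) by simp
  qed
  show "a = cst N c \<longleftrightarrow> a' = cst M c" if "c \<in> csts L" "(a, a') \<in> q" for c a a' using D(5) that by auto
  show "\<exists>a'. insert (a, a') q \<in> {q. q\<inverse> \<in> Q}" if "a \<in> universe N" for a
    using D(7)[OF that] unfolding ins by blast
  show "\<exists>a. insert (a, a') q \<in> {q. q\<inverse> \<in> Q}" if "a' \<in> universe M" for a'
    using D(6)[OF that] unfolding ins by blast
qed

lemma bf_converse: "bf L M N q \<Longrightarrow> bf L N M (q\<inverse>)"
  unfolding bf_def using bf_system_converse[of L M N] by fastforce

lemma bf_extend_list:
  assumes "bf L M N q" "set t \<subseteq> universe M"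
  shows "\<exists>t'. length t' = length t \<and> bf L M N (q \<union> set (zip t t'))"
  using assms
proof (induction t arbitrary: q)
  case Nil
  then show ?case by simp
next
  case (Cons a t)
  obtain a' where "bf L M N (insert (a, a') q)" using bf_forth Cons.prems by fastforce
  then obtain t' where "length t' = length t" "bf L M N (insert (a, a') q \<union> set (zip t t'))"
    using Cons.IH Cons.prems by fastforce
  then show ?case by (intro exI[of _ "a' # t'"]) auto
qed

text \<open>Whatever answers the constant is forced by the clause on constants, so constants can be
  added to any position after the fact.\<close>

lemma bf_insert_cst:
  assumes "bf L M N q" "c \<in> csts L" "cst M c \<in> universe M"
  shows "bf L M N (insert (cst M c, cst N c) q)"
proof -
  obtain a' where a: "bf L M N (insert (cst M c, a') q)" using bf_forth assms by fastforce
  then have "a' = cst N c" using bf_cst[OF a assms(2), of "cst M c" a'] by simp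
  then show ?thesis using a by simp
qed

lemma bf_union_csts:
  assumes "bf L M N q" "finite C" "C \<subseteq> csts L" "\<And>c. c \<in> C \<Longrightarrow> cst M c \<in> universe M"
  shows "bf L M N (q \<union> (\<lambda>c. (cst M c, cst N c)) ` C)"
  using assms(2-)
proof (induction C rule: finite_induct)
  case empty
  then show ?case using assms(1) by simp
next
  case (insert c C)
  then show ?case using bf_insert_cst[of L M N "q \<union> (\<lambda>c. (cst M c, cst N c)) ` C" c] by simp
qed

text \<open>A move passes through \<open>N\<close>: the answer in one game is played as a challenge
  in the other. This makes having the same type composable, on which the counting of components
  relies.\<close>

lemma bf_trans:
  assumes "bf L M N p" "bf L N P q"
  shows "bf L M P (p O q)"
proof -
  define Q where "Q = {r. \<exists>p q. bf L M N p \<and> bf L N P q \<and> r \<subseteq> p O q}"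
  have "bf_system L M P Q"
  proof (rule bf_systemI)
    fix r assume "r \<in> Q"
    then obtain p q where p: "bf L M N p" and q: "bf L N P q" and r: "r \<subseteq> p O q"
      unfolding Q_def by blast
    show "t \<in> rel M S \<longleftrightarrow> t'' \<in> rel P S"
      if S: "S \<in> syms L" and len: "length t = length t''" and z: "set (zip t t'') \<subseteq> r" for S t t''
    proof -
      have "\<forall>i<length t. \<exists>b. (t ! i, b) \<in> p \<and> (b, t'' ! i) \<in> q"
        using z r len by (fastforce simp: set_zip)
      then obtain f where f: "\<And>i. i < length t \<Longrightarrow> (t ! i, f i) \<in> p \<and> (f i, t'' ! i) \<in> q" by metis
      define t' where "t' = map f [0..<length t]"
      have "set (zip t t') \<subseteq> p" "set (zip t' t'') \<subseteq> q" "length t = length t'"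
        using f len by (auto simp: t'_def set_zip)
      then show ?thesis using bf_rel[OF p S] bf_rel[OF q S] len by metis
    qed
    show "\<exists>c. insert (a, c) r \<in> Q" if a: "a \<in> universe M" for a
    proof -
      obtain b where b: "bf L M N (insert (a, b) p)" using bf_forth[OF p a] by blast
      then have "b \<in> universe N" using bf_universe by fastforce
      then obtain c where "bf L N P (insert (b, c) q)" using bf_forth[OF q] by blast
      then show ?thesis using b r unfolding Q_def by blast
    qed
    show "\<exists>a. insert (a, c) r \<in> Q" if c: "c \<in> universe P" for c
    proof -
      obtain b where b: "bf L N P (insert (b, c) q)" using bf_back[OF q c] by blast
      then have "b \<in> universe N" using bf_universe by fastforce
      then obtain a where "bf L M N (insert (a, b) p)" using bf_back[OF p] by blast
      then show ?thesis using b r unfolding Q_def by blast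
    qed
    show "a = a1 \<longleftrightarrow> c = c1" if "(a, c) \<in> r" "(a1, c1) \<in> r" for a c a1 c1
      using that r bf_eq[OF p] bf_eq[OF q] by blast
    show "a = cst M d \<longleftrightarrow> c = cst P d" if "d \<in> csts L" "(a, c) \<in> r" for a c d
      using that r bf_cst[OF p] bf_cst[OF q] by blast
    show "r \<subseteq> universe M \<times> universe P" using r bf_universe[OF p] bf_universe[OF q] by blast
    show "q' \<in> Q" if "q' \<subseteq> r" for q' using that p q r unfolding Q_def by blast
  qed
  moreover have "p O q \<in> Q" using assms unfolding Q_def by blast
  ultimately show ?thesis unfolding bf_def by blast
qed

text \<open>Without constants every term is a variable, so the values of all terms are played
  points.\<close>

lemma sat_bf:
  assumes "csts L = {}" "wf_formula L \<phi>" "bf L M N q" "\<And>x. x \<in> free_vars \<phi> \<Longrightarrow> (v x, w x) \<in> q"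
  shows "sat M v \<phi> \<longleftrightarrow> sat N w \<phi>"
  using assms(2-)
proof (induction \<phi> arbitrary: q v w)
  case (Eq s t)
  then obtain x y where "s = Var x" "t = Var y" using assms(1) by (cases s; cases t) auto
  then show ?case using Eq bf_eq[OF Eq(2), of "v x" "w x" "v y" "w y"] by auto
next
  case (Rel S ts)
  have V: "\<exists>x. t = Var x" if "t \<in> set ts" for t using Rel(1) assms(1) that by (cases t) auto
  have "(eval_term M v t, eval_term N w t) \<in> q" if "t \<in> set ts" for t
    using V[OF that] Rel(3) that by fastforce
  then have "set (zip (map (eval_term M v) ts) (map (eval_term N w) ts)) \<subseteq> q"
    by (auto simp: set_zip)
  then show ?case using bf_rel[OF Rel(2), of S] Rel(1) by simp
next
  case (Neg \<phi>)
  have "sat M v \<phi> \<longleftrightarrow> sat N w \<phi>" using Neg.prems by (intro Neg.IH[OF _ Neg.prems(2)]) auto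
  then show ?case by simp
next
  case (Conj \<phi> \<psi>)
  have "sat M v \<phi> \<longleftrightarrow> sat N w \<phi>" "sat M v \<psi> \<longleftrightarrow> sat N w \<psi>"

    by (rule Conj.IH[OF _ Conj.prems(2)]; use Conj.prems in simp)+
  then show ?case by simp
next
  case (Ex x \<phi>)
  have *: "sat M (v(x := a)) \<phi> \<longleftrightarrow> sat N (w(x := a')) \<phi>" if "bf L M N (insert (a, a') q)" for a a'
    using Ex.prems by (intro Ex.IH[OF _ that]) auto
  show ?case
  proof
    assume "sat M v (Ex x \<phi>)"
    then obtain a where a: "a \<in> universe M" "sat M (v(x := a)) \<phi>"
      unfolding sat.simps by blast
    then obtain a' where "bf L M N (insert (a, a') q)" using bf_forth[OF Ex.prems(2) a(1)] by blast
    then show "sat N w (Ex x \<phi>)" using a(2) *[of a a'] bf_universe[of L M N _ a a'] by auto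
  next
    assume "sat N w (Ex x \<phi>)"
    then obtain a' where a: "a' \<in> universe N" "sat N (w(x := a')) \<phi>"
      unfolding sat.simps by blast
    then obtain a where "bf L M N (insert (a, a') q)" using bf_back[OF Ex.prems(2) a(1)] by blast
    then show "sat M v (Ex x \<phi>)" using a(2) *[of a a'] bf_universe[of L M N _ a a'] by auto
  qed
qed

section \<open>Gaifman distance and connectivity under back-and-forth\<close>

lemma gaifman_sym: "(x, y) \<in> gaifman L M \<Longrightarrow> (y, x) \<in> gaifman L M"
  unfolding gaifman_def by auto

lemma gaifman_rtrancl_sym: "(x, y) \<in> (gaifman L M)\<^sup>* \<Longrightarrow> (y, x) \<in> (gaifman L M)\<^sup>*"
  by (meson gaifman_sym symI symD sym_rtrancl)

lemma same_tuple_connected: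
  "S \<in> syms L \<Longrightarrow> t \<in> rel M S \<Longrightarrow> x \<in> set t \<Longrightarrow> y \<in> set t \<Longrightarrow> (x, y) \<in> (gaifman L M)\<^sup>*"
  unfolding gaifman_def by (cases "x = y") (auto intro!: r_into_rtrancl)

lemma gaifman_universe:
  assumes "fo_structure L M" "(x, y) \<in> gaifman L M"
  shows "x \<in> universe M \<and> y \<in> universe M"
  using assms unfolding gaifman_def fo_structure_def by blast

text \<open>The tuple witnessing adjacency is played entry by entry; as equality is preserved,
  \<open>x'\<close> and \<open>y'\<close> must occur in the answer.\<close>

lemma bf_gaifman:
  assumes "fo_structure L M" "bf L M N q" "(x, x') \<in> q" "(y, y') \<in> q" "(x, y) \<in> gaifman L M"
  shows "(x', y') \<in> gaifman L N"
proof -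
  obtain S t where S: "S \<in> syms L" and t: "t \<in> rel M S" "x \<in> set t" "y \<in> set t" and ne: "x \<noteq> y"
    using assms(5) unfolding gaifman_def by blast
  have "set t \<subseteq> universe M" using assms(1) S t(1) unfolding fo_structure_def by blast
  then obtain t' where len: "length t' = length t" and b: "bf L M N (q \<union> set (zip t t'))"
    using bf_extend_list[OF assms(2)] by blast
  have t': "t' \<in> rel N S" using bf_rel[OF b S, of t t'] len t(1) by simp
  have "u' \<in> set t'" if u: "(u, u') \<in> q" "u \<in> set t" for u u'
  proof -
    obtain i where i: "i < length t" "t ! i = u" using u(2) by (auto simp: in_set_conv_nth)
    then have "(u, t' ! i) \<in> set (zip t t')" using len by (auto simp: set_zip)
    then have "u' = t' ! i" using bf_eq[OF b, of u u' u "t' ! i"] u(1) by auto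
    then show ?thesis using i len by auto
  qed
  then have "x' \<in> set t'" "y' \<in> set t'" using assms(3,4) t by auto
  moreover have "x' \<noteq> y'" using bf_eq[OF assms(2-4)] ne by simp
  ultimately show ?thesis unfolding gaifman_def using S t' by blast
qed

text \<open>The inner vertices of the path are played one after another, so the position
  \<open>q\<close> varies in the induction.\<close>

lemma bf_gaifman_relpow:
  assumes "fo_structure L M" "bf L M N q" "(x, x') \<in> q" "(y, y') \<in> q" "(x, y) \<in> gaifman L M ^^ d"
  shows "(x', y') \<in> gaifman L N ^^ d"
  using assms(2-)
proof (induction d arbitrary: y y' q)
  case 0
  then show ?case using bf_eq[OF 0(1-3)] by simp
next
  case (Suc d)
  then obtain z where z: "(x, z) \<in> gaifman L M ^^ d" "(z, y) \<in> gaifman L M" by auto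
  obtain z' where b: "bf L M N (insert (z, z') q)"
    using bf_forth[OF Suc.prems(1)] gaifman_universe[OF assms(1) z(2)] by blast
  have "(x', z') \<in> gaifman L N ^^ d" using Suc.IH[OF b, of z z'] Suc.prems z by blast
  moreover have "(z', y') \<in> gaifman L N"
    using bf_gaifman[OF assms(1) b, of z z' y y'] z Suc.prems by blast
  ultimately show ?case by auto
qed

text \<open>Connectivity is not first-order, but a connecting path has some finite length and the
  game is long enough to play all of it.\<close>

lemma bf_connected:
  assumes "fo_structure L M" "fo_structure L N" "bf L M N q" "(x, x') \<in> q" "(y, y') \<in> q"
  shows "(x, y) \<in> (gaifman L M)\<^sup>* \<longleftrightarrow> (x', y') \<in> (gaifman L N)\<^sup>*"
  using bf_gaifman_relpow[OF assms(1,3-5)] bf_gaifman_relpow[OF assms(2) bf_converse[OF assms(3)], of x' x y' y]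
    assms(4,5) by (auto simp: rtrancl_power)

section \<open>Ultraproducts\<close>

locale free_ultrafilter =
  fixes U :: "nat filter"
  assumes free: "U \<le> sequentially" and proper: "U \<noteq> bot"
    and ultra: "eventually P U \<or> eventually (\<lambda>n. \<not> P n) U"
begin

lemma ev_not: "eventually (\<lambda>n. \<not> P n) U \<longleftrightarrow> \<not> eventually P U"
proof
  assume "eventually (\<lambda>n. \<not> P n) U"
  then show "\<not> eventually P U"
    using proper eventually_conj[of "\<lambda>n. \<not> P n" U P] by (auto simp: trivial_limit_def)
qed (use ultra in blast)

lemma ev_disj: "eventually (\<lambda>n. P n \<or> Q n) U \<longleftrightarrow> eventually P U \<or> eventually Q U"
proof
  assume d: "eventually (\<lambda>n. P n \<or> Q n) U"
  show "eventually P U \<or> eventually Q U"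
  proof (rule disjCI)
    assume "\<not> eventually Q U"
    then have "eventually (\<lambda>n. \<not> Q n) U" by (simp only: ev_not not_False_eq_True)
    with d show "eventually P U" by eventually_elim blast
  qed
qed (auto elim: eventually_mono)

lemma ev_imp: "eventually (\<lambda>n. P n \<longrightarrow> Q n) U \<longleftrightarrow> (eventually P U \<longrightarrow> eventually Q U)"
  unfolding imp_conv_disj ev_disj ev_not ..

lemma ev_iff: "eventually (\<lambda>n. P n \<longleftrightarrow> Q n) U \<longleftrightarrow> (eventually P U \<longleftrightarrow> eventually Q U)"
  unfolding iff_conv_conj_imp eventually_conj_iff ev_imp by blast

lemma ev_const: "eventually (\<lambda>n. P) U \<longleftrightarrow> P"
  using proper by (cases P) (auto simp: trivial_limit_def)

lemma ev_bex_finite: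
  assumes "finite I"
  shows "eventually (\<lambda>n. \<exists>i\<in>I. P i n) U \<longleftrightarrow> (\<exists>i\<in>I. eventually (P i) U)"
  using assms by (induction I rule: finite_induct) (simp_all add: ev_const ev_disj)

lemma ev_happens: "eventually P U \<Longrightarrow> \<exists>n. P n"
  using proper eventually_happens' by blast

lemma ev_sequentially: "eventually P sequentially \<Longrightarrow> eventually P U"
  using free le_filter_def by blast

text \<open>Diagonal argument: at index \<open>n\<close>, a witness is chosen for as long an initial
  segment of the conditions as is satisfiable there. Each single condition is then met at almost
  every index.\<close>

lemma countable_saturation:
  assumes "\<And>m. eventually (\<lambda>n. \<exists>c\<in>X n. \<forall>i<m. Q i n c) U"
  shows "\<exists>g. eventually (\<lambda>n. g n \<in> X n) U \<and> (\<forall>i::nat. eventually (\<lambda>n. Q i n (g n)) U)"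
proof -
  define P where "P m n \<longleftrightarrow> (\<exists>c\<in>X n. \<forall>i<m. Q i n c)" for m n
  \<comment> \<open>The cap \<open>m \<le> n\<close> keeps the maximum over a finite set; it costs
    nothing, because \<open>n \<ge> m\<close> holds almost everywhere along a free
    ultrafilter.\<close>
  define top where "top n = Max {m. m \<le> n \<and> P m n}" for n
  define g where "g n = (SOME c. c \<in> X n \<and> (\<forall>i<top n. Q i n c))" for n
  have P: "eventually (P m) U" for m using assms unfolding P_def by simp
  have g: "g n \<in> X n \<and> (\<forall>i<m. Q i n (g n))" if "m \<le> n" "P m n" for m n
  proof -
    have fin: "finite {m. m \<le> n \<and> P m n}" by simp
    have "top n \<in> {m. m \<le> n \<and> P m n}" unfolding top_def using that by (intro Max_in) auto
    then have "\<exists>c. c \<in> X n \<and> (\<forall>i<top n. Q i n c)" unfolding P_def by blast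
    then have "g n \<in> X n \<and> (\<forall>i<top n. Q i n (g n))" unfolding g_def by (rule someI_ex)
    moreover have "m \<le> top n" unfolding top_def using that by (intro Max_ge) auto
    ultimately show ?thesis by auto
  qed
  have *: "eventually (\<lambda>n. g n \<in> X n \<and> (\<forall>i<m. Q i n (g n))) U" for m
    using eventually_conj[OF P[of m] ev_sequentially[OF eventually_ge_at_top[of m]]]
    by (rule eventually_mono) (use g in blast)
  show ?thesis
  proof (intro exI[of _ g] conjI allI)
    show "eventually (\<lambda>n. g n \<in> X n) U" using *[of 0] by simp
    show "eventually (\<lambda>n. Q i n (g n)) U" for i using *[of "Suc i"] by (rule eventually_mono) simp
  qed
qed

end

text \<open>Zorn's lemma for proper filters below \<open>F\<close>, ordered by refinement. A finest
  one decides every \<open>P\<close>: if it does not contain the complement, adding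
  \<open>{n. P n}\<close> keeps it proper and therefore changes nothing.\<close>

lemma free_ultrafilter_exists:
  assumes "F \<noteq> bot" "F \<le> sequentially"
  shows "\<exists>U. free_ultrafilter U \<and> U \<le> F"
proof -
  define X where "X = {G. G \<noteq> bot \<and> G \<le> F}"
  have "\<exists>u\<in>X. \<forall>G\<in>C. u \<le> G" if C: "C \<in> Chains (relation_of (\<lambda>a b. b \<le> a) X)" for C
  proof (cases "C = {}")
    case True
    then show ?thesis using assms(1) unfolding X_def by auto
  next
    case False
    have sub: "C \<subseteq> X" and tot: "\<And>a b. a \<in> C \<Longrightarrow> b \<in> C \<Longrightarrow> a \<le> b \<or> b \<le> a"
      using C unfolding Chains_def relation_of_def by blast+
    \<comment> \<open>Because \<open>C\<close> is a chain, its members form a filter base, so the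
      infimum is proper whenever all members are.\<close>
    have "eventually P (Inf C) \<longleftrightarrow> (\<exists>G\<in>C. eventually P G)" for P
      using False tot by (intro eventually_Inf_base) (auto simp: inf_absorb1 inf_absorb2 le_infI1 le_infI2)
    then have "Inf C \<noteq> bot" using sub unfolding X_def trivial_limit_def by blast
    moreover have "Inf C \<le> F" using False sub Inf_lower2 unfolding X_def by blast
    ultimately show ?thesis unfolding X_def using Inf_lower by blast
  qed
  moreover have "partial_order_on X (relation_of (\<lambda>a b. b \<le> a) X)"
    by (rule partial_order_on_relation_ofI) auto
  ultimately obtain U where U: "U \<in> X" and max: "\<And>G. G \<in> X \<Longrightarrow> G \<le> U \<Longrightarrow> G = U"
    using predicate_Zorn[of X "\<lambda>a b. b \<le> a"] by blast
  have "eventually P U \<or> eventually (\<lambda>n. \<not> P n) U" for P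
  proof (rule disjCI)
    assume "\<not> eventually (\<lambda>n. \<not> P n) U"
    then have "inf U (principal {n. P n}) \<noteq> bot"
      by (simp add: trivial_limit_def eventually_inf_principal)
    moreover have "inf U (principal {n. P n}) \<le> F" using U le_infI1 unfolding X_def by blast
    ultimately have "inf U (principal {n. P n}) = U" using max unfolding X_def by simp
    moreover have "eventually P (inf U (principal {n. P n}))" by (simp add: eventually_inf_principal)
    ultimately show "eventually P U" by simp
  qed
  then have "free_ultrafilter U"
    using U assms(2) order.trans unfolding X_def by unfold_locales auto
  then show ?thesis using U unfolding X_def by blast
qed

text \<open>
  A point of the ultraproduct is a chosen representative of its class of almost equal sequences,
  so that it can be evaluated at an index.
\<close>

definition canon :: "nat filter \<Rightarrow> (nat \<Rightarrow> 'a) \<Rightarrow> nat \<Rightarrow> 'a" where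
  "canon U f = (SOME g. eventually (\<lambda>n. g n = f n) U)"

lemma ev_canon: "eventually (\<lambda>n. canon U f n = f n) U"
  unfolding canon_def by (rule someI[of _ f]) simp

lemma canon_cong:
  assumes "eventually (\<lambda>n. f n = g n) U"
  shows "canon U f = canon U g"
proof -
  have "(\<lambda>h. eventually (\<lambda>n. h n = f n) U) = (\<lambda>h. eventually (\<lambda>n. h n = g n) U)"
    using assms by (intro ext iffI) (auto elim: eventually_elim2)
  then show ?thesis unfolding canon_def by simp
qed

lemma canon_canon [simp]: "canon U (canon U f) = canon U f"
  by (rule canon_cong) (rule ev_canon)

lemma canon_eqI:
  "canon U c = c \<Longrightarrow> canon U d = d \<Longrightarrow> eventually (\<lambda>n. c n = d n) U \<Longrightarrow> c = d"
  using canon_cong by metis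

lemma canon_eq_iff: "canon U c = c \<Longrightarrow> canon U d = d \<Longrightarrow> c = d \<longleftrightarrow> eventually (\<lambda>n. c n = d n) U"
  using canon_eqI by auto

lemma eq_canon_iff: "canon U c = c \<Longrightarrow> c = canon U f \<longleftrightarrow> eventually (\<lambda>n. c n = f n) U"
  using canon_cong ev_canon by metis

definition ult :: "nat filter \<Rightarrow> (nat \<Rightarrow> ('a, 'r) fo_struct) \<Rightarrow> (nat \<Rightarrow> 'a, 'r) fo_struct" where
  "ult U M =
     \<lparr>universe = {c. canon U c = c \<and> eventually (\<lambda>n. c n \<in> universe (M n)) U},
      rel = (\<lambda>S. {t. (\<forall>c\<in>set t. canon U c = c) \<and> eventually (\<lambda>n. map (\<lambda>c. c n) t \<in> rel (M n) S) U}),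
      cst = (\<lambda>i. canon U (\<lambda>n. cst (M n) i))\<rparr>"

lemma ult_universe: "c \<in> universe (ult U M) \<longleftrightarrow> canon U c = c \<and> eventually (\<lambda>n. c n \<in> universe (M n)) U"
  by (simp add: ult_def)

lemma ult_rel:
  "t \<in> rel (ult U M) S \<longleftrightarrow>
   (\<forall>c\<in>set t. canon U c = c) \<and> eventually (\<lambda>n. map (\<lambda>c. c n) t \<in> rel (M n) S) U"
  by (simp add: ult_def)

lemma ult_cst: "cst (ult U M) i = canon U (\<lambda>n. cst (M n) i)"
  by (simp add: ult_def)

lemma canon_universe:
  "eventually (\<lambda>n. f n \<in> universe (M n)) U \<Longrightarrow> canon U f \<in> universe (ult U M)"
  using ev_canon[of U f] by (auto simp: ult_universe elim: eventually_elim2)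

lemma universe_canon: "c \<in> universe (ult U M) \<Longrightarrow> canon U c = c"
  by (simp add: ult_universe)

lemma universe_ev: "c \<in> universe (ult U M) \<Longrightarrow> eventually (\<lambda>n. c n \<in> universe (M n)) U"
  by (simp add: ult_universe)

lemma ev_map_canon:
  "eventually (\<lambda>n. map (\<lambda>c. c n) (map (\<lambda>i. canon U (\<lambda>n. t n ! i)) [0..<a]) = map (\<lambda>i. t n ! i) [0..<a]) U"
proof -
  have "eventually (\<lambda>n. \<forall>i\<in>{..<a}. canon U (\<lambda>n. t n ! i) n = t n ! i) U"
    by (intro eventually_ball_finite) (auto intro: ev_canon)
  then show ?thesis by (rule eventually_mono) auto
qed

text \<open>A sequence of tuples turns into a tuple of sequences only if the lengths agree almost
  everywhere; the arity provides this in the applications.\<close>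

lemma ult_rel_choice:
  assumes "eventually (\<lambda>n. t n \<in> rel (M n) S) U" "eventually (\<lambda>n. length (t n) = a) U"
  obtains T where "T \<in> rel (ult U M) S" "length T = a" "eventually (\<lambda>n. map (\<lambda>c. c n) T = t n) U"
proof -
  define T where "T = map (\<lambda>i. canon U (\<lambda>n. t n ! i)) [0..<a]"
  have ev: "eventually (\<lambda>n. map (\<lambda>c. c n) T = t n) U"
    using ev_map_canon[of U t a] assms(2) unfolding T_def
    by eventually_elim (metis map_nth)
  then have "eventually (\<lambda>n. map (\<lambda>c. c n) T \<in> rel (M n) S) U"
    using assms(1) by eventually_elim simp
  then have "T \<in> rel (ult U M) S" by (auto simp: ult_rel T_def)
  then show ?thesis using that ev by (simp add: T_def)
qed

lemma eval_term_ult: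
  assumes "\<And>x. x \<in> term_vars s \<Longrightarrow> v x \<in> universe (ult U M)"
  shows "canon U (eval_term (ult U M) v s) = eval_term (ult U M) v s"
    and "eventually (\<lambda>n. eval_term (ult U M) v s n = eval_term (M n) (\<lambda>x. v x n) s) U"
  using assms ev_canon by (cases s; auto simp: ult_cst ult_universe)+

context free_ultrafilter
begin

lemma ult_fo_structure:
  assumes "\<And>n. fo_structure L (M n)"
  shows "fo_structure L (ult U M)"
proof -
  have M: "universe (M n) \<noteq> {}" "\<And>S t. S \<in> syms L \<Longrightarrow> t \<in> rel (M n) S \<Longrightarrow> length t = arity L S \<and> set t \<subseteq> universe (M n)"
    "\<And>c. c \<in> csts L \<Longrightarrow> cst (M n) c \<in> universe (M n)" for n
    using assms[of n] unfolding fo_structure_def by auto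
  have "\<forall>n. \<exists>a. a \<in> universe (M n)" using M(1) by blast
  then obtain f where "\<And>n. f n \<in> universe (M n)" by metis
  then have "canon U f \<in> universe (ult U M)" by (intro canon_universe) simp
  moreover have "length t = arity L S \<and> set t \<subseteq> universe (ult U M)"
    if S: "S \<in> syms L" and t: "t \<in> rel (ult U M) S" for S t
  proof -
    have ev: "eventually (\<lambda>n. length t = arity L S \<and> (\<lambda>c. c n) ` set t \<subseteq> universe (M n)) U"
      using t M(2)[OF S] by (auto simp: ult_rel elim!: eventually_mono) fastforce+
    then have "length t = arity L S" using ev_happens by fastforce
    moreover have "c \<in> universe (ult U M)" if "c \<in> set t" for c
      using ev t that by (auto simp: ult_rel ult_universe elim!: eventually_mono)
    ultimately show ?thesis by auto
  qed
  moreover have "cst (ult U M) c \<in> universe (ult U M)" if "c \<in> csts L" for c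
    unfolding ult_cst using M(3)[OF that] by (intro canon_universe) simp
  ultimately show ?thesis unfolding fo_structure_def by blast
qed

text \<open>Los's theorem. Boolean connectives commute with the ultrafilter; for the quantifier,
  witnesses are chosen index by index and replaced by the canonical representative.\<close>

lemma ult_los:
  assumes "\<And>x. x \<in> free_vars \<phi> \<Longrightarrow> v x \<in> universe (ult U M)"
  shows "sat (ult U M) v \<phi> \<longleftrightarrow> eventually (\<lambda>n. sat (M n) (\<lambda>x. v x n) \<phi>) U"
  using assms
proof (induction \<phi> arbitrary: v)
  case (Eq s t)
  have s: "canon U (eval_term (ult U M) v s) = eval_term (ult U M) v s"
    "eventually (\<lambda>n. eval_term (ult U M) v s n = eval_term (M n) (\<lambda>x. v x n) s) U"
    and t: "canon U (eval_term (ult U M) v t) = eval_term (ult U M) v t"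
    "eventually (\<lambda>n. eval_term (ult U M) v t n = eval_term (M n) (\<lambda>x. v x n) t) U"
    using Eq by (intro eval_term_ult; simp)+
  have "eventually (\<lambda>n. (eval_term (ult U M) v s n = eval_term (ult U M) v t n) \<longleftrightarrow>
      sat (M n) (\<lambda>x. v x n) (Eq s t)) U"
    using s(2) t(2) by eventually_elim simp
  then show ?case using canon_eq_iff[OF s(1) t(1)] ev_iff by simp
next
  case (Rel S ts)
  have can: "canon U (eval_term (ult U M) v s) = eval_term (ult U M) v s"
    and ev: "eventually (\<lambda>n. eval_term (ult U M) v s n = eval_term (M n) (\<lambda>x. v x n) s) U"
    if "s \<in> set ts" for s
    using Rel that by (intro eval_term_ult; auto)+
  have "eventually (\<lambda>n. \<forall>s\<in>set ts. eval_term (ult U M) v s n = eval_term (M n) (\<lambda>x. v x n) s) U"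
    using ev by (intro eventually_ball_finite) auto
  then have "eventually (\<lambda>n. (map (\<lambda>c. c n) (map (eval_term (ult U M) v) ts) \<in> rel (M n) S) \<longleftrightarrow>
      sat (M n) (\<lambda>x. v x n) (Rel S ts)) U"
    by eventually_elim (simp cong: map_cong)
  then show ?case using can ev_iff by (simp add: ult_rel)
next
  case (Neg \<phi>)
  have "sat (ult U M) v \<phi> \<longleftrightarrow> eventually (\<lambda>n. sat (M n) (\<lambda>x. v x n) \<phi>) U"
    using Neg.prems by (intro Neg.IH) simp
  then show ?case by (simp add: ev_not)
next
  case (Conj \<phi> \<psi>)
  have "sat (ult U M) v \<phi> \<longleftrightarrow> eventually (\<lambda>n. sat (M n) (\<lambda>x. v x n) \<phi>) U"
    "sat (ult U M) v \<psi> \<longleftrightarrow> eventually (\<lambda>n. sat (M n) (\<lambda>x. v x n) \<psi>) U"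
    by (rule Conj.IH, simp add: Conj.prems)+
  then show ?case by (simp add: eventually_conj_iff)
next
  case (Ex x \<phi>)
  have upd: "(\<lambda>y. (v(x := c)) y n) = (\<lambda>y. v y n)(x := c n)" for c n by auto
  have IH: "sat (ult U M) (v(x := c)) \<phi> \<longleftrightarrow> eventually (\<lambda>n. sat (M n) ((\<lambda>y. v y n)(x := c n)) \<phi>) U"
    if "c \<in> universe (ult U M)" for c
  proof -
    have "(v(x := c)) y \<in> universe (ult U M)" if "y \<in> free_vars \<phi>" for y
      using Ex.prems that \<open>c \<in> universe (ult U M)\<close> by auto
    from Ex.IH[of "v(x := c)", OF this] show ?thesis unfolding upd .
  qed
  show ?case
  proof
    assume "sat (ult U M) v (Ex x \<phi>)"
    then obtain c where c: "c \<in> universe (ult U M)" "sat (ult U M) (v(x := c)) \<phi>"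
      unfolding sat.simps by blast
    have "eventually (\<lambda>n. sat (M n) ((\<lambda>y. v y n)(x := c n)) \<phi>) U" using IH c by blast
    then show "eventually (\<lambda>n. sat (M n) (\<lambda>x. v x n) (Ex x \<phi>)) U"
      using universe_ev[OF c(1)] by eventually_elim auto
  next
    assume "eventually (\<lambda>n. sat (M n) (\<lambda>x. v x n) (Ex x \<phi>)) U"
    then have ev: "eventually (\<lambda>n. \<exists>a\<in>universe (M n). sat (M n) ((\<lambda>y. v y n)(x := a)) \<phi>) U" by simp
    define f where "f n = (SOME a. a \<in> universe (M n) \<and> sat (M n) ((\<lambda>y. v y n)(x := a)) \<phi>)" for n
    have f: "eventually (\<lambda>n. f n \<in> universe (M n) \<and> sat (M n) ((\<lambda>y. v y n)(x := f n)) \<phi>) U"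
      using ev unfolding f_def
      by (rule eventually_mono) (metis (mono_tags, lifting) someI)
    then have c: "canon U f \<in> universe (ult U M)" by (intro canon_universe) (auto elim: eventually_mono)
    have "eventually (\<lambda>n. sat (M n) ((\<lambda>y. v y n)(x := canon U f n)) \<phi>) U"
      using f ev_canon[of U f] by eventually_elim auto
    then have "sat (ult U M) (v(x := canon U f)) \<phi>" using IH[OF c] by blast
    then show "sat (ult U M) v (Ex x \<phi>)" using c by auto
  qed
qed

lemma ult_models:
  assumes "\<And>n. fo_structure L (M n)" "\<phi> \<in> sentences L"
  shows "ult U M \<Turnstile> \<phi> \<longleftrightarrow> eventually (\<lambda>n. M n \<Turnstile> \<phi>) U"
proof -
  have fv: "free_vars \<phi> = {}" using assms(2) unfolding sentences_def by simp
  have ne: "universe (M n) \<noteq> {}" "universe (ult U M) \<noteq> {}" for n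
    using assms(1) ult_fo_structure[OF assms(1)] unfolding fo_structure_def by auto
  have "ult U M \<Turnstile> \<phi> \<longleftrightarrow> sat (ult U M) (\<lambda>_ _. undefined) \<phi>" using models_sentence[OF fv ne(2)] .
  also have "\<dots> \<longleftrightarrow> eventually (\<lambda>n. sat (M n) (\<lambda>_. undefined) \<phi>) U" using ult_los[of \<phi>] fv by simp
  also have "\<dots> \<longleftrightarrow> eventually (\<lambda>n. M n \<Turnstile> \<phi>) U" using models_sentence[OF fv ne(1)] by simp
  finally show ?thesis .
qed

end

section \<open>Types of tuples and saturation of ultraproducts\<close>

instance fo_term :: countable by countable_datatype
instance fo_formula :: (countable) countable by countable_datatype

lemma set_wf_formula: "wf_formula L \<phi> \<Longrightarrow> set_fo_formula \<phi> \<subseteq> syms L"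
  by (induction \<phi>) auto

text \<open>The type of symbols may be uncountable, but a well-formed formula mentions only the
  finitely many symbols of \<open>L\<close>. Renaming these injectively to numbers embeds the
  formulas into a countable type.\<close>

lemma countable_wf_formulas:
  assumes "finite (syms L)"
  shows "countable {\<phi>. wf_formula L \<phi>}"
proof -
  obtain f :: "'a \<Rightarrow> nat" where f: "inj_on f (syms L)"
    using assms countable_finite unfolding countable_def by blast
  have "inj_on (map_fo_formula f) {\<phi>. wf_formula L \<phi>}"
  proof (rule inj_onI, rule fo_formula.inj_map_strong[rotated])
    fix \<phi> \<psi> z z' assume "\<phi> \<in> {\<phi>. wf_formula L \<phi>}" "\<psi> \<in> {\<phi>. wf_formula L \<phi>}"
      "z \<in> set_fo_formula \<phi>" "z' \<in> set_fo_formula \<psi>" "f z = f z'"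
    then show "z = z'" using f set_wf_formula unfolding inj_on_def by blast
  qed
  then show ?thesis using countable_image_inj_on by (metis countableI_type)
qed

text \<open>Equality of the complete types of two finite tuples. The pairs form a list, so that
  variable \<open>i\<close> can denote the \<open>i\<close>-th pair.\<close>

definition agree ::
  "'r lang \<Rightarrow> ('a, 'r) fo_struct \<Rightarrow> ('b, 'r) fo_struct \<Rightarrow> ('a \<times> 'b) list \<Rightarrow> bool" where
  "agree L M N ps \<longleftrightarrow> set ps \<subseteq> universe M \<times> universe N \<and>
     (\<forall>\<phi>. wf_formula L \<phi> \<longrightarrow> free_vars \<phi> \<subseteq> {..<length ps} \<longrightarrow>
        (sat M (\<lambda>i. fst (ps ! i)) \<phi> \<longleftrightarrow> sat N (\<lambda>i. snd (ps ! i)) \<phi>))"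

lemma agree_swap:
  assumes "agree L M N ps"
  shows "agree L N M (map prod.swap ps)"
proof -
  have "sat N (\<lambda>i. fst (map prod.swap ps ! i)) \<phi> \<longleftrightarrow> sat M (\<lambda>i. snd (map prod.swap ps ! i)) \<phi>"
    if "wf_formula L \<phi>" "free_vars \<phi> \<subseteq> {..<length ps}" for \<phi>
  proof -
    have "sat N (\<lambda>i. fst (map prod.swap ps ! i)) \<phi> \<longleftrightarrow> sat N (\<lambda>i. snd (ps ! i)) \<phi>"
      "sat M (\<lambda>i. snd (map prod.swap ps ! i)) \<phi> \<longleftrightarrow> sat M (\<lambda>i. fst (ps ! i)) \<phi>"
      using that(2) by (intro sat_cong; auto)+
    then show ?thesis using assms that unfolding agree_def by simp
  qed
  then show ?thesis using assms unfolding agree_def by auto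
qed

lemma sat_foldr_Conj:
  "sat M v (foldr Conj \<phi>s \<psi>) \<longleftrightarrow> (\<forall>\<phi>\<in>set \<phi>s. sat M v \<phi>) \<and> sat M v \<psi>"
  by (induction \<phi>s) auto

lemma free_vars_foldr_Conj:
  "free_vars (foldr Conj \<phi>s \<psi>) = (\<Union>\<phi>\<in>set \<phi>s. free_vars \<phi>) \<union> free_vars \<psi>"
  by (induction \<phi>s) auto

lemma wf_foldr_Conj:
  "wf_formula L (foldr Conj \<phi>s \<psi>) \<longleftrightarrow> (\<forall>\<phi>\<in>set \<phi>s. wf_formula L \<phi>) \<and> wf_formula L \<psi>"
  by (induction \<phi>s) auto

text \<open>Let \<Gamma> be the type of \<open>a\<close> over the tuple already chosen in
  \<open>M\<close>. Finitely many of its formulas are put under one existential quantifier and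
  transferred by agreement; countable saturation then realises all of \<Gamma> by a single
  point.\<close>

lemma (in free_ultrafilter) agree_forth:
  assumes fin: "finite (syms L)" and ag: "agree L M (ult U N) ps" and a: "a \<in> universe M"
  shows "\<exists>b. agree L M (ult U N) (ps @ [(a, b)])"
proof -
  define k where "k = length ps"
  define v where "v = (\<lambda>i. fst (ps ! i))"
  define w where "w = (\<lambda>i. snd (ps ! i))"
  define \<Gamma> where "\<Gamma> = {\<phi>. wf_formula L \<phi> \<and> free_vars \<phi> \<subseteq> {..k} \<and> sat M (v(k := a)) \<phi>}"
  have ag': "wf_formula L \<phi> \<Longrightarrow> free_vars \<phi> \<subseteq> {..<k} \<Longrightarrow> sat M v \<phi> \<longleftrightarrow> sat (ult U N) w \<phi>" for \<phi>
    using ag unfolding agree_def k_def v_def w_def by blast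
  have wu: "w i \<in> universe (ult U N)" if "i < k" for i
    using ag that nth_mem[of i ps] unfolding agree_def k_def w_def by fastforce
  have "countable \<Gamma>" unfolding \<Gamma>_def
    by (rule countable_subset[OF _ countable_wf_formulas[OF fin]]) auto
  \<comment> \<open>A trivial member makes \<Gamma> nonempty, as needed to enumerate it as the range
    of a sequence.\<close>
  moreover have "Eq (Var k) (Var k) \<in> \<Gamma>" unfolding \<Gamma>_def by auto
  ultimately obtain \<phi> :: "nat \<Rightarrow> _" where \<phi>: "range \<phi> = \<Gamma>"
    using range_from_nat_into by (metis empty_iff)
  have \<phi>\<Gamma>: "\<phi> i \<in> \<Gamma>" for i using \<phi> by auto
  have los: "sat (ult U N) (w(k := c)) \<psi> \<longleftrightarrow> eventually (\<lambda>n. sat (N n) ((\<lambda>x. w x n)(k := c n)) \<psi>) U"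
    if "c \<in> universe (ult U N)" "free_vars \<psi> \<subseteq> {..k}" for c \<psi>
  proof -
    have upd: "(\<lambda>y. (w(k := c)) y n) = (\<lambda>y. w y n)(k := c n)" for n by auto
    have "(w(k := c)) x \<in> universe (ult U N)" if "x \<in> free_vars \<psi>" for x
      using wu[of x] that \<open>free_vars \<psi> \<subseteq> {..k}\<close> \<open>c \<in> universe (ult U N)\<close> by (cases "x = k") auto
    from ult_los[of \<psi> "w(k := c)" N, OF this] show ?thesis unfolding upd .
  qed
  have "eventually (\<lambda>n. \<exists>c\<in>universe (N n). \<forall>i<m. sat (N n) ((\<lambda>x. w x n)(k := c)) (\<phi> i)) U" for m
  proof -
    define \<psi> where "\<psi> = foldr Conj (map \<phi> [0..<m]) (Eq (Var k) (Var k))"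
    have wf: "wf_formula L (Ex k \<psi>)" using \<phi>\<Gamma> by (auto simp: \<psi>_def wf_foldr_Conj \<Gamma>_def)
    have fv0: "free_vars \<psi> \<subseteq> {..k}" using \<phi>\<Gamma> by (auto simp: \<psi>_def free_vars_foldr_Conj \<Gamma>_def)
    then have fv: "free_vars (Ex k \<psi>) \<subseteq> {..<k}" by (auto simp: less_le)
    have "sat M (v(k := a)) \<psi>" using \<phi>\<Gamma> by (auto simp: \<psi>_def sat_foldr_Conj \<Gamma>_def)
    then have "sat M v (Ex k \<psi>)" using a by auto
    then have "sat (ult U N) w (Ex k \<psi>)" using ag' wf fv by blast
    then obtain c where c: "c \<in> universe (ult U N)" "sat (ult U N) (w(k := c)) \<psi>"
      unfolding sat.simps by blast
    have "eventually (\<lambda>n. sat (N n) ((\<lambda>x. w x n)(k := c n)) \<psi>) U" using los c fv0 by blast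
    then show ?thesis using universe_ev[OF c(1)]
    proof eventually_elim
      case (elim n)
      then show ?case by (intro bexI[of _ "c n"]) (auto simp: \<psi>_def sat_foldr_Conj)
    qed
  qed
  from countable_saturation[OF this] obtain g where g: "eventually (\<lambda>n. g n \<in> universe (N n)) U"
    "\<And>i. eventually (\<lambda>n. sat (N n) ((\<lambda>x. w x n)(k := g n)) (\<phi> i)) U" by blast
  define b where "b = canon U g"
  have b: "b \<in> universe (ult U N)" unfolding b_def using g(1) by (rule canon_universe)
  have sat\<Gamma>: "sat (ult U N) (w(k := b)) \<psi>" if \<psi>: "\<psi> \<in> \<Gamma>" for \<psi>
  proof -
    obtain i where i: "\<psi> = \<phi> i" using \<psi> \<phi> by blast
    have "eventually (\<lambda>n. sat (N n) ((\<lambda>x. w x n)(k := b n)) (\<phi> i)) U"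
      using g(2)[of i] ev_canon[of U g] unfolding b_def by eventually_elim simp
    then show ?thesis using los[OF b] \<psi> unfolding i \<Gamma>_def by blast
  qed
  have "agree L M (ult U N) (ps @ [(a, b)])"
    unfolding agree_def
  proof (intro conjI allI impI)
    show "set (ps @ [(a, b)]) \<subseteq> universe M \<times> universe (ult U N)"
      using ag a b unfolding agree_def by auto
    fix \<psi> assume wf: "wf_formula L \<psi>" and fv: "free_vars \<psi> \<subseteq> {..<length (ps @ [(a, b)])}"
    have fv': "free_vars \<psi> \<subseteq> {..k}" using fv unfolding k_def by auto
    have "sat M (v(k := a)) \<psi> \<longleftrightarrow> sat (ult U N) (w(k := b)) \<psi>"
    proof (cases "sat M (v(k := a)) \<psi>")
      case True
      then show ?thesis using sat\<Gamma>[of \<psi>] wf fv' unfolding \<Gamma>_def by blast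
    next
      case False
      \<comment> \<open>\<Gamma> is complete, so realising it also gives the converse
        implication.\<close>
      then have "Neg \<psi> \<in> \<Gamma>" using wf fv' unfolding \<Gamma>_def by simp
      then show ?thesis using sat\<Gamma>[of "Neg \<psi>"] False by simp
    qed
    moreover have "sat M (\<lambda>i. fst ((ps @ [(a, b)]) ! i)) \<psi> \<longleftrightarrow> sat M (v(k := a)) \<psi>"
      using fv' by (intro sat_cong) (auto simp: nth_append v_def k_def)
    moreover have "sat (ult U N) (\<lambda>i. snd ((ps @ [(a, b)]) ! i)) \<psi> \<longleftrightarrow> sat (ult U N) (w(k := b)) \<psi>"
      using fv' by (intro sat_cong) (auto simp: nth_append w_def k_def)
    ultimately show "sat M (\<lambda>i. fst ((ps @ [(a, b)]) ! i)) \<psi> \<longleftrightarrow>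
        sat (ult U N) (\<lambda>i. snd ((ps @ [(a, b)]) ! i)) \<psi>" by blast
  qed
  then show ?thesis by blast
qed

text \<open>Equality of types is itself a back-and-forth system here, because each ultraproduct
  realises the type of any new point of the other. Elementary equivalence is what makes the empty
  tuples agree.\<close>

lemma ult_bf:
  assumes U: "free_ultrafilter U" and V: "free_ultrafilter V" and fin: "finite (syms L)"
    and M: "\<And>n. fo_structure L (M n)" and N: "\<And>n. fo_structure L (N n)"
    and eq: "\<And>\<phi>. \<phi> \<in> sentences L \<Longrightarrow> ult U M \<Turnstile> \<phi> \<longleftrightarrow> ult V N \<Turnstile> \<phi>"
  shows "bf L (ult U M) (ult V N) {}"
proof -
  interpret U: free_ultrafilter U by (rule U)
  interpret V: free_ultrafilter V by (rule V)
  note sM = U.ult_fo_structure[of L M, OF M] and sN = V.ult_fo_structure[of L N, OF N]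
  define Q where "Q = {q. \<exists>ps. q \<subseteq> set ps \<and> agree L (ult U M) (ult V N) ps}"
  have "bf_system L (ult U M) (ult V N) Q"
  proof (rule bf_systemI)
    fix q assume "q \<in> Q"
    then obtain ps where q: "q \<subseteq> set ps" and ag: "agree L (ult U M) (ult V N) ps"
      unfolding Q_def by blast
    show "q' \<in> Q" if "q' \<subseteq> q" for q' using that q ag unfolding Q_def by blast
    show "q \<subseteq> universe (ult U M) \<times> universe (ult V N)" using q ag unfolding agree_def by blast
    have idx: "\<exists>i<length ps. fst (ps ! i) = a \<and> snd (ps ! i) = b" if "(a, b) \<in> q" for a b
      using q that by (metis fst_conv in_set_conv_nth snd_conv subsetD)
    have agD: "sat (ult U M) (\<lambda>i. fst (ps ! i)) \<phi> \<longleftrightarrow> sat (ult V N) (\<lambda>i. snd (ps ! i)) \<phi>"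
      if "wf_formula L \<phi>" "free_vars \<phi> \<subseteq> {..<length ps}" for \<phi>
      using ag that unfolding agree_def by blast
    show "a = b \<longleftrightarrow> a' = b'" if "(a, a') \<in> q" "(b, b') \<in> q" for a a' b b'
    proof -
      from idx[OF that(1)] idx[OF that(2)] obtain i j where "i < length ps" "fst (ps ! i) = a" "snd (ps ! i) = a'"
        "j < length ps" "fst (ps ! j) = b" "snd (ps ! j) = b'" by blast
      then show ?thesis using agD[of "Eq (Var i) (Var j)"] by simp
    qed
    show "a = cst (ult U M) c \<longleftrightarrow> a' = cst (ult V N) c" if c: "c \<in> csts L" and aq: "(a, a') \<in> q" for c a a'
    proof -
      obtain i where "i < length ps" "fst (ps ! i) = a" "snd (ps ! i) = a'" using idx[OF aq] by blast
      then show ?thesis using agD[of "Eq (Var i) (Cst c)"] c by simp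
    qed
    show "t \<in> rel (ult U M) S \<longleftrightarrow> t' \<in> rel (ult V N) S"
      if S: "S \<in> syms L" and len: "length t = length t'" and z: "set (zip t t') \<subseteq> q" for S t t'
    proof -
      show ?thesis
      \<comment> \<open>A tuple of the wrong length belongs to neither relation, and no well-formed
        atomic formula could speak about it.\<close>
      proof (cases "length t = arity L S")
        case False
        then show ?thesis using sM sN S len unfolding fo_structure_def by metis
      next
        case True
        have "\<forall>j<length t. \<exists>i<length ps. fst (ps ! i) = t ! j \<and> snd (ps ! i) = t' ! j"
          using z len idx by (fastforce simp: set_zip)
        then obtain f where f: "\<And>j. j < length t \<Longrightarrow> f j < length ps \<and> fst (ps ! f j) = t ! j \<and> snd (ps ! f j) = t' ! j"
          by metis
        define \<phi> where "\<phi> = Rel S (map (\<lambda>j. Var (f j)) [0..<length t])"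
        have "wf_formula L \<phi>" "free_vars \<phi> \<subseteq> {..<length ps}" using S True f by (auto simp: \<phi>_def)
        moreover have "map (eval_term (ult U M) (\<lambda>i. fst (ps ! i))) (map (\<lambda>j. Var (f j)) [0..<length t]) = t"
          "map (eval_term (ult V N) (\<lambda>i. snd (ps ! i))) (map (\<lambda>j. Var (f j)) [0..<length t]) = t'"
          using f len by (auto intro!: nth_equalityI)
        ultimately show ?thesis using agD[of \<phi>] unfolding \<phi>_def sat.simps by simp
      qed
    qed
    show "\<exists>a'. insert (a, a') q \<in> Q" if a: "a \<in> universe (ult U M)" for a
    proof -
      obtain b where "agree L (ult U M) (ult V N) (ps @ [(a, b)])"
        using V.agree_forth[OF fin ag a] by blast
      then show ?thesis unfolding Q_def using q
        by (intro exI[of _ b]) (auto intro!: exI[of _ "ps @ [(a, b)]"])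
    qed
    show "\<exists>a. insert (a, b) q \<in> Q" if b: "b \<in> universe (ult V N)" for b
    proof -
      obtain a where "agree L (ult V N) (ult U M) (map prod.swap ps @ [(b, a)])"
        using U.agree_forth[OF fin agree_swap[OF ag] b] by blast
      from agree_swap[OF this] have "agree L (ult U M) (ult V N) (ps @ [(a, b)])" by (simp add: comp_def)
      then show ?thesis unfolding Q_def using q
        by (intro exI[of _ a]) (auto intro!: exI[of _ "ps @ [(a, b)]"])
    qed
  qed
  moreover have "{} \<in> Q"
  proof -
    have "agree L (ult U M) (ult V N) []"
    proof -
      have ne: "universe (ult U M) \<noteq> {}" "universe (ult V N) \<noteq> {}"
        using sM sN unfolding fo_structure_def by auto
      have "sat (ult U M) v \<phi> \<longleftrightarrow> sat (ult V N) w \<phi>" if "wf_formula L \<phi>" "free_vars \<phi> = {}" for \<phi> v w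
        using eq[of \<phi>] models_sentence[OF that(2) ne(1), of v] models_sentence[OF that(2) ne(2), of w] that
        unfolding sentences_def by simp
      then show ?thesis unfolding agree_def by simp
    qed
    then show ?thesis unfolding Q_def by auto
  qed
  ultimately show ?thesis unfolding bf_def by blast
qed

section \<open>Gaifman graphs of ultraproducts\<close>

context free_ultrafilter
begin

text \<open>For the converse, the symbol that witnesses adjacency depends on the index; as the
  language is finite, one symbol works almost everywhere.\<close>

lemma ult_gaifman:
  assumes M: "\<And>n. fo_structure L (M n)" and fin: "finite (syms L)"
    and x: "canon U x = x" and y: "canon U y = y"
  shows "(x, y) \<in> gaifman L (ult U M) \<longleftrightarrow> eventually (\<lambda>n. (x n, y n) \<in> gaifman L (M n)) U"
proof
  assume "(x, y) \<in> gaifman L (ult U M)"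
  then obtain S t where S: "S \<in> syms L" and t: "t \<in> rel (ult U M) S" "x \<in> set t" "y \<in> set t" and ne: "x \<noteq> y"
    unfolding gaifman_def by blast
  have "eventually (\<lambda>n. x n \<noteq> y n) U" using ne canon_eq_iff[OF x y] ev_not by simp
  moreover have "eventually (\<lambda>n. map (\<lambda>c. c n) t \<in> rel (M n) S) U" using t(1) by (simp add: ult_rel)
  ultimately show "eventually (\<lambda>n. (x n, y n) \<in> gaifman L (M n)) U"
  proof eventually_elim
    case (elim n)
    have "x n \<in> set (map (\<lambda>c. c n) t)" "y n \<in> set (map (\<lambda>c. c n) t)" using t by auto
    then show ?case using elim S unfolding gaifman_def by blast
  qed
next
  assume ev: "eventually (\<lambda>n. (x n, y n) \<in> gaifman L (M n)) U"
  then have "eventually (\<lambda>n. \<exists>S\<in>syms L. \<exists>t\<in>rel (M n) S. x n \<in> set t \<and> y n \<in> set t) U"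
    by (rule eventually_mono) (auto simp: gaifman_def)
  then obtain S where S: "S \<in> syms L" and "eventually (\<lambda>n. \<exists>t\<in>rel (M n) S. x n \<in> set t \<and> y n \<in> set t) U"
    using ev_bex_finite[OF fin, of "\<lambda>S n. \<exists>t\<in>rel (M n) S. x n \<in> set t \<and> y n \<in> set t"] by auto
  then obtain t where t: "eventually (\<lambda>n. t n \<in> rel (M n) S \<and> x n \<in> set (t n) \<and> y n \<in> set (t n)) U"
    unfolding Bex_def eventually_ex by blast
  have len: "eventually (\<lambda>n. length (t n) = arity L S) U"
    using t M S unfolding fo_structure_def by (auto elim!: eventually_mono)
  have tS: "eventually (\<lambda>n. t n \<in> rel (M n) S) U" using t by (rule eventually_mono) simp
  obtain T where T: "T \<in> rel (ult U M) S" "length T = arity L S" and ev': "eventually (\<lambda>n. map (\<lambda>c. c n) T = t n) U"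
    using ult_rel_choice[OF tS len] .
  have mem: "z \<in> set T" if z: "canon U z = z" and zt: "eventually (\<lambda>n. z n \<in> set (t n)) U" for z
  proof -
    have "eventually (\<lambda>n. \<exists>c\<in>set T. c n = z n) U"
      using zt ev' by eventually_elim (metis (mono_tags, lifting) image_iff list.set_map)
    then obtain c where "c \<in> set T" "eventually (\<lambda>n. c n = z n) U"
      using ev_bex_finite[of "set T" "\<lambda>c n. c n = z n"] by auto
    moreover have "canon U c = c" using T(1) \<open>c \<in> set T\<close> by (simp add: ult_rel)
    ultimately show ?thesis using canon_eqI z by metis
  qed
  have "x \<in> set T" "y \<in> set T" using t by (intro mem x y; auto elim: eventually_mono)+
  moreover have "x \<noteq> y" using ev ev_happens unfolding gaifman_def by fastforce
  ultimately show "(x, y) \<in> gaifman L (ult U M)" unfolding gaifman_def using S T(1) by blast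
qed

text \<open>The length \<open>d\<close> is fixed along the sequence. Paths of unbounded lengths
  leave no path in the ultraproduct, which is why roots of different classes become disconnected
  there.\<close>

lemma ult_gaifman_relpow:
  assumes M: "\<And>n. fo_structure L (M n)" and fin: "finite (syms L)"
    and x: "canon U x = x" and y: "canon U y = y"
  shows "(x, y) \<in> gaifman L (ult U M) ^^ d \<longleftrightarrow> eventually (\<lambda>n. (x n, y n) \<in> gaifman L (M n) ^^ d) U"
  using y
proof (induction d arbitrary: y)
  case 0
  then show ?case using canon_eq_iff[OF x 0] by simp
next
  case (Suc d)
  show ?case
  proof
    assume "(x, y) \<in> gaifman L (ult U M) ^^ Suc d"
    then obtain z where z: "(x, z) \<in> gaifman L (ult U M) ^^ d" "(z, y) \<in> gaifman L (ult U M)" by auto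
    have cz: "canon U z = z"
      using gaifman_universe[OF ult_fo_structure[of L M, OF M] z(2)] universe_canon by blast
    have "eventually (\<lambda>n. (x n, z n) \<in> gaifman L (M n) ^^ d) U" using Suc.IH[OF cz] z by blast
    moreover have "eventually (\<lambda>n. (z n, y n) \<in> gaifman L (M n)) U"
      using ult_gaifman[of L M, OF M fin cz Suc.prems] z by blast
    ultimately show "eventually (\<lambda>n. (x n, y n) \<in> gaifman L (M n) ^^ Suc d) U"
      by eventually_elim auto
  next
    assume "eventually (\<lambda>n. (x n, y n) \<in> gaifman L (M n) ^^ Suc d) U"
    then have "eventually (\<lambda>n. \<exists>z. (x n, z) \<in> gaifman L (M n) ^^ d \<and> (z, y n) \<in> gaifman L (M n)) U"
      by (rule eventually_mono) auto
    then obtain f where f: "eventually (\<lambda>n. (x n, f n) \<in> gaifman L (M n) ^^ d \<and> (f n, y n) \<in> gaifman L (M n)) U"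
      unfolding eventually_ex by blast
    define z where "z = canon U f"
    have cz: "canon U z = z" by (simp add: z_def)
    have "eventually (\<lambda>n. (x n, z n) \<in> gaifman L (M n) ^^ d \<and> (z n, y n) \<in> gaifman L (M n)) U"
      using f ev_canon[of U f] unfolding z_def by eventually_elim auto
    then have "(x, z) \<in> gaifman L (ult U M) ^^ d" "(z, y) \<in> gaifman L (ult U M)"
      using Suc.IH[OF cz] ult_gaifman[of L M, OF M fin cz Suc.prems] by (auto simp: eventually_conj_iff)
    then show "(x, y) \<in> gaifman L (ult U M) ^^ Suc d" by auto
  qed
qed

end

section \<open>Structures glued from a fragmented structure and a gadget\<close>

definition auxs :: "('b, 'r frag_sym) fo_struct \<Rightarrow> nat set \<Rightarrow> 'b set" where
  "auxs B X = last ` rel B (Frag X)"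

definition plain :: "nat set set \<Rightarrow> ('b, 'r frag_sym) fo_struct \<Rightarrow> 'b set" where
  "plain I B = universe B - (\<Union>X\<in>I. auxs B X)"

definition roots :: "nat \<Rightarrow> ('h, 'r) fo_struct \<Rightarrow> 'h set" where
  "roots k H = cst H ` {..<k}"

definition rooted :: "'r lang \<Rightarrow> nat \<Rightarrow> ('h, 'r) fo_struct \<Rightarrow> 'h \<Rightarrow> bool" where
  "rooted L k H v \<longleftrightarrow> (\<exists>j<k. (cst H j, v) \<in> (gaifman L H)\<^sup>*)"

text \<open>A pair \<open>(x, v)\<close> stands for the vertex \<open>v\<close> in the copy
  belonging to the edge with last vertex \<open>x\<close>. Connectivity is taken inside that copy,
  not in the glued structure.\<close>

definition copy_conn :: "'r lang \<Rightarrow> ('h, 'r) fo_struct \<Rightarrow> 'b \<times> 'h \<Rightarrow> 'b \<times> 'h \<Rightarrow> bool" where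
  "copy_conn L H a c \<longleftrightarrow> fst a = fst c \<and> (snd a, snd c) \<in> (gaifman L H)\<^sup>*"

lemma copy_conn_refl: "copy_conn L H a a"
  by (simp add: copy_conn_def)

lemma copy_conn_sym: "copy_conn L H a c \<Longrightarrow> copy_conn L H c a"
  unfolding copy_conn_def using gaifman_rtrancl_sym by metis

lemma copy_conn_trans: "copy_conn L H a c \<Longrightarrow> copy_conn L H c d \<Longrightarrow> copy_conn L H a d"
  unfolding copy_conn_def using rtrancl_trans by metis

lemma gaifman_gadget_lang [simp]: "gaifman (gadget_lang L k) H = gaifman L H"
  by (simp add: gaifman_def gadget_lang_def)

lemma syms_gadget_lang [simp]: "syms (gadget_lang L k) = syms L"
  by (simp add: gadget_lang_def)

lemma csts_gadget_lang [simp]: "csts (gadget_lang L k) = {..<k}"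
  by (simp add: gadget_lang_def)

text \<open>\<open>J\<close> places the points of \<open>B\<close> that are not auxiliary, and
  \<open>K x v\<close> is the vertex \<open>v\<close> in the copy for the edge ending in
  \<open>x\<close>; by \<open>edge_unique\<close> the auxiliary vertex determines the edge.
  \<open>part v\<close> tells which sort of edges carries \<open>v\<close>. Besides lying in
  \<open>I\<close>, it only has to be constant along Gaifman edges and to contain \<open>j\<close>
  at root \<open>j\<close>: a rootless component may go to any sort, and this freedom lets one
  locale cover both products. \<open>auxs_card\<close> says that all sorts of edges are equally
  frequent, up to infinity.\<close>

locale gluing =
  fixes L :: "'r lang" and k :: nat and I :: "nat set set"
    and B :: "('b, 'r frag_sym) fo_struct" and H :: "('h, 'r) fo_struct" and M :: "('m, 'r) fo_struct"
    and part :: "'h \<Rightarrow> nat set" and J :: "'b \<Rightarrow> 'm" and K :: "'b \<Rightarrow> 'h \<Rightarrow> 'm"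
  assumes I_sub: "X \<in> I \<Longrightarrow> X \<subseteq> {..<k}"
    and I_disjoint: "X \<in> I \<Longrightarrow> Y \<in> I \<Longrightarrow> j \<in> X \<Longrightarrow> j \<in> Y \<Longrightarrow> X = Y"
    and edge: "X \<in> I \<Longrightarrow> e \<in> rel B (Frag X) \<Longrightarrow> length e = Suc (card X) \<and> set e \<subseteq> universe B"
    and edge_unique: "X \<in> I \<Longrightarrow> Y \<in> I \<Longrightarrow> e \<in> rel B (Frag X) \<Longrightarrow> f \<in> rel B (Frag Y) \<Longrightarrow>
      last e = last f \<Longrightarrow> X = Y \<and> e = f"
    and edge_plain: "X \<in> I \<Longrightarrow> e \<in> rel B (Frag X) \<Longrightarrow> p < card X \<Longrightarrow> e ! p \<in> plain I B"
    and auxs_card: "X \<in> I \<Longrightarrow> Y \<in> I \<Longrightarrow> finite F \<Longrightarrow> F \<subseteq> auxs B X \<Longrightarrow>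
      \<exists>F'\<subseteq>auxs B Y. finite F' \<and> card F' = card F"
    and H_structure: "fo_structure (gadget_lang L k) H"
    and J_inj: "inj_on J (plain I B)"
    and M_universe: "universe M = J ` plain I B \<union>
      {K x v |x v. v \<in> universe H - roots k H \<and> x \<in> auxs B (part v)}"
    and K_root: "X \<in> I \<Longrightarrow> e \<in> rel B (Frag X) \<Longrightarrow> p < card X \<Longrightarrow>
      K (last e) (cst H (sorted_list_of_set X ! p)) = J (e ! p)"
    and K_not_J: "v \<in> universe H - roots k H \<Longrightarrow> x \<in> auxs B (part v) \<Longrightarrow> K x v \<notin> J ` plain I B"
    and K_inj: "v \<in> universe H - roots k H \<Longrightarrow> x \<in> auxs B (part v) \<Longrightarrow>
      w \<in> universe H - roots k H \<Longrightarrow> y \<in> auxs B (part w) \<Longrightarrow> K x v = K y w \<Longrightarrow> x = y \<and> v = w"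
    and M_rel: "S \<in> syms L \<Longrightarrow> t \<in> rel M S \<longleftrightarrow>
      (\<exists>s\<in>rel B (Orig S). set s \<subseteq> plain I B \<and> t = map J s) \<or>
      (\<exists>X\<in>I. \<exists>x\<in>auxs B X. \<exists>s\<in>rel H S. (\<forall>v\<in>set s. part v = X) \<and> t = map (K x) s)"
    and part_index: "v \<in> universe H \<Longrightarrow> part v \<in> I"
    and part_adjacent: "(u, v) \<in> gaifman L H \<Longrightarrow> part u = part v"
    and part_root: "j < k \<Longrightarrow> j \<in> part (cst H j)"
begin

lemma part_connected: "(u, v) \<in> (gaifman L H)\<^sup>* \<Longrightarrow> part u = part v"
  by (induction rule: rtrancl_induct) (auto dest: part_adjacent)

lemma cst_universe: "j < k \<Longrightarrow> cst H j \<in> universe H"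
  using H_structure unfolding fo_structure_def by simp

lemma part_root_eq:
  assumes "X \<in> I" "j \<in> X" "(cst H j, v) \<in> (gaifman L H)\<^sup>*"
  shows "part v = X"
proof -
  have j: "j < k" using I_sub assms by auto
  have "part (cst H j) = X" using I_disjoint[OF part_index[OF cst_universe[OF j]] assms(1)] part_root[OF j] assms(2) by blast
  then show ?thesis using part_connected[OF assms(3)] by simp
qed

lemma rel_H_universe: "S \<in> syms L \<Longrightarrow> s \<in> rel H S \<Longrightarrow> set s \<subseteq> universe H"
  using H_structure unfolding fo_structure_def by simp

lemma root_position:
  assumes "X \<in> I" "j \<in> X"
  obtains p where "p < card X" "sorted_list_of_set X ! p = j"
proof -
  have "finite X" using I_sub[OF assms(1)] finite_subset by blast
  then have "j \<in> set (sorted_list_of_set X)" "length (sorted_list_of_set X) = card X" using assms by auto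
  then show ?thesis using that by (metis in_set_conv_nth)
qed

end

text \<open>Playing a whole edge instead of its last vertex also settles the answers to the vertices
  at which the roots of the copy sit.\<close>

lemma bf_edge:
  assumes "bf LB B B' q" "Frag X \<in> syms LB" "e \<in> rel B (Frag X)" "e \<noteq> []" "set e \<subseteq> universe B"
  obtains e' where "length e' = length e" "e' \<in> rel B' (Frag X)" "bf LB B B' (q \<union> set (zip e e'))"
    "(last e, last e') \<in> set (zip e e')" "\<And>p. p < length e \<Longrightarrow> (e ! p, e' ! p) \<in> set (zip e e')"
proof -
  obtain e' where e': "length e' = length e" "bf LB B B' (q \<union> set (zip e e'))"
    using bf_extend_list[OF assms(1,5)] by blast
  have "e' \<in> rel B' (Frag X)" using bf_rel[OF e'(2) assms(2), of e e'] assms(3) e'(1) by simp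
  moreover have "(e ! p, e' ! p) \<in> set (zip e e')" if "p < length e" for p
    using that e'(1) by (auto simp: set_zip)
  moreover have "e' \<noteq> []" using assms(4) e'(1) by auto
  ultimately show ?thesis using that[of e'] e' assms(4) by (simp add: last_conv_nth)
qed

lemma bf_auxs:
  assumes "bf LB B B' q" "Frag X \<in> syms LB"
    and edge: "\<And>e. e \<in> rel B (Frag X) \<Longrightarrow> e \<noteq> [] \<and> set e \<subseteq> universe B"
    and "(x, x') \<in> q" "x \<in> auxs B X"
  shows "x' \<in> auxs B' X"
proof -
  obtain e where e: "e \<in> rel B (Frag X)" "x = last e" using assms(5) unfolding auxs_def by auto
  obtain e' where e': "e' \<in> rel B' (Frag X)" "bf LB B B' (q \<union> set (zip e e'))" "(last e, last e') \<in> set (zip e e')"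
    using bf_edge[OF assms(1,2) e(1)] edge[OF e(1)] by metis
  have "x' = last e'" using bf_eq[OF e'(2), of x x' "last e" "last e'"] assms(4) e(2) e'(3) by auto
  then show ?thesis using e'(1) unfolding auxs_def by auto
qed

text \<open>The elements of \<open>F\<close> are played one after another; their answers are
  distinct and again auxiliary of the same sort.\<close>

lemma bf_auxs_card:
  assumes "bf LB B B' {}" "Frag X \<in> syms LB"
    and edge: "\<And>e. e \<in> rel B (Frag X) \<Longrightarrow> e \<noteq> [] \<and> set e \<subseteq> universe B"
    and F: "finite F" "F \<subseteq> auxs B X"
  shows "\<exists>F'\<subseteq>auxs B' X. finite F' \<and> card F' = card F"
proof -
  obtain xs where xs: "set xs = F" "distinct xs" using finite_distinct_list[OF F(1)] by blast
  have "F \<subseteq> universe B" using F(2) edge last_in_set unfolding auxs_def by blast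
  then obtain xs' where xs': "length xs' = length xs" "bf LB B B' ({} \<union> set (zip xs xs'))"
    using bf_extend_list[OF assms(1), of xs] xs by blast
  have z: "(xs ! i, xs' ! i) \<in> {} \<union> set (zip xs xs')" if "i < length xs" for i
    using that xs'(1) by (auto simp: set_zip)
  have "distinct xs'"
    unfolding distinct_conv_nth
  proof (intro allI impI)
    fix i j assume "i < length xs'" "j < length xs'" "i \<noteq> j"
    then show "xs' ! i \<noteq> xs' ! j"
      using bf_eq[OF xs'(2) z z, of i j] xs(2) xs'(1) by (simp add: nth_eq_iff_index_eq)
  qed
  moreover have "set xs' \<subseteq> auxs B' X"
  proof
    fix x' assume "x' \<in> set xs'"
    then obtain i where i: "i < length xs" "x' = xs' ! i" using xs'(1) by (auto simp: in_set_conv_nth)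
    then have "xs ! i \<in> auxs B X" using F(2) xs(1) nth_mem by blast
    then show "x' \<in> auxs B' X" using bf_auxs[OF xs'(2) assms(2) edge z[OF i(1)]] i(2) by blast
  qed
  ultimately show ?thesis using xs xs'(1) distinct_card by (metis List.finite_set)
qed

section \<open>The combined game on two glued structures\<close>

locale gluing_pair =
  gluing L k I B H M part J K + g': gluing L k I B' H' M' part' J' K'
  for L :: "'r lang" and k I
    and B :: "('b, 'r frag_sym) fo_struct" and H :: "('h, 'r) fo_struct" and M :: "('m, 'r) fo_struct"
    and part J K
    and B' :: "('c, 'r frag_sym) fo_struct" and H' :: "('i, 'r) fo_struct" and M' :: "('n, 'r) fo_struct"
    and part' J' K' +
  fixes LB :: "'r frag_sym lang"
  assumes LB: "Orig ` syms L \<union> Frag ` I \<subseteq> syms LB"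
    and bf_B: "bf LB B B' {}"
    and bf_H: "bf (gadget_lang L k) H H' {}"
begin

text \<open>The situation is symmetric, so the facts below are shown in one direction and
  transported to the other by reversing positions.\<close>

lemma swap: "gluing_pair L k I B' H' M' part' J' K' B H M part J K LB"
  using LB bf_converse[OF bf_B] bf_converse[OF bf_H] gluing_axioms g'.gluing_axioms
  unfolding gluing_pair_def gluing_pair_axioms_def by simp

lemma conn_bf:
  assumes "bf (gadget_lang L k) H H' q" "(u, u') \<in> q" "(v, v') \<in> q"
  shows "(u, v) \<in> (gaifman L H)\<^sup>* \<longleftrightarrow> (u', v') \<in> (gaifman L H')\<^sup>*"
  using bf_connected[OF H_structure g'.H_structure assms] by simp

text \<open>The root can be inserted into the position as a constant, so its connection to
  \<open>v\<close> is preserved although it has not been played.\<close>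

lemma conn_root_bf:
  assumes "bf (gadget_lang L k) H H' q" "(v, v') \<in> q" "j < k"
  shows "(cst H j, v) \<in> (gaifman L H)\<^sup>* \<longleftrightarrow> (cst H' j, v') \<in> (gaifman L H')\<^sup>*"
proof -
  have "bf (gadget_lang L k) H H' (insert (cst H j, cst H' j) q)"
    using bf_insert_cst[OF assms(1), of j] assms(3) cst_universe by simp
  then show ?thesis using conn_bf assms(2) by blast
qed

lemma rooted_bf:
  assumes "bf (gadget_lang L k) H H' q" "(v, v') \<in> q"
  shows "rooted L k H v \<longleftrightarrow> rooted L k H' v'"
  unfolding rooted_def using conn_root_bf[OF assms] by blast

lemma roots_bf:
  assumes "bf (gadget_lang L k) H H' q" "(v, v') \<in> q"
  shows "v \<in> roots k H \<longleftrightarrow> v' \<in> roots k H'"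
  unfolding roots_def using bf_cst[OF assms(1) _ assms(2)] by auto

lemma Frag_LB: "X \<in> I \<Longrightarrow> Frag X \<in> syms LB"
  using LB by auto

lemma edge_ne: "X \<in> I \<Longrightarrow> e \<in> rel B (Frag X) \<Longrightarrow> e \<noteq> [] \<and> set e \<subseteq> universe B"
  using edge by fastforce

lemma edge_bf:
  assumes "bf LB B B' q" "X \<in> I" "e \<in> rel B (Frag X)"
  obtains e' where "length e' = length e" "e' \<in> rel B' (Frag X)" "bf LB B B' (q \<union> set (zip e e'))"
    "(last e, last e') \<in> set (zip e e')" "\<And>p. p < card X \<Longrightarrow> (e ! p, e' ! p) \<in> set (zip e e')"
  using bf_edge[OF assms(1) Frag_LB[OF assms(2)] assms(3)] edge_ne[OF assms(2,3)] edge[OF assms(2,3)]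
  by (metis less_SucI)

lemma auxs_bf_imp:
  assumes "bf LB B B' q" "X \<in> I" "(x, x') \<in> q" "x \<in> auxs B X"
  shows "x' \<in> auxs B' X"
  using bf_auxs[OF assms(1) Frag_LB[OF assms(2)] edge_ne[OF assms(2)] assms(3,4)] .

lemma auxs_bf:
  assumes "bf LB B B' q" "X \<in> I" "(x, x') \<in> q"
  shows "x \<in> auxs B X \<longleftrightarrow> x' \<in> auxs B' X"
proof -
  interpret sw: gluing_pair L k I B' H' M' part' J' K' B H M part J K LB by (rule swap)
  show ?thesis using auxs_bf_imp[OF assms] sw.auxs_bf_imp[OF bf_converse[OF assms(1)] assms(2), of x' x] assms(3) by auto
qed

lemma plain_bf:
  assumes "bf LB B B' q" "(x, x') \<in> q"
  shows "x \<in> plain I B \<longleftrightarrow> x' \<in> plain I B'"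
  unfolding plain_def using auxs_bf[OF assms(1) _ assms(2)] bf_universe[OF assms] by auto

text \<open>Only the left component is tested. For positions satisfying \<open>inv\<close> and
  \<open>a\<close> on the left of \<open>h\<close>, the test on the right side selects the same
  pairs.\<close>

definition slice :: "(('b \<times> 'h) \<times> ('c \<times> 'i)) set \<Rightarrow> 'b \<times> 'h \<Rightarrow> ('h \<times> 'i) set" where
  "slice h a = {(w, w'). \<exists>y y'. ((y, w), (y', w')) \<in> h \<and> copy_conn L H a (y, w)}"

text \<open>
  The invariant of the back-and-forth game. \<open>p\<close> is a position of the game on the fragmented
  structures, \<open>h\<close> matches the played points that are not roots inside copies of the gadgets;
  each touched component carries its own position \<open>slice h a\<close> of the game on the gadgets.
  Only components containing roots have to respect \<open>p\<close>.
\<close>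

definition matched :: "('b \<times> 'c) set \<Rightarrow> 'b \<times> 'h \<Rightarrow> 'c \<times> 'i \<Rightarrow> bool" where
  "matched p a a' \<longleftrightarrow>
     snd a \<in> universe H - roots k H \<and> fst a \<in> auxs B (part (snd a)) \<and>
     snd a' \<in> universe H' - roots k H' \<and> fst a' \<in> auxs B' (part' (snd a')) \<and>
     (rooted L k H (snd a) \<or> rooted L k H' (snd a') \<longrightarrow> (fst a, fst a') \<in> p)"

definition represented ::
  "('b \<times> 'c) set \<Rightarrow> (('b \<times> 'h) \<times> ('c \<times> 'i)) set \<Rightarrow> 'm \<Rightarrow> 'n \<Rightarrow> bool" where
  "represented p h m m' \<longleftrightarrow>
     (\<exists>b b'. (b, b') \<in> p \<and> b \<in> plain I B \<and> b' \<in> plain I B' \<and> m = J b \<and> m' = J' b') \<or>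
     (\<exists>x v x' v'. ((x, v), (x', v')) \<in> h \<and> m = K x v \<and> m' = K' x' v')"

definition inv :: "('b \<times> 'c) set \<Rightarrow> (('b \<times> 'h) \<times> ('c \<times> 'i)) set \<Rightarrow> ('m \<times> 'n) set \<Rightarrow> bool" where
  "inv p h q \<longleftrightarrow> finite h \<and> bf LB B B' p \<and>
     (\<forall>a a'. (a, a') \<in> h \<longrightarrow> matched p a a') \<and>
     (\<forall>a a' c c'. (a, a') \<in> h \<longrightarrow> (c, c') \<in> h \<longrightarrow> (copy_conn L H a c \<longleftrightarrow> copy_conn L H' a' c')) \<and>
     (\<forall>a a'. (a, a') \<in> h \<longrightarrow> bf (gadget_lang L k) H H' (slice h a)) \<and>
     (\<forall>m m'. (m, m') \<in> q \<longrightarrow> represented p h m m')"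

lemma invI:
  assumes "finite h" "bf LB B B' p"
    and "\<And>a a'. (a, a') \<in> h \<Longrightarrow> matched p a a'"
    and "\<And>a a' c c'. (a, a') \<in> h \<Longrightarrow> (c, c') \<in> h \<Longrightarrow> copy_conn L H a c \<longleftrightarrow> copy_conn L H' a' c'"
    and "\<And>a a'. (a, a') \<in> h \<Longrightarrow> bf (gadget_lang L k) H H' (slice h a)"
    and "\<And>m m'. (m, m') \<in> q \<Longrightarrow> represented p h m m'"
  shows "inv p h q"
  unfolding inv_def by (intro conjI allI impI) (fact assms)+

lemma inv_matched: "inv p h q \<Longrightarrow> (a, a') \<in> h \<Longrightarrow> matched p a a'"
  unfolding inv_def by blast

lemma inv_represented: "inv p h q \<Longrightarrow> (m, m') \<in> q \<Longrightarrow> represented p h m m'"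
  unfolding inv_def by blast

lemma invD:
  assumes "inv p h q"
  shows "finite h" "bf LB B B' p"
    and "\<And>x v x' v'. ((x, v), (x', v')) \<in> h \<Longrightarrow> v \<in> universe H - roots k H"
    and "\<And>x v x' v'. ((x, v), (x', v')) \<in> h \<Longrightarrow> x \<in> auxs B (part v)"
    and "\<And>x v x' v'. ((x, v), (x', v')) \<in> h \<Longrightarrow> v' \<in> universe H' - roots k H'"
    and "\<And>x v x' v'. ((x, v), (x', v')) \<in> h \<Longrightarrow> x' \<in> auxs B' (part' v')"
    and "\<And>x v x' v'. ((x, v), (x', v')) \<in> h \<Longrightarrow> rooted L k H v \<Longrightarrow> (x, x') \<in> p"
    and "\<And>x v x' v'. ((x, v), (x', v')) \<in> h \<Longrightarrow> rooted L k H' v' \<Longrightarrow> (x, x') \<in> p"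
    and "\<And>a a' c c'. (a, a') \<in> h \<Longrightarrow> (c, c') \<in> h \<Longrightarrow> copy_conn L H a c \<longleftrightarrow> copy_conn L H' a' c'"
    and "\<And>a a'. (a, a') \<in> h \<Longrightarrow> bf (gadget_lang L k) H H' (slice h a)"
proof -
  show "finite h" "bf LB B B' p" using assms unfolding inv_def by auto
  fix x v x' v' assume "((x, v), (x', v')) \<in> h"
  from inv_matched[OF assms this, unfolded matched_def]
  show "v \<in> universe H - roots k H" "x \<in> auxs B (part v)" "v' \<in> universe H' - roots k H'"
    "x' \<in> auxs B' (part' v')" "rooted L k H v \<Longrightarrow> (x, x') \<in> p" "rooted L k H' v' \<Longrightarrow> (x, x') \<in> p"
    by simp_all
next
  show "\<And>a a' c c'. (a, a') \<in> h \<Longrightarrow> (c, c') \<in> h \<Longrightarrow> copy_conn L H a c \<longleftrightarrow> copy_conn L H' a' c'"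
    "\<And>a a'. (a, a') \<in> h \<Longrightarrow> bf (gadget_lang L k) H H' (slice h a)"
    using assms unfolding inv_def by blast+
qed

lemma inv_q:
  assumes "inv p h q" "(m, m') \<in> q"
  obtains b b' where "(b, b') \<in> p" "b \<in> plain I B" "b' \<in> plain I B'" "m = J b" "m' = J' b'"
  | x v x' v' where "((x, v), (x', v')) \<in> h" "m = K x v" "m' = K' x' v'"
  using inv_represented[OF assms] unfolding represented_def by blast

lemma slice_self: "((x, v), (x', v')) \<in> h \<Longrightarrow> (v, v') \<in> slice h (x, v)"
  unfolding slice_def using copy_conn_refl by fastforce

lemma inv_q_J:
  assumes "inv p h q" "(J b, m') \<in> q" "b \<in> plain I B"
  obtains b' where "(b, b') \<in> p" "b' \<in> plain I B'" "m' = J' b'"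
  using assms(1,2)
proof (cases rule: inv_q)
  case (1 b2 b')
  then have "b = b2" using J_inj assms(3) unfolding inj_on_def by blast
  then show ?thesis using that 1 by blast
next
  case (2 x v x' v')
  then have "K x v \<notin> J ` plain I B" using K_not_J invD(3,4)[OF assms(1)] by blast
  then show ?thesis using 2(2) imageI[OF assms(3), of J] by simp
qed

lemma inv_q_K:
  assumes "inv p h q" "(K x v, m') \<in> q" "v \<in> universe H - roots k H" "x \<in> auxs B (part v)"
  obtains x' v' where "((x, v), (x', v')) \<in> h" "m' = K' x' v'"
  using assms(1,2)
proof (cases rule: inv_q)
  case (1 b b')
  then show ?thesis using K_not_J[OF assms(3,4)] by auto
next
  case (2 y w x' v')
  then have "x = y \<and> v = w" using K_inj[OF assms(3,4)] invD(3,4)[OF assms(1)] by blast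
  then show ?thesis using that 2 by blast
qed

lemma inv_converse:
  assumes "inv p h q"
  shows "gluing_pair.inv L k I B' H' part' J' K' B H part J K LB (p\<inverse>) (h\<inverse>) (q\<inverse>)"
proof -
  interpret sw: gluing_pair L k I B' H' M' part' J' K' B H M part J K LB by (rule swap)
  note D = invD[OF assms]
  have "sw.slice (h\<inverse>) a' = (slice h a)\<inverse>" if a: "(a, a') \<in> h" for a a'
    unfolding sw.slice_def slice_def using D(9)[OF a] by auto
  then have sl: "bf (gadget_lang L k) H' H (sw.slice (h\<inverse>) a')" if "(a, a') \<in> h" for a a'
    using that bf_converse[OF D(10)] by simp
  show ?thesis
  proof (rule sw.invI)
    show "finite (h\<inverse>)" "bf LB B' B (p\<inverse>)" using D(1) bf_converse[OF D(2)] by simp_all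
    show "sw.matched (p\<inverse>) a' a" if "(a', a) \<in> h\<inverse>" for a a'
      using inv_matched[OF assms, of a a'] that unfolding sw.matched_def matched_def by auto
    show "copy_conn L H' a' c' \<longleftrightarrow> copy_conn L H a c" if "(a', a) \<in> h\<inverse>" "(c', c) \<in> h\<inverse>" for a a' c c'
      using D(9)[of a a' c c'] that by simp
    show "bf (gadget_lang L k) H' H (sw.slice (h\<inverse>) a')" if "(a', a) \<in> h\<inverse>" for a a'
      using sl that by simp
    show "sw.represented (p\<inverse>) (h\<inverse>) m' m" if "(m', m) \<in> q\<inverse>" for m m'
      using inv_represented[OF assms, of m m'] that unfolding sw.represented_def represented_def
      by (meson converse_iff)
  qed
qed

lemma inv_eq_imp:
  assumes "inv p h q" "(m, m') \<in> q" "(m, n') \<in> q"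
  shows "m' = n'"
  using assms(1,2)
proof (cases rule: inv_q)
  case (1 b b')
  then obtain b2 where "(b, b2) \<in> p" "n' = J' b2" using inv_q_J[OF assms(1), of b n'] assms(3) by blast
  then show ?thesis using 1 bf_eq[OF invD(2)[OF assms(1)]] by blast
next
  case (2 x v x' v')
  note D = invD[OF assms(1)]
  obtain y' w' where 3: "((x, v), (y', w')) \<in> h" "n' = K' y' w'"
    using inv_q_K[OF assms(1), of x v n'] assms(3) 2 D(3,4) by metis
  have "copy_conn L H' (x', v') (y', w')" using D(9)[OF 2(1) 3(1)] copy_conn_refl by blast
  moreover have "v' = w'"
    using bf_eq[OF D(10)[OF 2(1)] slice_self[OF 2(1)] slice_self[OF 3(1)]] by blast
  ultimately show ?thesis using 2 3 by (simp add: copy_conn_def)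
qed

text \<open>A root of a copy is the same point as a vertex of its edge, so \<open>p\<close> dictates
  the answer; the extension \<open>p2\<close> knows the answers to the whole edge.\<close>

lemma inv_root_coordinate:
  assumes "inv p h q" "p \<subseteq> p2" "bf LB B B' p2" "X \<in> I" "e \<in> rel B (Frag X)" "e' \<in> rel B' (Frag X)"
    "\<And>i. i < card X \<Longrightarrow> (e ! i, e' ! i) \<in> p2" "j \<in> X" "(K (last e) (cst H j), m') \<in> q"
  shows "m' = K' (last e') (cst H' j)"
proof -
  obtain i where i: "i < card X" "sorted_list_of_set X ! i = j" using root_position[OF assms(4,8)] .
  have "K (last e) (cst H j) = J (e ! i)" "K' (last e') (cst H' j) = J' (e' ! i)"
    using K_root[OF assms(4,5) i(1)] g'.K_root[OF assms(4,6) i(1)] i(2) by auto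
  moreover obtain b' where "(e ! i, b') \<in> p" "m' = J' b'"
    using inv_q_J[OF assms(1), of "e ! i" m'] edge_plain[OF assms(4,5) i(1)] assms(9) calculation by metis
  moreover have "b' = e' ! i" using bf_eq[OF assms(3)] assms(2) assms(7)[OF i(1)] calculation by blast
  ultimately show ?thesis by simp
qed

text \<open>The difficult tuples come from a copy and mix roots, controlled by \<open>p\<close>,
  with other vertices, controlled by \<open>h\<close>. A tuple is connected, so its non-root entries
  share one slice; if a root occurs as well, the component is rooted and its copy has to follow
  \<open>p\<close>. Hence both sources name the same copy.\<close>

lemma inv_rel_imp:
  assumes inv: "inv p h q" and S: "S \<in> syms L" and len: "length t = length t'"
    and z: "set (zip t t') \<subseteq> q" and t: "t \<in> rel M S"
  shows "t' \<in> rel M' S"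
proof -
  note D = invD[OF inv]
  have zq: "(t ! i, t' ! i) \<in> q" if "i < length t" for i
    using z len that by (auto simp: set_zip)
  from t[unfolded M_rel[OF S]] consider
    (base) s where "s \<in> rel B (Orig S)" "set s \<subseteq> plain I B" "t = map J s" |
    (copy) X x s where "X \<in> I" "x \<in> auxs B X" "s \<in> rel H S" "\<forall>v\<in>set s. part v = X" "t = map (K x) s"
    by blast
  then show ?thesis
  proof cases
    case base
    have "\<forall>i<length s. \<exists>b'. (s ! i, b') \<in> p \<and> b' \<in> plain I B' \<and> t' ! i = J' b'"
    proof (intro allI impI)
      fix i assume i: "i < length s"
      then have "(J (s ! i), t' ! i) \<in> q" "s ! i \<in> plain I B" using zq[of i] base by auto
      then show "\<exists>b'. (s ! i, b') \<in> p \<and> b' \<in> plain I B' \<and> t' ! i = J' b'" using inv_q_J[OF inv] by metis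
    qed
    then obtain f where f: "\<And>i. i < length s \<Longrightarrow> (s ! i, f i) \<in> p \<and> f i \<in> plain I B' \<and> t' ! i = J' (f i)"
      by metis
    define s' where "s' = map f [0..<length s]"
    have "set (zip s s') \<subseteq> p" "length s = length s'" using f by (auto simp: s'_def set_zip)
    then have "s' \<in> rel B' (Orig S)" using bf_rel[OF D(2), of "Orig S" s s'] base(1) LB S by auto
    moreover have "set s' \<subseteq> plain I B'" using f by (auto simp: s'_def)
    moreover have "t' = map J' s'" using f len base(3) by (intro nth_equalityI) (auto simp: s'_def)
    ultimately show ?thesis unfolding g'.M_rel[OF S] by blast
  next
    case copy
    obtain e where e: "e \<in> rel B (Frag X)" "x = last e" using copy(2) unfolding auxs_def by auto
    obtain e' where e': "e' \<in> rel B' (Frag X)" "bf LB B B' (p \<union> set (zip e e'))"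
      "(last e, last e') \<in> set (zip e e')" "\<And>i. i < card X \<Longrightarrow> (e ! i, e' ! i) \<in> set (zip e e')"
      using edge_bf[OF D(2) copy(1) e(1)] by metis
    have sH: "set s \<subseteq> universe H" using rel_H_universe[OF S copy(3)] .
    have root_in: "j \<in> X" if "cst H j \<in> set s" "j < k" for j
      using copy(4) that part_root by blast
    have rootm: "m' = K' (last e') (cst H' j)" if "j < k" "cst H j \<in> set s" "(K x (cst H j), m') \<in> q" for j m'
      using inv_root_coordinate[OF inv Un_upper1 e'(2) copy(1) e(1) e'(1), of j m'] e'(4) root_in that e(2) by blast
    \<comment> \<open>It suffices to send all entries to one copy \<open>x'\<close> of one sort
      through one winning gadget position \<open>r\<close>.\<close>
    have main: "t' \<in> rel M' S"
      if X': "X' \<in> I" and x': "x' \<in> auxs B' X'" and bfr: "bf (gadget_lang L k) H H' r"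
        and f: "\<And>i. i < length s \<Longrightarrow> (s ! i, f i) \<in> r \<and> t' ! i = K' x' (f i) \<and> part' (f i) = X'"
      for X' x' r f
    proof -
      define s' where "s' = map f [0..<length s]"
      have "set (zip s s') \<subseteq> r" "length s = length s'" using f by (auto simp: s'_def set_zip)
      then have "s' \<in> rel H' S" using bf_rel[OF bfr, of S s s'] copy(3) S by simp
      moreover have "t' = map (K' x') s'" using f len copy(5) by (intro nth_equalityI) (auto simp: s'_def)
      moreover have "\<forall>v\<in>set s'. part' v = X'" using f by (auto simp: s'_def)
      ultimately show ?thesis unfolding g'.M_rel[OF S] using X' x' by blast
    qed
    define C where "C = (\<lambda>j. (cst H j, cst H' j)) ` {..<k}"
    have bfC: "bf (gadget_lang L k) H H' (r \<union> C)" if "bf (gadget_lang L k) H H' r" for r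
      unfolding C_def using bf_union_csts[OF that, of "{..<k}"] cst_universe by simp
    show ?thesis
    proof (cases "set s \<subseteq> roots k H")
      \<comment> \<open>With roots only, no slice exists; the position consisting of the constants
        alone serves as \<open>r\<close>, and the copy is found by playing the edge of
        \<open>x\<close>. The empty tuple falls under this case.\<close>
      case True
      have "\<forall>i<length s. \<exists>j<k. s ! i = cst H j" using True nth_mem unfolding roots_def by fastforce
      then obtain j where j: "\<And>i. i < length s \<Longrightarrow> j i < k \<and> s ! i = cst H (j i)" by metis
      have x': "last e' \<in> auxs B' X" using e'(1) unfolding auxs_def by auto
      show ?thesis
      proof (rule main[OF copy(1) x' bfC[OF bf_H], of "\<lambda>i. cst H' (j i)"])
        fix i assume i: "i < length s"
        have js: "cst H (j i) \<in> set s" using j[OF i] i nth_mem by metis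
        have "(K x (cst H (j i)), t' ! i) \<in> q" using zq[of i] i copy(5) j[OF i] by auto
        then have "t' ! i = K' (last e') (cst H' (j i))" using rootm j[OF i] js by blast
        moreover have "part' (cst H' (j i)) = X"
          using g'.part_root_eq[OF copy(1) root_in[OF js]] j[OF i] by blast
        ultimately show "(s ! i, cst H' (j i)) \<in> {} \<union> C \<and> t' ! i = K' (last e') (cst H' (j i)) \<and> part' (cst H' (j i)) = X"
          using j[OF i] unfolding C_def by auto
      qed
    next
      case False
      have nonroot: "\<exists>x' v'. ((x, v), (x', v')) \<in> h \<and> t' ! i = K' x' v'"
        if "i < length s" "s ! i = v" "v \<notin> roots k H" for v i
      proof -
        have "v \<in> set s" using that(1,2) nth_mem by auto
        then have v: "v \<in> universe H - roots k H" "x \<in> auxs B (part v)"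
          using that(3) sH copy(2,4) by auto
        have "(K x v, t' ! i) \<in> q" using zq[of i] that copy(5) by auto
        then show ?thesis using inv_q_K[OF inv _ v] by metis
      qed
      obtain i0 where i0: "i0 < length s" "s ! i0 \<notin> roots k H" using False by (auto simp: in_set_conv_nth subset_iff)
      define v0 where "v0 = s ! i0"
      obtain x' v0' where h0: "((x, v0), (x', v0')) \<in> h" using nonroot[OF i0(1) refl i0(2)] v0_def by blast
      have conn0: "(v0, v) \<in> (gaifman L H)\<^sup>*" if "v \<in> set s" for v
        using same_tuple_connected[OF S copy(3), of v0 v] that i0 v0_def by simp
      have "\<exists>v'. (s ! i, v') \<in> slice h (x, v0) \<union> C \<and> t' ! i = K' x' v' \<and> part' v' = part' v0'"
        if i: "i < length s" for i
      proof -
        have bfr: "bf (gadget_lang L k) H H' (slice h (x, v0) \<union> C)" using bfC[OF D(10)[OF h0]] .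
        have 0: "(v0, v0') \<in> slice h (x, v0) \<union> C" using slice_self[OF h0] by blast
        have ci: "(v0, s ! i) \<in> (gaifman L H)\<^sup>*" using conn0 i by simp
        have "\<exists>v'. (s ! i, v') \<in> slice h (x, v0) \<union> C \<and> t' ! i = K' x' v'"
        proof (cases "s ! i \<in> roots k H")
          case True
          then obtain j where j: "j < k" "s ! i = cst H j" unfolding roots_def by auto
          \<comment> \<open>A root among the entries makes the component of \<open>v0\<close>
            rooted, so the copy chosen for \<open>v0\<close> must be the one ending the answer to
            \<open>e\<close>.\<close>
          have "rooted L k H v0" unfolding rooted_def using j ci gaifman_rtrancl_sym by metis
          then have "(x, x') \<in> p" using D(7)[OF h0] by blast
          then have "x' = last e'" using bf_eq[OF e'(2), of x x' x "last e'"] e'(3) e(2) by auto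
          moreover have "(K x (cst H j), t' ! i) \<in> q" using zq[of i] i copy(5) j by auto
          ultimately have "t' ! i = K' x' (cst H' j)" using rootm[OF j(1)] j(2) i nth_mem by metis
          then show ?thesis using j unfolding C_def by auto
        next
          case False
          then obtain y' v' where h: "((x, s ! i), (y', v')) \<in> h" "t' ! i = K' y' v'" using nonroot[OF i refl] by blast
          have cc: "copy_conn L H (x, v0) (x, s ! i)" using ci by (simp add: copy_conn_def)
          then have "y' = x'" using D(9)[OF h0 h(1)] by (simp add: copy_conn_def)
          moreover have "(s ! i, v') \<in> slice h (x, v0)" unfolding slice_def using h(1) cc by blast
          ultimately show ?thesis using h by blast
        qed
        then obtain v' where v': "(s ! i, v') \<in> slice h (x, v0) \<union> C" "t' ! i = K' x' v'" by blast
        moreover have "(v0', v') \<in> (gaifman L H')\<^sup>*" using conn_bf[OF bfr 0 v'(1)] ci by blast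
        ultimately show ?thesis using g'.part_connected by metis
      qed
      then obtain f where f: "\<And>i. i < length s \<Longrightarrow> (s ! i, f i) \<in> slice h (x, v0) \<union> C \<and> t' ! i = K' x' (f i) \<and> part' (f i) = part' v0'"
        by metis
      have "part' v0' \<in> I" "x' \<in> auxs B' (part' v0')" using g'.part_index D(5,6)[OF h0] by auto
      then show ?thesis using main[OF _ _ bfC[OF D(10)[OF h0]] f] by blast
    qed
  qed
qed

lemma inv_mono:
  assumes "inv p h q" "bf LB B B' p2" "p \<subseteq> p2"
  shows "inv p2 h q"
proof (rule invI)
  show "matched p2 a a'" if "(a, a') \<in> h" for a a'
    using inv_matched[OF assms(1) that] assms(3) unfolding matched_def by blast
  show "represented p2 h m m'" if "(m, m') \<in> q" for m m'
    using inv_represented[OF assms(1) that] assms(3) unfolding represented_def by blast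
qed (fact invD[OF assms(1)] assms(2))+

text \<open>A new point changes only the slices of its own component, so a single gadget position
  has to be checked.\<close>

lemma inv_insert:
  assumes inv: "inv p h q" and v: "v \<in> universe H - roots k H" "x \<in> auxs B (part v)"
    and v': "v' \<in> universe H' - roots k H'" "x' \<in> auxs B' (part' v')"
    and rt: "rooted L k H v \<or> rooted L k H' v' \<Longrightarrow> (x, x') \<in> p"
    and cc: "\<And>c c'. (c, c') \<in> h \<Longrightarrow> copy_conn L H (x, v) c \<longleftrightarrow> copy_conn L H' (x', v') c'"
    and sl: "bf (gadget_lang L k) H H' (insert (v, v') (slice h (x, v)))"
  shows "inv p (insert ((x, v), (x', v')) h) (insert (K x v, K' x' v') q)"
proof -
  note D = invD[OF inv]
  let ?h = "insert ((x, v), (x', v')) h"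
  have slice1: "slice ?h a \<subseteq> insert (v, v') (slice h (x, v))" if "copy_conn L H (x, v) a" for a
    using that copy_conn_trans unfolding slice_def by blast
  have slice2: "slice ?h a = slice h a" if "\<not> copy_conn L H (x, v) a" for a
    using that copy_conn_sym unfolding slice_def by blast
  have sl': "bf (gadget_lang L k) H H' (slice ?h a)" if "(a, a') \<in> ?h" for a a'
  proof (cases "copy_conn L H (x, v) a")
    case True
    then show ?thesis using bf_mono[OF sl slice1] by blast
  next
    case False
    then have "(a, a') \<in> h" using that copy_conn_refl by blast
    then show ?thesis using slice2[OF False] D(10) by simp
  qed
  have cc': "copy_conn L H a c \<longleftrightarrow> copy_conn L H' a' c'" if ac: "(a, a') \<in> ?h" "(c, c') \<in> ?h" for a a' c c'
  proof -
    consider "(a, a') \<in> h" "(c, c') \<in> h" | "(a, a') = ((x, v), (x', v'))" "(c, c') \<in> h"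
      | "(a, a') \<in> h" "(c, c') = ((x, v), (x', v'))" | "(a, a') = ((x, v), (x', v'))" "(c, c') = ((x, v), (x', v'))"
      using ac by blast
    then show ?thesis
    proof cases
      case 1
      then show ?thesis using D(9) by blast
    next
      case 2
      then show ?thesis using cc by blast
    next
      case 3
      then show ?thesis using cc copy_conn_sym by (metis Pair_inject)
    next
      case 4
      then show ?thesis using copy_conn_refl by (metis Pair_inject)
    qed
  qed
  show ?thesis
  proof (rule invI)
    show "finite ?h" "bf LB B B' p" using D(1,2) by simp_all
    show "matched p a a'" if "(a, a') \<in> ?h" for a a'
    proof (cases "(a, a') \<in> h")
      case True
      then show ?thesis by (rule inv_matched[OF inv])
    next
      case False
      then have "a = (x, v)" "a' = (x', v')" using that by auto
      then show ?thesis using v v' rt unfolding matched_def by simp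
    qed
    show "represented p ?h m m'" if "(m, m') \<in> insert (K x v, K' x' v') q" for m m'
    proof (cases "(m, m') \<in> q")
      case True
      from inv_represented[OF inv this] show ?thesis unfolding represented_def by blast
    next
      case False
      then show ?thesis using that unfolding represented_def by blast
    qed
  qed (fact cc' sl')+
qed

lemma auxs_card_bf:
  assumes "X \<in> I" "Y \<in> I" "finite F" "F \<subseteq> auxs B X"
  shows "\<exists>F'\<subseteq>auxs B' Y. finite F' \<and> card F' = card F"
proof -
  obtain F1 where F1: "F1 \<subseteq> auxs B Y" "finite F1" "card F1 = card F" using auxs_card[OF assms] by blast
  show ?thesis using bf_auxs_card[OF bf_B Frag_LB[OF assms(2)] edge_ne[OF assms(2)] F1(2,1)] F1(3) by simp
qed

section \<open>Counting components of a given type\<close>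

definition scattered :: "('b \<times> 'h) set \<Rightarrow> bool" where
  "scattered F \<longleftrightarrow> (\<forall>a\<in>F. \<forall>c\<in>F. copy_conn L H a c \<longrightarrow> a = c)"

text \<open>The type is named by a point \<open>u\<close> of the other gadget because
  \<open>bf\<close> is available between \<open>H\<close> and \<open>H'\<close>; two points of
  \<open>H\<close> have equal type if both correspond to \<open>u\<close>.\<close>

definition of_type :: "'i \<Rightarrow> ('b \<times> 'h) set" where
  "of_type u = {(x, w). w \<in> universe H \<and> x \<in> auxs B (part w) \<and> bf (gadget_lang L k) H H' {(w, u)}}"

text \<open>All of \<open>W\<close> is played in one game, so unconnected points receive unconnected
  answers. The type is carried along by composing the passages from \<open>v\<close> to
  \<open>u\<close>, back to \<open>w\<close>, and on to the answer.\<close>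

lemma type_transfer:
  assumes "finite W" "W \<subseteq> universe H" "\<And>w. w \<in> W \<Longrightarrow> bf (gadget_lang L k) H H' {(w, u)}"
    and vu: "bf (gadget_lang L k) H H' {(v, u)}"
    and sep: "\<And>w1 w2. w1 \<in> W \<Longrightarrow> w2 \<in> W \<Longrightarrow> (w1, w2) \<in> (gaifman L H)\<^sup>* \<Longrightarrow> w1 = w2"
  shows "\<exists>f. (\<forall>w\<in>W. f w \<in> universe H' \<and> bf (gadget_lang L k) H H' {(v, f w)}) \<and>
    (\<forall>w1\<in>W. \<forall>w2\<in>W. (f w1, f w2) \<in> (gaifman L H')\<^sup>* \<longrightarrow> w1 = w2)"
proof -
  obtain ws where ws: "set ws = W" "distinct ws" using finite_distinct_list[OF assms(1)] by blast
  obtain ws' where ws': "length ws' = length ws" "bf (gadget_lang L k) H H' ({} \<union> set (zip ws ws'))"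
    using bf_extend_list[OF bf_H, of ws] assms(2) ws by blast
  have "\<forall>w\<in>W. \<exists>w'. (w, w') \<in> {} \<union> set (zip ws ws')"
  proof
    fix w assume "w \<in> W"
    then obtain i where "i < length ws" "w = ws ! i" using ws(1) by (auto simp: in_set_conv_nth)
    then show "\<exists>w'. (w, w') \<in> {} \<union> set (zip ws ws')"
      using ws'(1) by (intro exI[of _ "ws' ! i"]) (auto simp: set_zip)
  qed
  then obtain f where f: "\<And>w. w \<in> W \<Longrightarrow> (w, f w) \<in> {} \<union> set (zip ws ws')" by metis
  have "f w \<in> universe H' \<and> bf (gadget_lang L k) H H' {(v, f w)}" if w: "w \<in> W" for w
  proof
    show "f w \<in> universe H'" using bf_universe[OF ws'(2) f[OF w]] by blast
    have "bf (gadget_lang L k) H H' {(w, f w)}" using bf_mono[OF ws'(2)] f[OF w] by blast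
    from bf_trans[OF bf_trans[OF vu bf_converse[OF assms(3)[OF w]]] this]
    have "bf (gadget_lang L k) H H' (({(v, u)} O {(w, u)}\<inverse>) O {(w, f w)})" .
    moreover have "({(v, u)} O {(w, u)}\<inverse>) O {(w, f w)} = {(v, f w)}" by auto
    ultimately show "bf (gadget_lang L k) H H' {(v, f w)}" by simp
  qed
  moreover have "w1 = w2" if "w1 \<in> W" "w2 \<in> W" "(f w1, f w2) \<in> (gaifman L H')\<^sup>*" for w1 w2
    using conn_bf[OF ws'(2) f[OF that(1)] f[OF that(2)]] that(3) sep[OF that(1,2)] by blast
  ultimately show ?thesis by (intro exI[of _ f] conjI ballI impI) auto
qed

text \<open>
  Every part has equally many copies (up to infinity), so the number of components of a given
  type in the glued structure is the number of copies times the number of components of this type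
  in the gadget, no matter how these components are distributed over the parts.
\<close>

lemma scattered_transfer:
  assumes F: "finite F" "F \<subseteq> of_type u" "scattered F" and vu: "bf (gadget_lang L k) H H' {(v, u)}"
  shows "\<exists>F'. finite F' \<and> card F' = card F \<and>
    (\<forall>(x, w)\<in>F'. w \<in> universe H' \<and> x \<in> auxs B' (part' w) \<and> bf (gadget_lang L k) H H' {(v, w)}) \<and>
    (\<forall>a\<in>F'. \<forall>c\<in>F'. copy_conn L H' a c \<longrightarrow> a = c)"
proof (cases "F = {}")
  case True
  then show ?thesis by auto
next
  case False
  \<comment> \<open>\<open>r\<close> picks one vertex from each gadget component met by
    \<open>F\<close>, regardless of the copy.\<close>
  define r where "r w = (SOME w2. w2 \<in> snd ` F \<and> (w, w2) \<in> (gaifman L H)\<^sup>*)" for w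
  have r: "r w \<in> snd ` F \<and> (w, r w) \<in> (gaifman L H)\<^sup>*" if "w \<in> snd ` F" for w
    unfolding r_def by (rule someI[of _ w]) (use that in auto)
  have r_eq: "r w1 = r w2" if "(w1, w2) \<in> (gaifman L H)\<^sup>*" for w1 w2
  proof -
    have "(w1, z) \<in> (gaifman L H)\<^sup>* \<longleftrightarrow> (w2, z) \<in> (gaifman L H)\<^sup>*" for z
      using that gaifman_rtrancl_sym rtrancl_trans by metis
    then show ?thesis unfolding r_def by simp
  qed
  define W where "W = r ` snd ` F"
  have Wsub: "W \<subseteq> snd ` F" unfolding W_def using r by blast
  have Wfin: "finite W" unfolding W_def using F(1) by simp
  have Wne: "W \<noteq> {}" unfolding W_def using False by simp
  have Wty: "w \<in> universe H \<and> bf (gadget_lang L k) H H' {(w, u)}" if "w \<in> W" for w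
    using that Wsub F(2) unfolding of_type_def by fastforce
  have sep: "w1 = w2" if w: "w1 \<in> W" "w2 \<in> W" "(w1, w2) \<in> (gaifman L H)\<^sup>*" for w1 w2
  proof -
    have "r w1 = w1" if w1: "w1 \<in> W" for w1
    proof -
      obtain w where "w \<in> snd ` F" "w1 = r w" using w1 unfolding W_def by blast
      then show ?thesis using r r_eq by metis
    qed
    then show ?thesis using r_eq[OF w(3)] w by simp
  qed
  have Wu: "W \<subseteq> universe H" and Wb: "\<And>w. w \<in> W \<Longrightarrow> bf (gadget_lang L k) H H' {(w, u)}" using Wty by blast+
  obtain f where f: "\<And>w. w \<in> W \<Longrightarrow> f w \<in> universe H' \<and> bf (gadget_lang L k) H H' {(v, f w)}"
    and fsep: "\<And>w1 w2. w1 \<in> W \<Longrightarrow> w2 \<in> W \<Longrightarrow> (f w1, f w2) \<in> (gaifman L H')\<^sup>* \<Longrightarrow> w1 = w2"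
    using type_transfer[OF Wfin Wu Wb vu sep] by blast
  define Fw where "Fw w = {a \<in> F. r (snd a) = w}" for w
  define N where "N = Max ((\<lambda>w. card (Fw w)) ` W)"
  have N: "card (Fw w) \<le> N" if "w \<in> W" for w unfolding N_def using that Wfin by (intro Max_ge) auto
  have "N \<in> (\<lambda>w. card (Fw w)) ` W" unfolding N_def using Wfin Wne by (intro Max_in) auto
  then obtain w0 where w0: "w0 \<in> W" "N = card (Fw w0)" by blast
  have "F = (\<Union>w\<in>W. Fw w)" unfolding Fw_def W_def by auto
  then have "card F \<le> (\<Sum>w\<in>W. card (Fw w))" using card_UN_le[OF Wfin, of Fw] by simp
  also have "\<dots> \<le> card W * N" using sum_bounded_above[of W "\<lambda>w. card (Fw w)" N] N by simp
  finally have cardF: "card F \<le> card W * N" .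
  have conn0: "(snd a, w0) \<in> (gaifman L H)\<^sup>*" if "a \<in> Fw w0" for a
    using that r[of "snd a"] unfolding Fw_def by auto
  \<comment> \<open>Two points over the same gadget component and in the same copy would be
    connected; so the \<open>N\<close> points use \<open>N\<close> different copies, and every sort
    on the other side has at least as many.\<close>
  have inj0: "inj_on fst (Fw w0)"
  proof (rule inj_onI)
    fix a c assume a: "a \<in> Fw w0" and c: "c \<in> Fw w0" and "fst a = fst c"
    then have "copy_conn L H a c" unfolding copy_conn_def
      using conn0[OF a] conn0[OF c] gaifman_rtrancl_sym rtrancl_trans by metis
    then show "a = c" using F(3) a c unfolding scattered_def Fw_def by blast
  qed
  have sub0: "fst ` Fw w0 \<subseteq> auxs B (part w0)"
  proof
    fix x assume "x \<in> fst ` Fw w0"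
    then obtain w where xw: "(x, w) \<in> Fw w0" by auto
    then have "x \<in> auxs B (part w)" using F(2) unfolding Fw_def of_type_def by auto
    then show "x \<in> auxs B (part w0)" using part_connected[of w w0] conn0[OF xw] by simp
  qed
  have fin0: "finite (fst ` Fw w0)" using F(1) unfolding Fw_def by simp
  have "part w0 \<in> I" using Wty[OF w0(1)] part_index by blast
  then have "\<forall>Y\<in>I. \<exists>E\<subseteq>auxs B' Y. finite E \<and> card E = N"
    using auxs_card_bf[OF _ _ fin0 sub0] card_image[OF inj0] w0(2) by metis
  then obtain E where E: "\<And>Y. Y \<in> I \<Longrightarrow> E Y \<subseteq> auxs B' Y \<and> finite (E Y) \<and> card (E Y) = N" by metis
  \<comment> \<open>The grid of all pairs of a transferred component and one of \<open>N\<close>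
    copies of whatever sort carries it.\<close>
  define F2 where "F2 = (\<Union>w\<in>W. (\<lambda>y. (y, f w)) ` E (part' (f w)))"
  have EI: "E (part' (f w)) \<subseteq> auxs B' (part' (f w)) \<and> finite (E (part' (f w))) \<and> card (E (part' (f w))) = N"
    if "w \<in> W" for w using E g'.part_index f[OF that] by blast
  have finj: "w1 = w2" if "w1 \<in> W" "w2 \<in> W" "f w1 = f w2" for w1 w2
    using fsep[OF that(1,2)] that(3) by simp
  have "card F2 = (\<Sum>w\<in>W. card ((\<lambda>y. (y, f w)) ` E (part' (f w))))"
    unfolding F2_def by (rule card_UN_disjoint) (use Wfin EI finj in auto)
  also have "\<dots> = card W * N" using EI by (simp add: card_image inj_on_def)
  finally have "card F \<le> card F2" using cardF by simp
  moreover have F2fin: "finite F2" unfolding F2_def using Wfin EI by auto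
  ultimately obtain F' where F': "F' \<subseteq> F2" "card F' = card F" "finite F'"
    using obtain_subset_with_card_n by metis
  have "w \<in> universe H' \<and> x \<in> auxs B' (part' w) \<and> bf (gadget_lang L k) H H' {(v, w)}"
    if "(x, w) \<in> F2" for x w
    using that f EI unfolding F2_def by blast
  moreover have "a = c" if ac: "a \<in> F2" "c \<in> F2" "copy_conn L H' a c" for a c
  proof -
    obtain w1 where "w1 \<in> W" "snd a = f w1" using ac(1) unfolding F2_def by auto
    moreover obtain w2 where "w2 \<in> W" "snd c = f w2" using ac(2) unfolding F2_def by auto
    ultimately show ?thesis using ac(3) fsep unfolding copy_conn_def by (metis prod.expand)
  qed
  ultimately show ?thesis using F' by (intro exI[of _ F']) blast
qed

text \<open>If every right component of the type of \<open>v\<close> were touched, a scattered set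
  of such points could have at most \<open>card h\<close> elements. A largest one is pulled back
  along the running gadget games; together with the untouched \<open>(x, v)\<close> it has one
  element more, and \<open>scattered_transfer\<close> sends it to a larger scattered set on the
  right.\<close>

lemma fresh_component:
  assumes inv: "inv p h q" and x: "x \<in> auxs B (part v)" and v: "v \<in> universe H"
    and fresh: "\<And>c c'. (c, c') \<in> h \<Longrightarrow> \<not> copy_conn L H (x, v) c"
  shows "\<exists>x' v'. v' \<in> universe H' \<and> x' \<in> auxs B' (part' v') \<and> bf (gadget_lang L k) H H' {(v, v')} \<and>
    (\<forall>c c'. (c, c') \<in> h \<longrightarrow> \<not> copy_conn L H' (x', v') c')"
proof (rule ccontr)
  assume contr: "\<not> ?thesis"
  note D = invD[OF inv]
  obtain u where vu: "bf (gadget_lang L k) H H' {(v, u)}" using bf_forth[OF bf_H v] by blast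
  define T where "T = {(x', w). w \<in> universe H' \<and> x' \<in> auxs B' (part' w) \<and> bf (gadget_lang L k) H H' {(v, w)}}"
  define P where "P F' \<longleftrightarrow> finite F' \<and> F' \<subseteq> T \<and> (\<forall>a\<in>F'. \<forall>c\<in>F'. copy_conn L H' a c \<longrightarrow> a = c)" for F'
  have used: "\<exists>c c'. (c, c') \<in> h \<and> copy_conn L H' f' c'" if "f' \<in> T" for f'
    using contr that unfolding T_def by blast
  define s where "s f' = (SOME cc. cc \<in> h \<and> copy_conn L H' f' (snd cc))" for f'
  have s: "s f' \<in> h \<and> copy_conn L H' f' (snd (s f'))" if "f' \<in> T" for f'
  proof -
    have "\<exists>cc. cc \<in> h \<and> copy_conn L H' f' (snd cc)" using used[OF that] by fastforce
    then show ?thesis unfolding s_def by (rule someI_ex)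
  qed
  \<comment> \<open>Each point of \<open>F'\<close> is charged to a pair of \<open>h\<close>
    touching its component; two points charged to the same pair would be connected.\<close>
  have "card F' \<le> card h" if "P F'" for F'
  proof (rule card_inj_on_le[of s])
    show "inj_on s F'"
    proof (rule inj_onI)
      fix a c assume "a \<in> F'" "c \<in> F'" "s a = s c"
      then have "copy_conn L H' a c" using that s copy_conn_sym copy_conn_trans unfolding P_def by (metis subsetD)
      then show "a = c" using that \<open>a \<in> F'\<close> \<open>c \<in> F'\<close> unfolding P_def by blast
    qed
    show "s ` F' \<subseteq> h" using that s unfolding P_def by blast
    show "finite h" using D(1) .
  qed
  moreover have "P {}" unfolding P_def by simp
  ultimately obtain F' where F': "P F'" and max: "\<And>F2. P F2 \<Longrightarrow> card F2 \<le> card F'"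
    using ex_has_greatest_nat[of P "{}" card "Suc (card h)"] by (auto simp: less_Suc_eq_le)
  have "\<exists>f. f \<in> of_type u \<and> copy_conn L H f (fst (s f'))" if f': "f' \<in> F'" for f'
  proof -
    have T: "f' \<in> T" using F' f' unfolding P_def by blast
    obtain y w y' w' where sf: "s f' = ((y, w), (y', w'))" by (metis prod.exhaust)
    have h: "((y, w), (y', w')) \<in> h" and cc: "copy_conn L H' f' (y', w')" using s[OF T] sf by auto
    obtain z' where z': "f' = (y', z')" "(z', w') \<in> (gaifman L H')\<^sup>*"
      using cc unfolding copy_conn_def by (cases f') auto
    have zT: "z' \<in> universe H'" "bf (gadget_lang L k) H H' {(v, z')}" using T z' unfolding T_def by auto
    \<comment> \<open>The point is pulled back within the game already running in the component of
      \<open>w\<close>, so \<open>z\<close> lands in that component; its type is \<open>u\<close> by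
      composition through \<open>z'\<close> and \<open>v\<close>.\<close>
    obtain z where z: "bf (gadget_lang L k) H H' (insert (z, z') (slice h (y, w)))"
      using bf_back[OF D(10)[OF h] zT(1)] by blast
    have zH: "z \<in> universe H" using bf_universe[OF z, of z z'] by blast
    have zw: "(z, w) \<in> (gaifman L H)\<^sup>*" using conn_bf[OF z, of z z' w w'] slice_self[OF h] z'(2) by blast
    have "bf (gadget_lang L k) H H' {(z, z')}" using bf_mono[OF z] by blast
    from bf_trans[OF bf_trans[OF this bf_converse[OF zT(2)]] vu]
    have "bf (gadget_lang L k) H H' (({(z, z')} O {(v, z')}\<inverse>) O {(v, u)})" .
    moreover have "({(z, z')} O {(v, z')}\<inverse>) O {(v, u)} = {(z, u)}" by auto
    ultimately have "bf (gadget_lang L k) H H' {(z, u)}" by simp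
    moreover have "y \<in> auxs B (part z)" using D(4)[OF h] part_connected[OF zw] by simp
    ultimately have "(y, z) \<in> of_type u" using zH unfolding of_type_def by blast
    moreover have "copy_conn L H (y, z) (fst (s f'))" using zw sf unfolding copy_conn_def by simp
    ultimately show ?thesis by blast
  qed
  then obtain g where g: "\<And>f'. f' \<in> F' \<Longrightarrow> g f' \<in> of_type u \<and> copy_conn L H (g f') (fst (s f'))" by metis
  have sh: "(fst (s f'), snd (s f')) \<in> h" if "f' \<in> F'" for f'
  proof -
    have "f' \<in> T" using F' that unfolding P_def by blast
    then show ?thesis using s[of f'] by simp
  qed
  have gsep: "f1 = f2" if f: "f1 \<in> F'" "f2 \<in> F'" and cc: "copy_conn L H (g f1) (g f2)" for f1 f2
  proof -
    have "copy_conn L H (fst (s f1)) (fst (s f2))"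
      using cc g[OF f(1)] g[OF f(2)] copy_conn_sym copy_conn_trans by metis
    then have "copy_conn L H' (snd (s f1)) (snd (s f2))" using D(9)[OF sh[OF f(1)] sh[OF f(2)]] by blast
    moreover have "f1 \<in> T" "f2 \<in> T" using F' f unfolding P_def by auto
    ultimately have "copy_conn L H' f1 f2" using s copy_conn_sym copy_conn_trans by metis
    then show ?thesis using F' f unfolding P_def by blast
  qed
  have gnew: "\<not> copy_conn L H (x, v) (g f')" if "f' \<in> F'" for f'
    using fresh[OF sh[OF that]] g[OF that] copy_conn_trans by metis
  define F where "F = insert (x, v) (g ` F')"
  have "finite F" using F' unfolding F_def P_def by simp
  moreover have "(x, v) \<in> of_type u" using vu x v unfolding of_type_def by blast
  then have "F \<subseteq> of_type u" using g unfolding F_def by blast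
  moreover have "scattered F"
    unfolding scattered_def
  proof (intro ballI impI)
    fix a c assume "a \<in> F" "c \<in> F" and cc: "copy_conn L H a c"
    then consider "a = (x, v)" "c = (x, v)" | f' where "f' \<in> F'" "a = (x, v)" "c = g f'"
      | f' where "f' \<in> F'" "c = (x, v)" "a = g f'" | f1 f2 where "f1 \<in> F'" "f2 \<in> F'" "a = g f1" "c = g f2"
      unfolding F_def by blast
    then show "a = c"
    proof cases
      case 2
      then show ?thesis using gnew cc by blast
    next
      case 3
      then show ?thesis using gnew copy_conn_sym[OF cc] by blast
    next
      case 4
      then show ?thesis using gsep cc by blast
    qed simp
  qed
  ultimately obtain F2 where F2: "finite F2" "card F2 = card F"
    "\<forall>(x, w)\<in>F2. w \<in> universe H' \<and> x \<in> auxs B' (part' w) \<and> bf (gadget_lang L k) H H' {(v, w)}"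
    "\<forall>a\<in>F2. \<forall>c\<in>F2. copy_conn L H' a c \<longrightarrow> a = c"
    using scattered_transfer[OF _ _ _ vu, of F] by blast
  then have "P F2" unfolding P_def T_def by auto
  moreover have "card F = Suc (card F')"
  proof -
    have "(x, v) \<notin> g ` F'" using gnew copy_conn_refl by fastforce
    moreover have "inj_on g F'" using gsep copy_conn_refl by (metis inj_onI)
    ultimately show ?thesis unfolding F_def using F' by (simp add: card_image P_def)
  qed
  ultimately show False using max[of F2] F2(2) by simp
qed

section \<open>Answering moves in the glued structures\<close>

text \<open>Four kinds of moves: a base point is answered in the game on \<open>B\<close>; a point
  of a touched component, in the game of its slice; a point of a new rooted component opens a slice
  in the copy prescribed by the edge; a point of a new rootless component gets a component from
  \<open>fresh_component\<close>.\<close>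

lemma inv_forth:
  assumes inv: "inv p h q" and m: "m \<in> universe M"
  shows "\<exists>p h m'. inv p h (insert (m, m') q)"
proof -
  note D = invD[OF inv]
  from m[unfolded M_universe] consider (base) b where "b \<in> plain I B" "m = J b"
    | (copy) x v where "v \<in> universe H - roots k H" "x \<in> auxs B (part v)" "m = K x v"
    by blast
  then show ?thesis
  proof cases
    case base
    have "b \<in> universe B" using base(1) unfolding plain_def by blast
    then obtain b' where b': "bf LB B B' (insert (b, b') p)" using bf_forth[OF D(2)] by blast
    then have pl: "b' \<in> plain I B'" using plain_bf[OF b', of b b'] base(1) by blast
    have inv2: "inv (insert (b, b') p) h q" using inv_mono[OF inv b'] by blast
    have "inv (insert (b, b') p) h (insert (m, J' b') q)"
    proof (rule invI)
      show "represented (insert (b, b') p) h n n'" if "(n, n') \<in> insert (m, J' b') q" for n n'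
      proof (cases "(n, n') \<in> q")
        case True
        then show ?thesis by (rule inv_represented[OF inv2])
      next
        case False
        then show ?thesis using that base pl unfolding represented_def by blast
      qed
    qed (fact invD[OF inv2] inv_matched[OF inv2])+
    then show ?thesis by blast
  next
    case copy
    show ?thesis
    proof (cases "\<exists>c c'. (c, c') \<in> h \<and> copy_conn L H (x, v) c")
      case True
      then obtain u x' u' where h: "((x, u), (x', u')) \<in> h" and vu: "(v, u) \<in> (gaifman L H)\<^sup>*"
        unfolding copy_conn_def by fastforce
      have cuv: "copy_conn L H (x, u) c \<longleftrightarrow> copy_conn L H (x, v) c" for c
        using vu gaifman_rtrancl_sym rtrancl_trans unfolding copy_conn_def by (metis fst_conv snd_conv)
      have "slice h (x, u) = slice h (x, v)" unfolding slice_def using cuv by simp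
      then have bs: "bf (gadget_lang L k) H H' (slice h (x, v))" using D(10)[OF h] by simp
      obtain v' where v': "bf (gadget_lang L k) H H' (insert (v, v') (slice h (x, v)))"
        using bf_forth[OF bs, of v] copy(1) by blast
      have uu: "(u, u') \<in> insert (v, v') (slice h (x, v))"
        using slice_self[OF h] \<open>slice h (x, u) = slice h (x, v)\<close> by blast
      have vu': "(v', u') \<in> (gaifman L H')\<^sup>*" using conn_bf[OF v' _ uu, of v v'] vu by blast
      have cuv': "copy_conn L H' (x', u') c \<longleftrightarrow> copy_conn L H' (x', v') c" for c
        using vu' gaifman_rtrancl_sym rtrancl_trans unfolding copy_conn_def by (metis fst_conv snd_conv)
      have rt: "rooted L k H v \<longleftrightarrow> rooted L k H u"
        unfolding rooted_def using vu gaifman_rtrancl_sym rtrancl_trans by metis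
      have rt': "rooted L k H v \<longleftrightarrow> rooted L k H' v'" using rooted_bf[OF v', of v v'] by blast
      have "inv p (insert ((x, v), (x', v')) h) (insert (K x v, K' x' v') q)"
      proof (rule inv_insert[OF inv copy(1,2) _ _ _ _ v'])
        show "v' \<in> universe H' - roots k H'"
          using bf_universe[OF v', of v v'] roots_bf[OF v', of v v'] copy(1) by blast
        show "x' \<in> auxs B' (part' v')" using D(6)[OF h] g'.part_connected[OF vu'] by simp
        show "(x, x') \<in> p" if "rooted L k H v \<or> rooted L k H' v'" using that rt rt' D(7)[OF h] by blast
        show "copy_conn L H (x, v) c \<longleftrightarrow> copy_conn L H' (x', v') c'" if "(c, c') \<in> h" for c c'
          using D(9)[OF h that] cuv cuv' by blast
      qed
      then show ?thesis using copy(3) by blast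
    next
      case new: False
      then have sl: "slice h (x, v) = {}" unfolding slice_def by blast
      show ?thesis
      proof (cases "rooted L k H v")
        case True
        then obtain j where j: "j < k" "(cst H j, v) \<in> (gaifman L H)\<^sup>*" unfolding rooted_def by blast
        define X where "X = part v"
        have X: "X \<in> I" "j \<in> X"
          using part_index copy(1) part_root[OF j(1)] part_connected[OF j(2)] unfolding X_def by auto
        obtain e where e: "e \<in> rel B (Frag X)" "x = last e" using copy(2) unfolding X_def auxs_def by auto
        obtain e' where e': "e' \<in> rel B' (Frag X)" "bf LB B B' (p \<union> set (zip e e'))"
          "(last e, last e') \<in> set (zip e e')"
          using edge_bf[OF D(2) X(1) e(1)] by metis
        define x' where "x' = last e'"
        define p2 where "p2 = p \<union> set (zip e e')"
        have x': "x' \<in> auxs B' X" using e'(1) unfolding x'_def auxs_def by auto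
        have xp: "(x, x') \<in> p2" using e'(3) e(2) unfolding x'_def p2_def by auto
        have bp: "bf LB B B' p2" using e'(2) unfolding p2_def .
        have inv2: "inv p2 h q" using inv_mono[OF inv bp] unfolding p2_def by blast
        \<comment> \<open>The gadget game for the new component starts afresh. The root
          \<open>j\<close> still ties the answer to the right sort, as connection to constants is
          preserved.\<close>
        obtain v' where v': "bf (gadget_lang L k) H H' (insert (v, v') {})"
          using bf_forth[OF bf_H] copy(1) by blast
        have j': "(cst H' j, v') \<in> (gaifman L H')\<^sup>*" using conn_root_bf[OF v', of v v' j] j by blast
        have pv: "part' v' = X" using g'.part_root_eq[OF X j'] .
        have "inv p2 (insert ((x, v), (x', v')) h) (insert (K x v, K' x' v') q)"
        proof (rule inv_insert[OF inv2 copy(1,2)])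
          show "v' \<in> universe H' - roots k H'"
            using bf_universe[OF v', of v v'] roots_bf[OF v', of v v'] copy(1) by blast
          show "x' \<in> auxs B' (part' v')" using x' pv by simp
          show "(x, x') \<in> p2" by (rule xp)
          show "bf (gadget_lang L k) H H' (insert (v, v') (slice h (x, v)))" using v' sl by simp
          show "copy_conn L H (x, v) c \<longleftrightarrow> copy_conn L H' (x', v') c'" if c: "(c, c') \<in> h" for c c'
          proof -
            \<comment> \<open>The answering component is untouched as well: a pair of
              \<open>h\<close> inside it would be rooted, hence follow \<open>p2\<close>, hence lie
              over the copy \<open>x\<close> in the component of root \<open>j\<close>, which is the
              component of \<open>v\<close>.\<close>
            have "\<not> copy_conn L H' (x', v') c'"
            proof
              assume cc: "copy_conn L H' (x', v') c'"
              obtain y w y' w' where cw: "c = (y, w)" "c' = (y', w')" by (metis prod.exhaust)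
              have hc: "((y, w), (y', w')) \<in> h" using c cw by simp
              have w: "y' = x'" "(cst H' j, w') \<in> (gaifman L H')\<^sup>*"
                using cc j' cw rtrancl_trans unfolding copy_conn_def by auto
              then have "rooted L k H' w'" unfolding rooted_def using j(1) by blast
              then have "(y, x') \<in> p2" using invD(8)[OF inv2 hc] w(1) by simp
              then have yx: "y = x" using bf_eq[OF bp _ xp] by blast
              have "(cst H j, w) \<in> (gaifman L H)\<^sup>*"
                using conn_root_bf[OF D(10)[OF hc] slice_self[OF hc] j(1)] w(2) by blast
              then have "(v, w) \<in> (gaifman L H)\<^sup>*" using j(2) gaifman_rtrancl_sym rtrancl_trans by metis
              then have "copy_conn L H (x, v) c" using yx cw by (simp add: copy_conn_def)
              then show False using new c by blast
            qed
            then show ?thesis using new c by blast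
          qed
        qed
        then show ?thesis using copy(3) by blast
      next
        case False
        obtain x' v' where v': "v' \<in> universe H'" "x' \<in> auxs B' (part' v')"
          "bf (gadget_lang L k) H H' {(v, v')}" "\<And>c c'. (c, c') \<in> h \<Longrightarrow> \<not> copy_conn L H' (x', v') c'"
          using fresh_component[OF inv copy(2)] copy(1) new by blast
        have "inv p (insert ((x, v), (x', v')) h) (insert (K x v, K' x' v') q)"
        proof (rule inv_insert[OF inv copy(1,2)])
          show "v' \<in> universe H' - roots k H'" using v'(1) roots_bf[OF v'(3), of v v'] copy(1) by blast
          show "x' \<in> auxs B' (part' v')" by (rule v'(2))
          show "(x, x') \<in> p" if "rooted L k H v \<or> rooted L k H' v'"
            using that False rooted_bf[OF v'(3), of v v'] by blast
          show "copy_conn L H (x, v) c \<longleftrightarrow> copy_conn L H' (x', v') c'" if "(c, c') \<in> h" for c c'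
            using v'(4)[OF that] new that by blast
          show "bf (gadget_lang L k) H H' (insert (v, v') (slice h (x, v)))" using v'(3) sl by simp
        qed
        then show ?thesis using copy(3) by blast
      qed
    qed
  qed
qed

lemma inv_universe:
  assumes "inv p h q" "(m, m') \<in> q"
  shows "m \<in> universe M"
  using assms
proof (cases rule: inv_q)
  case 1
  then show ?thesis unfolding M_universe by blast
next
  case 2
  then show ?thesis unfolding M_universe using invD(3,4)[OF assms(1)] by blast
qed

text \<open>The positions are all relations that admit some \<open>p\<close> and \<open>h\<close>;
  every backward condition is the forward one for the swapped pair.\<close>

theorem bf_glued:
  assumes "csts L = {}"
  shows "bf L M M' {}"
proof -
  interpret sw: gluing_pair L k I B' H' M' part' J' K' B H M part J K LB by (rule swap)
  define Q where "Q = {q. \<exists>p h. inv p h q}"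
  have sw_inv: "sw.inv p h q \<Longrightarrow> inv (p\<inverse>) (h\<inverse>) (q\<inverse>)" for p h q using sw.inv_converse .
  have "bf_system L M M' Q"
  proof (rule bf_systemI)
    fix q assume "q \<in> Q"
    then obtain p h where inv: "inv p h q" unfolding Q_def by blast
    note inv' = inv_converse[OF inv]
    show "q \<subseteq> universe M \<times> universe M'"
      using inv_universe[OF inv] sw.inv_universe[OF inv'] by fastforce
    show "q' \<in> Q" if "q' \<subseteq> q" for q'
    proof -
      have "inv p h q'" using inv that unfolding inv_def by blast
      then show ?thesis unfolding Q_def by blast
    qed
    show "a = b \<longleftrightarrow> a' = b'" if "(a, a') \<in> q" "(b, b') \<in> q" for a a' b b'
      using that inv_eq_imp[OF inv, of a a' b'] sw.inv_eq_imp[OF inv', of a' a b] by auto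
    show "t \<in> rel M S \<longleftrightarrow> t' \<in> rel M' S"
      if a: "S \<in> syms L" "length t = length t'" "set (zip t t') \<subseteq> q" for S t t'
    proof -
      have "set (zip t' t) \<subseteq> q\<inverse>" using a(3) unfolding set_zip_converse[of t t', symmetric] by blast
      then show ?thesis
        using inv_rel_imp[OF inv a] sw.inv_rel_imp[OF inv' a(1), of t' t] a(2) by auto
    qed
    show "\<exists>a'. insert (a, a') q \<in> Q" if "a \<in> universe M" for a
      using inv_forth[OF inv that] unfolding Q_def by blast
    show "\<exists>a. insert (a, a') q \<in> Q" if a': "a' \<in> universe M'" for a'
    proof -
      obtain p2 h2 a where "sw.inv p2 h2 (insert (a', a) (q\<inverse>))" using sw.inv_forth[OF inv' a'] by blast
      from sw_inv[OF this] have "inv (p2\<inverse>) (h2\<inverse>) ((insert (a', a) (q\<inverse>))\<inverse>)" .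
      moreover have "(insert (a', a) (q\<inverse>))\<inverse> = insert (a, a') q" by auto
      ultimately have "inv (p2\<inverse>) (h2\<inverse>) (insert (a, a') q)" by simp
      then show ?thesis unfolding Q_def by blast
    qed
  qed (simp add: assms)
  moreover have "inv {} {} {}" by (rule invI) (use bf_B in simp_all)
  then have "{} \<in> Q" unfolding Q_def by blast
  ultimately show ?thesis unfolding bf_def by blast
qed

end

text \<open>
  \<open>D X\<close> is the set of gadget vertices that are copied for an edge of sort \<open>X\<close>. It is a
  part of the gadget for the product along a fragmentation, and the whole gadget for
  the plain gadget construction, where the copies of sorts \<open>X\<close> and \<open>Y\<close> coming from the same edge coincide.
\<close>

locale pre_gluing =
  fixes L :: "'r lang" and k :: nat and I :: "nat set set"
    and B :: "('b, 'r frag_sym) fo_struct" and H :: "('h, 'r) fo_struct" and M :: "('m, 'r) fo_struct"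
    and D :: "nat set \<Rightarrow> 'h set" and J :: "'b \<Rightarrow> 'm" and K :: "'b \<Rightarrow> 'h \<Rightarrow> 'm"
  assumes I_sub: "X \<in> I \<Longrightarrow> X \<subseteq> {..<k}"
    and I_disjoint: "X \<in> I \<Longrightarrow> Y \<in> I \<Longrightarrow> j \<in> X \<Longrightarrow> j \<in> Y \<Longrightarrow> X = Y"
    and edge: "X \<in> I \<Longrightarrow> e \<in> rel B (Frag X) \<Longrightarrow> length e = Suc (card X) \<and> set e \<subseteq> universe B"
    and edge_unique: "X \<in> I \<Longrightarrow> Y \<in> I \<Longrightarrow> e \<in> rel B (Frag X) \<Longrightarrow> f \<in> rel B (Frag Y) \<Longrightarrow>
      last e = last f \<Longrightarrow> X = Y \<and> e = f"
    and edge_plain: "X \<in> I \<Longrightarrow> e \<in> rel B (Frag X) \<Longrightarrow> p < card X \<Longrightarrow> e ! p \<in> plain I B"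
    and H_structure: "fo_structure (gadget_lang L k) H"
    and D_universe: "X \<in> I \<Longrightarrow> D X \<subseteq> universe H"
    and J_inj: "inj_on J (plain I B)"
    and M_universe: "universe M = J ` plain I B \<union> (\<Union>X\<in>I. {K x v |x v. x \<in> auxs B X \<and> v \<in> D X})"
    and D_root: "X \<in> I \<Longrightarrow> j \<in> X \<Longrightarrow> cst H j \<in> D X"
    and K_root: "X \<in> I \<Longrightarrow> e \<in> rel B (Frag X) \<Longrightarrow> p < card X \<Longrightarrow>
      K (last e) (cst H (sorted_list_of_set X ! p)) = J (e ! p)"
    and K_not_J: "X \<in> I \<Longrightarrow> x \<in> auxs B X \<Longrightarrow> v \<in> D X - roots k H \<Longrightarrow> K x v \<notin> J ` plain I B"
    and K_inj: "X \<in> I \<Longrightarrow> x \<in> auxs B X \<Longrightarrow> v \<in> D X - roots k H \<Longrightarrow>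
      Y \<in> I \<Longrightarrow> y \<in> auxs B Y \<Longrightarrow> w \<in> D Y - roots k H \<Longrightarrow> K x v = K y w \<Longrightarrow> v = w \<and> (X = Y \<longrightarrow> x = y)"
    and M_rel: "S \<in> syms L \<Longrightarrow> t \<in> rel M S \<longleftrightarrow>
      (\<exists>s\<in>rel B (Orig S). set s \<subseteq> plain I B \<and> t = map J s) \<or>
      (\<exists>X\<in>I. \<exists>x\<in>auxs B X. \<exists>s\<in>rel H S. set s \<subseteq> D X \<and> t = map (K x) s)"
    and K_shift: "X \<in> I \<Longrightarrow> Y \<in> I \<Longrightarrow> x \<in> auxs B X \<Longrightarrow> v \<in> D X \<inter> D Y \<Longrightarrow>
      \<exists>y\<in>auxs B Y. \<forall>w\<in>D X \<inter> D Y. K y w = K x w"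
begin

text \<open>When the sets \<open>D X\<close> overlap, a point of \<open>M\<close> has several
  descriptions. A choice of \<open>part\<close> singles out one sort per gadget vertex, and
  \<open>K_shift\<close> rewrites any description into the chosen sort.\<close>

lemma gluing:
  assumes auxs_card: "\<And>X Y F. X \<in> I \<Longrightarrow> Y \<in> I \<Longrightarrow> finite F \<Longrightarrow> F \<subseteq> auxs B X \<Longrightarrow>
      \<exists>F'\<subseteq>auxs B Y. finite F' \<and> card F' = card F"
    and part: "\<And>v. v \<in> universe H \<Longrightarrow> part v \<in> I \<and> v \<in> D (part v)"
    and adj: "\<And>u v. (u, v) \<in> gaifman L H \<Longrightarrow> part u = part v"
    and root: "\<And>j. j < k \<Longrightarrow> j \<in> part (cst H j)"
  shows "gluing L k I B H M part J K"
proof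
  show "universe M = J ` plain I B \<union> {K x v |x v. v \<in> universe H - roots k H \<and> x \<in> auxs B (part v)}"
  proof (intro equalityI subsetI)
    fix m assume "m \<in> universe M"
    then consider "m \<in> J ` plain I B" | X x v where "X \<in> I" "x \<in> auxs B X" "v \<in> D X" "m = K x v"
      unfolding M_universe by blast
    then show "m \<in> J ` plain I B \<union> {K x v |x v. v \<in> universe H - roots k H \<and> x \<in> auxs B (part v)}"
    proof cases
      case 2
      have v: "v \<in> universe H" using D_universe 2 by blast
      obtain y where y: "y \<in> auxs B (part v)" "K y v = K x v"
        using K_shift[OF 2(1) _ 2(2), of "part v" v] part[OF v] 2(3) by blast
      show ?thesis
      proof (cases "v \<in> roots k H")
        case False
        then have "v \<in> universe H - roots k H" "m = K y v" using v y 2(4) by auto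
        then show ?thesis using y(1) by blast
      next
        case True
        then obtain j where j: "j < k" "v = cst H j" unfolding roots_def by auto
        obtain e where e: "e \<in> rel B (Frag (part v))" "y = last e" using y(1) unfolding auxs_def by auto
        have pI: "part v \<in> I" using part[OF v] by blast
        have "finite (part v)" using I_sub[OF pI] finite_subset by blast
        then have "j \<in> set (sorted_list_of_set (part v))" using root[OF j(1)] j(2) by simp
        then obtain p where p: "p < card (part v)" "sorted_list_of_set (part v) ! p = j"
          by (metis in_set_conv_nth length_sorted_list_of_set)
        have "m = J (e ! p)" using K_root[OF pI e(1) p(1)] p(2) j(2) y(2) e(2) 2(4) by simp
        then show ?thesis using edge_plain[OF pI e(1) p(1)] by blast
      qed
    qed simp
  next
    fix m assume "m \<in> J ` plain I B \<union> {K x v |x v. v \<in> universe H - roots k H \<and> x \<in> auxs B (part v)}"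
    then show "m \<in> universe M" unfolding M_universe using part by blast
  qed
  show "K x v \<notin> J ` plain I B" if "v \<in> universe H - roots k H" "x \<in> auxs B (part v)" for x v
    using K_not_J[of "part v" x v] part that by blast
  show "x = y \<and> v = w" if "v \<in> universe H - roots k H" "x \<in> auxs B (part v)"
    "w \<in> universe H - roots k H" "y \<in> auxs B (part w)" "K x v = K y w" for x y v w
    using K_inj[of "part v" x v "part w" y w] part that by blast
  show "t \<in> rel M S \<longleftrightarrow>
      (\<exists>s\<in>rel B (Orig S). set s \<subseteq> plain I B \<and> t = map J s) \<or>
      (\<exists>X\<in>I. \<exists>x\<in>auxs B X. \<exists>s\<in>rel H S. (\<forall>v\<in>set s. part v = X) \<and> t = map (K x) s)"
    if S: "S \<in> syms L" for S t
  proof -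
    have univ: "set s \<subseteq> universe H" if "s \<in> rel H S" for s
      using H_structure S that unfolding fo_structure_def by simp
    have conn: "part u = part v" if "(u, v) \<in> (gaifman L H)\<^sup>*" for u v
      using that by (induction rule: rtrancl_induct) (auto dest: adj)
    have fwd: "\<exists>X\<in>I. \<exists>x\<in>auxs B X. \<exists>s\<in>rel H S. (\<forall>v\<in>set s. part v = X) \<and> t = map (K x) s"
      if X: "X \<in> I" "x \<in> auxs B X" and s: "s \<in> rel H S" "set s \<subseteq> D X" and t: "t = map (K x) s" for X x s
    proof (cases s)
      \<comment> \<open>The empty tuple has no vertex that could determine a sort, so it keeps the
        sort \<open>X\<close>.\<close>
      case Nil
      then show ?thesis using X s t by auto
    next
      case (Cons v0 s2)
      have v0: "v0 \<in> set s" using Cons by simp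
      \<comment> \<open>The entries of a tuple are connected, so all of them have the same part and
        the whole tuple moves to one sort.\<close>
      define Y where "Y = part v0"
      have Y: "part v = Y" if "v \<in> set s" for v
        unfolding Y_def using conn same_tuple_connected[OF S s(1) that v0] by blast
      have YI: "Y \<in> I" and DY: "\<And>v. v \<in> set s \<Longrightarrow> v \<in> D X \<inter> D Y"
        using part univ[OF s(1)] v0 Y s(2) by blast+
      obtain y where y: "y \<in> auxs B Y" "\<forall>w\<in>D X \<inter> D Y. K y w = K x w"
        using K_shift[OF X(1) YI X(2) DY[OF v0]] by blast
      have "t = map (K y) s" unfolding t
      by (rule map_cong[OF refl]) (rule y(2)[rule_format, OF DY, symmetric])
      then show ?thesis
        by (intro bexI[of _ Y] bexI[of _ y] bexI[of _ s] conjI ballI Y YI y(1) s(1))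
    qed
    have bwd: "set s \<subseteq> D X" if "s \<in> rel H S" "\<forall>v\<in>set s. part v = X" for s X
    proof
      fix v assume "v \<in> set s"
      then show "v \<in> D X" using part[of v] univ[OF that(1)] that(2) by auto
    qed
    show ?thesis unfolding M_rel[OF S] by (intro iffI; elim disjE bexE conjE) (use fwd bwd in blast)+
  qed
  show "part v \<in> I" if "v \<in> universe H" for v using part[OF that] by blast
qed (fact I_sub I_disjoint edge edge_unique edge_plain auxs_card H_structure J_inj K_root adj root)+

end

section \<open>Internal sets and functions of an ultraproduct\<close>

text \<open>In the usual terminology, \<open>lift_set\<close> gives the internal subsets of the
  ultraproduct, and \<open>lift1\<close>, \<open>lift2\<close> the internal functions of one and two
  arguments.\<close>

definition lift_set :: "nat filter \<Rightarrow> (nat \<Rightarrow> 'a set) \<Rightarrow> (nat \<Rightarrow> 'a) set" where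
  "lift_set U A = {c. canon U c = c \<and> eventually (\<lambda>n. c n \<in> A n) U}"

definition lift1 :: "nat filter \<Rightarrow> (nat \<Rightarrow> 'a \<Rightarrow> 'b) \<Rightarrow> (nat \<Rightarrow> 'a) \<Rightarrow> nat \<Rightarrow> 'b" where
  "lift1 U f c = canon U (\<lambda>n. f n (c n))"

definition lift2 :: "nat filter \<Rightarrow> (nat \<Rightarrow> 'a \<Rightarrow> 'b \<Rightarrow> 'c) \<Rightarrow> (nat \<Rightarrow> 'a) \<Rightarrow> (nat \<Rightarrow> 'b) \<Rightarrow> nat \<Rightarrow> 'c" where
  "lift2 U f c = lift1 U (\<lambda>n. f n (c n))"

lemma lift_setI: "canon U c = c \<Longrightarrow> eventually (\<lambda>n. c n \<in> A n) U \<Longrightarrow> c \<in> lift_set U A"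
  by (simp add: lift_set_def)

lemma lift_set_canon: "c \<in> lift_set U A \<Longrightarrow> canon U c = c"
  by (simp add: lift_set_def)

lemma lift_set_ev: "c \<in> lift_set U A \<Longrightarrow> eventually (\<lambda>n. c n \<in> A n) U"
  by (simp add: lift_set_def)

lemma canon_lift_set: "eventually (\<lambda>n. f n \<in> A n) U \<Longrightarrow> canon U f \<in> lift_set U A"
  using ev_canon[of U f] by (auto simp: lift_set_def elim: eventually_elim2)

lemma canon_lift1 [simp]: "canon U (lift1 U f c) = lift1 U f c"
  by (simp add: lift1_def)

lemma ev_lift1: "eventually (\<lambda>n. lift1 U f c n = f n (c n)) U"
  unfolding lift1_def by (rule ev_canon)

lemma ev_lift2: "eventually (\<lambda>n. lift2 U f c d n = f n (c n) (d n)) U"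
  unfolding lift2_def by (rule ev_lift1)

lemma ev_map_lift1: "eventually (\<lambda>n. map (\<lambda>c. c n) (map (lift1 U f) s) = map (f n) (map (\<lambda>c. c n) s)) U"
proof -
  have "eventually (\<lambda>n. \<forall>c\<in>set s. lift1 U f c n = f n (c n)) U"
    by (intro eventually_ball_finite) (auto intro: ev_lift1)
  then show ?thesis by (rule eventually_mono) simp
qed

lemma ult_universe_lift_set: "universe (ult U M) = lift_set U (\<lambda>n. universe (M n))"
  by (auto simp: ult_universe lift_set_def)

context free_ultrafilter
begin

lemma lift_image:
  assumes "c \<in> lift_set U (\<lambda>n. f n ` A n)"
  shows "\<exists>a\<in>lift_set U A. c = lift1 U f a"
proof -
  have "eventually (\<lambda>n. \<exists>a. a \<in> A n \<and> c n = f n a) U"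
    using lift_set_ev[OF assms] by (rule eventually_mono) auto
  then obtain g where g: "eventually (\<lambda>n. g n \<in> A n \<and> c n = f n (g n)) U" unfolding eventually_ex by blast
  have "canon U g \<in> lift_set U A" using g by (intro canon_lift_set) (auto elim: eventually_mono)
  moreover have "eventually (\<lambda>n. c n = lift1 U f (canon U g) n) U"
    using g ev_lift1[of U f "canon U g"] ev_canon[of U g] by eventually_elim simp
  then have "c = lift1 U f (canon U g)" using canon_eqI[OF lift_set_canon[OF assms]] by simp
  ultimately show ?thesis by blast
qed

lemma canon_list_eqI:
  assumes "\<And>c. c \<in> set s \<Longrightarrow> canon U c = c" "\<And>c. c \<in> set t \<Longrightarrow> canon U c = c"
    "eventually (\<lambda>n. map (\<lambda>c. c n) s = map (\<lambda>c. c n) t) U"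
  shows "s = t"
proof (rule nth_equalityI)
  show len: "length s = length t" using ev_happens[OF assms(3)] map_eq_imp_length_eq by blast
  fix i assume i: "i < length s"
  have "eventually (\<lambda>n. (s ! i) n = (t ! i) n) U"
    using assms(3)
  proof eventually_elim
    case (elim n)
    then have "map (\<lambda>c. c n) s ! i = map (\<lambda>c. c n) t ! i" by simp
    then show ?case using i len by simp
  qed
  then show "s ! i = t ! i" using canon_eqI assms(1,2) i len nth_mem by metis
qed

lemma roots_ult: "roots k (ult U H) = lift_set U (\<lambda>n. roots k (H n))"
proof (intro equalityI subsetI)
  fix v assume "v \<in> roots k (ult U H)"
  then obtain j where j: "j < k" "v = canon U (\<lambda>n. cst (H n) j)" unfolding roots_def ult_cst by auto
  then show "v \<in> lift_set U (\<lambda>n. roots k (H n))"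
    by (auto simp: roots_def intro!: canon_lift_set)
next
  fix v assume v: "v \<in> lift_set U (\<lambda>n. roots k (H n))"
  then have "eventually (\<lambda>n. \<exists>j\<in>{..<k}. v n = cst (H n) j) U"
    unfolding roots_def by (auto dest!: lift_set_ev elim!: eventually_mono)
  then obtain j where "j < k" "eventually (\<lambda>n. v n = cst (H n) j) U"
    using ev_bex_finite[of "{..<k}" "\<lambda>j n. v n = cst (H n) j"] by auto
  then have "v = cst (ult U H) j" unfolding ult_cst using eq_canon_iff[OF lift_set_canon[OF v]] by simp
  then show "v \<in> roots k (ult U H)" using \<open>j < k\<close> unfolding roots_def by simp
qed

lemma lift_set_Diff: "lift_set U (\<lambda>n. A n - C n) = lift_set U A - lift_set U C"
  unfolding lift_set_def by (auto simp: eventually_conj_iff ev_not)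

lemma lift_set_Int: "lift_set U (\<lambda>n. A n \<inter> C n) = lift_set U A \<inter> lift_set U C"
  unfolding lift_set_def by (auto simp: eventually_conj_iff)

lemma lift_set_UN:
  assumes "finite I"
  shows "lift_set U (\<lambda>n. \<Union>X\<in>I. A n X) = (\<Union>X\<in>I. lift_set U (\<lambda>n. A n X))"
  unfolding lift_set_def using ev_bex_finite[OF assms, of "\<lambda>X n. _ n \<in> A n X"] by auto

lemma lift_set_Un: "lift_set U (\<lambda>n. A n \<union> C n) = lift_set U A \<union> lift_set U C"
  unfolding lift_set_def by (auto simp: ev_disj)

lemma last_edge_ult:
  assumes "e \<in> rel (ult U B) T" "e \<noteq> []"
  shows "canon U (last e) = last e" "eventually (\<lambda>n. map (\<lambda>c. c n) e \<in> rel (B n) T \<and> last e n = last (map (\<lambda>c. c n) e)) U"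
  using assms by (auto simp: ult_rel last_map)

text \<open>The length condition keeps edges nonempty, so that taking the last vertex commutes with
  evaluation at an index, and makes sequences of edges combine to an edge.\<close>

lemma auxs_ult:
  assumes "\<And>n e. e \<in> rel (B n) (Frag X) \<Longrightarrow> length e = Suc (card X)"
  shows "auxs (ult U B) X = lift_set U (\<lambda>n. auxs (B n) X)"
proof (intro equalityI subsetI)
  fix x assume "x \<in> auxs (ult U B) X"
  then obtain e where e: "e \<in> rel (ult U B) (Frag X)" "x = last e" unfolding auxs_def by auto
  have "e \<noteq> []"
  proof
    assume "e = []"
    then have "eventually (\<lambda>n. [] \<in> rel (B n) (Frag X)) U" using e(1) by (simp add: ult_rel)
    then show False using ev_happens assms by fastforce
  qed
  from last_edge_ult[OF e(1) this] show "x \<in> lift_set U (\<lambda>n. auxs (B n) X)"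
    unfolding e(2) by (intro lift_setI) (auto simp: auxs_def elim!: eventually_mono)
next
  fix x assume x: "x \<in> lift_set U (\<lambda>n. auxs (B n) X)"
  have "eventually (\<lambda>n. \<exists>e. e \<in> rel (B n) (Frag X) \<and> last e = x n) U"
    using lift_set_ev[OF x] unfolding auxs_def by (rule eventually_mono) auto
  then obtain e where e: "eventually (\<lambda>n. e n \<in> rel (B n) (Frag X) \<and> last (e n) = x n) U"
    unfolding eventually_ex by blast
  have e1: "eventually (\<lambda>n. e n \<in> rel (B n) (Frag X)) U" using e by (rule eventually_mono) simp
  have e2: "eventually (\<lambda>n. length (e n) = Suc (card X)) U" using e1 by (rule eventually_mono) (use assms in blast)
  obtain E where E: "E \<in> rel (ult U B) (Frag X)" "length E = Suc (card X)" "eventually (\<lambda>n. map (\<lambda>c. c n) E = e n) U"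
    using ult_rel_choice[OF e1 e2] .
  have "E \<noteq> []" using E(2) by auto
  note l = last_edge_ult[OF E(1) this]
  have "eventually (\<lambda>n. x n = last E n) U" using l(2) E(3) e by eventually_elim simp
  then have "x = last E" using canon_eqI[OF lift_set_canon[OF x] l(1)] by blast
  then show "x \<in> auxs (ult U B) X" using E(1) unfolding auxs_def by auto
qed

lemma plain_ult:
  assumes "finite I" "\<And>n X e. X \<in> I \<Longrightarrow> e \<in> rel (B n) (Frag X) \<Longrightarrow> length e = Suc (card X)"
  shows "plain I (ult U B) = lift_set U (\<lambda>n. plain I (B n))"
proof -
  have "(\<Union>X\<in>I. auxs (ult U B) X) = (\<Union>X\<in>I. lift_set U (\<lambda>n. auxs (B n) X))"
    by (intro SUP_cong refl auxs_ult assms(2))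
  then show ?thesis unfolding plain_def
    by (simp add: lift_set_Diff lift_set_UN[OF assms(1)] ult_universe_lift_set)
qed

text \<open>Each factor has an injection from the auxiliary vertices of one sort into those of
  another; the internal function they form is again injective.\<close>

lemma auxs_card_ult:
  assumes len: "\<And>n X e. X \<in> I \<Longrightarrow> e \<in> rel (B n) (Frag X) \<Longrightarrow> length e = Suc (card X)"
    and sib: "\<And>n X Y. X \<in> I \<Longrightarrow> Y \<in> I \<Longrightarrow> \<exists>s. inj_on s (auxs (B n) X) \<and> s ` auxs (B n) X \<subseteq> auxs (B n) Y"
    and XY: "X \<in> I" "Y \<in> I" and F: "finite F" "F \<subseteq> auxs (ult U B) X"
  shows "\<exists>F'\<subseteq>auxs (ult U B) Y. finite F' \<and> card F' = card F"
proof -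
  have "\<forall>n. \<exists>s. inj_on s (auxs (B n) X) \<and> s ` auxs (B n) X \<subseteq> auxs (B n) Y" using sib[OF XY] by blast
  then obtain s where s: "\<And>n. inj_on (s n) (auxs (B n) X) \<and> s n ` auxs (B n) X \<subseteq> auxs (B n) Y" by metis
  have aX: "auxs (ult U B) X = lift_set U (\<lambda>n. auxs (B n) X)" by (rule auxs_ult) (rule len[OF XY(1)])
  have aY: "auxs (ult U B) Y = lift_set U (\<lambda>n. auxs (B n) Y)" by (rule auxs_ult) (rule len[OF XY(2)])
  have ev: "eventually (\<lambda>n. c n \<in> auxs (B n) X) U" "canon U c = c" if "c \<in> F" for c
    using that F(2) lift_set_ev lift_set_canon unfolding aX by blast+
  have "lift1 U s c \<in> auxs (ult U B) Y" if "c \<in> F" for c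
    unfolding aY lift1_def by (rule canon_lift_set, rule eventually_mono[OF ev(1)[OF that]]) (use s in blast)
  moreover have "inj_on (lift1 U s) F"
  proof (rule inj_onI)
    fix c d assume c: "c \<in> F" and d: "d \<in> F" and eq: "lift1 U s c = lift1 U s d"
    have "eventually (\<lambda>n. c n = d n) U"
      using ev(1)[OF c] ev(1)[OF d] ev_lift1[of U s c] ev_lift1[of U s d]
    proof eventually_elim
      case (elim n)
      then show ?case using s[of n] eq inj_onD[of "s n" "auxs (B n) X" "c n" "d n"] by simp
    qed
    then show "c = d" using canon_eqI ev(2)[OF c] ev(2)[OF d] by blast
  qed
  ultimately show ?thesis using F(1) by (intro exI[of _ "lift1 U s ` F"]) (auto simp: card_image)
qed

lemma lift_set_image: "lift_set U (\<lambda>n. f n ` A n) = lift1 U f ` lift_set U A"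
proof (intro equalityI subsetI)
  fix c assume "c \<in> lift1 U f ` lift_set U A"
  then obtain a where a: "a \<in> lift_set U A" "c = lift1 U f a" by blast
  have "eventually (\<lambda>n. f n (a n) \<in> f n ` A n) U"
    using lift_set_ev[OF a(1)] by (rule eventually_mono) blast
  then show "c \<in> lift_set U (\<lambda>n. f n ` A n)" unfolding a(2) lift1_def by (rule canon_lift_set)
qed (use lift_image in blast)

lemma lift_set_image2:
  "lift_set U (\<lambda>n. {f n x v |x v. x \<in> A n \<and> v \<in> C n}) = {lift2 U f x v |x v. x \<in> lift_set U A \<and> v \<in> lift_set U C}"
proof (intro equalityI subsetI)
  fix c assume c: "c \<in> lift_set U (\<lambda>n. {f n x v |x v. x \<in> A n \<and> v \<in> C n})"
  have "eventually (\<lambda>n. \<exists>x v. x \<in> A n \<and> v \<in> C n \<and> c n = f n x v) U"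
    using lift_set_ev[OF c] by (rule eventually_mono) auto
  then obtain x v where xv: "eventually (\<lambda>n. x n \<in> A n \<and> v n \<in> C n \<and> c n = f n (x n) (v n)) U"
    unfolding eventually_ex by blast
  have "canon U x \<in> lift_set U A" "canon U v \<in> lift_set U C"
    using xv by (auto intro!: canon_lift_set elim: eventually_mono)
  moreover have "eventually (\<lambda>n. c n = lift2 U f (canon U x) (canon U v) n) U"
    using xv ev_lift2[of U f "canon U x" "canon U v"] ev_canon[of U x] ev_canon[of U v] by eventually_elim simp
  then have "c = lift2 U f (canon U x) (canon U v)"
    using canon_eqI[OF lift_set_canon[OF c]] by (simp add: lift2_def)
  ultimately show "c \<in> {lift2 U f x v |x v. x \<in> lift_set U A \<and> v \<in> lift_set U C}" by blast
next
  fix c assume "c \<in> {lift2 U f x v |x v. x \<in> lift_set U A \<and> v \<in> lift_set U C}"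
  then obtain x v where xv: "x \<in> lift_set U A" "v \<in> lift_set U C" "c = lift2 U f x v" by blast
  have "eventually (\<lambda>n. f n (x n) (v n) \<in> {f n x v |x v. x \<in> A n \<and> v \<in> C n}) U"
    using lift_set_ev[OF xv(1)] lift_set_ev[OF xv(2)] by eventually_elim blast
  then show "c \<in> lift_set U (\<lambda>n. {f n x v |x v. x \<in> A n \<and> v \<in> C n})"
    unfolding xv(3) lift2_def lift1_def by (rule canon_lift_set)
qed

lemma ult_rel_lift1:
  assumes "eventually (\<lambda>n. s n \<in> rel (N n) T \<and> set (s n) \<subseteq> A n \<and> map (\<lambda>c. c n) t = map (f n) (s n)) U"
    and can: "\<And>c. c \<in> set t \<Longrightarrow> canon U c = c"
  shows "\<exists>S\<in>rel (ult U N) T. set S \<subseteq> lift_set U A \<and> t = map (lift1 U f) S"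
proof -
  have e1: "eventually (\<lambda>n. s n \<in> rel (N n) T) U" using assms(1) by (rule eventually_mono) simp
  have e2: "eventually (\<lambda>n. length (s n) = length t) U"
    using assms(1) by (rule eventually_mono) (metis length_map)
  obtain S where S: "S \<in> rel (ult U N) T" "eventually (\<lambda>n. map (\<lambda>c. c n) S = s n) U"
    using ult_rel_choice[OF e1 e2] by blast
  have "set S \<subseteq> lift_set U A"
  proof
    fix c assume c: "c \<in> set S"
    have "eventually (\<lambda>n. c n \<in> A n) U" using S(2) assms(1)
    proof eventually_elim
      case (elim n)
      have "c n \<in> set (map (\<lambda>c. c n) S)" using c by simp
      then show ?case using elim by auto
    qed
    then show "c \<in> lift_set U A" using S(1) c by (intro lift_setI) (auto simp: ult_rel)
  qed
  moreover have "t = map (lift1 U f) S"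
  proof (rule canon_list_eqI)
    show "eventually (\<lambda>n. map (\<lambda>c. c n) t = map (\<lambda>c. c n) (map (lift1 U f) S)) U"
      using assms(1) S(2) ev_map_lift1[of U f S] by eventually_elim simp
  qed (use can in auto)
  ultimately show ?thesis using S(1) by blast
qed

lemma lift1_ult_rel:
  assumes "s \<in> rel (ult U N) T" "set s \<subseteq> lift_set U A"
  shows "eventually (\<lambda>n. map (\<lambda>c. c n) s \<in> rel (N n) T \<and> set (map (\<lambda>c. c n) s) \<subseteq> A n \<and>
    map (\<lambda>c. c n) (map (lift1 U f) s) = map (f n) (map (\<lambda>c. c n) s)) U"
proof -
  have "eventually (\<lambda>n. \<forall>c\<in>set s. c n \<in> A n) U"
    using assms(2) lift_set_ev by (intro eventually_ball_finite) auto
  moreover have "eventually (\<lambda>n. map (\<lambda>c. c n) s \<in> rel (N n) T) U" using assms(1) by (simp add: ult_rel)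
  ultimately show ?thesis using ev_map_lift1[of U f s] by eventually_elim auto
qed

text \<open>Every clause of \<open>pre_gluing\<close> can be checked index by index; finiteness of
  \<open>I\<close> lets one sort be chosen for almost all indices. The clauses on
  \<open>part\<close> are left out because components are not internal: \<open>part\<close> is
  selected only afterwards, from connectivity in the ultraproduct.\<close>

lemma pre_gluing_ult:
  assumes fin: "finite I"
    and pg: "\<And>n. pre_gluing L k I (B n) (H n) (M n) (D n) (J n) (K n)"
  shows "pre_gluing L k I (ult U B) (ult U H) (ult U M) (\<lambda>X. lift_set U (\<lambda>n. D n X)) (lift1 U J) (lift2 U K)"
proof -
  have len: "length e = Suc (card X)" if "X \<in> I" "e \<in> rel (B n) (Frag X)" for n X e
    using pre_gluing.edge[OF pg that] by blast
  have A: "auxs (ult U B) X = lift_set U (\<lambda>n. auxs (B n) X)" if "X \<in> I" for X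
    by (rule auxs_ult) (rule len[OF that])
  have P: "plain I (ult U B) = lift_set U (\<lambda>n. plain I (B n))"
    by (rule plain_ult[OF fin len])
  have edge_ne: "e \<noteq> []" if e: "X \<in> I" "e \<in> rel (ult U B) (Frag X)" for X e
  proof
    assume "e = []"
    then have "eventually (\<lambda>n. [] \<in> rel (B n) (Frag X)) U" using e(2) by (simp add: ult_rel)
    then show False using ev_happens len[OF e(1)] by fastforce
  qed
  have ev_edge: "eventually (\<lambda>n. map (\<lambda>c. c n) e \<in> rel (B n) (Frag X) \<and> last e n = last (map (\<lambda>c. c n) e)) U"
    and edge_can: "\<And>c. c \<in> set e \<Longrightarrow> canon U c = c"
    if "X \<in> I" "e \<in> rel (ult U B) (Frag X)" for X e
    using last_edge_ult(2)[OF that(2) edge_ne[OF that]] that(2) by (auto simp: ult_rel)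
  show ?thesis
  proof
    show "X \<subseteq> {..<k}" if "X \<in> I" for X using pre_gluing.I_sub[OF pg that] .
    show "X = Y" if "X \<in> I" "Y \<in> I" "j \<in> X" "j \<in> Y" for X Y j using pre_gluing.I_disjoint[OF pg that] .
    show edge: "length e = Suc (card X) \<and> set e \<subseteq> universe (ult U B)" if e: "X \<in> I" "e \<in> rel (ult U B) (Frag X)" for X e
    proof
      obtain n where "map (\<lambda>c. c n) e \<in> rel (B n) (Frag X)" using ev_happens[OF ev_edge[OF e]] by blast
      then show "length e = Suc (card X)" using len[OF e(1)] by (metis length_map)
      show "set e \<subseteq> universe (ult U B)"
      proof
        fix c assume c: "c \<in> set e"
        have "eventually (\<lambda>n. c n \<in> universe (B n)) U"
          using ev_edge[OF e]
        proof eventually_elim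
          case (elim n)
          have "set (map (\<lambda>c. c n) e) \<subseteq> universe (B n)" using pre_gluing.edge[OF pg e(1)] elim by blast
          then show ?case using c by auto
        qed
        then show "c \<in> universe (ult U B)" using edge_can[OF e c] by (simp add: ult_universe)
      qed
    qed
    show "X = Y \<and> e = f" if e: "X \<in> I" "Y \<in> I" "e \<in> rel (ult U B) (Frag X)" "f \<in> rel (ult U B) (Frag Y)" "last e = last f"
      for X Y e f
    proof -
      have ev: "eventually (\<lambda>n. X = Y \<and> map (\<lambda>c. c n) e = map (\<lambda>c. c n) f) U"
        using ev_edge[OF e(1,3)] ev_edge[OF e(2,4)]
      proof eventually_elim
        case (elim n)
        then show ?case using pre_gluing.edge_unique[OF pg e(1,2), of "map (\<lambda>c. c n) e" n "map (\<lambda>c. c n) f"] e(5) by simp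
      qed
      have "X = Y" using ev_happens[OF ev] by blast
      moreover have "e = f"
        by (rule canon_list_eqI) (use edge_can[OF e(1,3)] edge_can[OF e(2,4)] ev in \<open>auto elim: eventually_mono\<close>)
      ultimately show ?thesis by blast
    qed
    show edge_plain: "e ! p \<in> plain I (ult U B)" if e: "X \<in> I" "e \<in> rel (ult U B) (Frag X)" and p: "p < card X" for X e p
    proof -
      have pl: "p < length e" using edge[OF e] p by simp
      have "eventually (\<lambda>n. (e ! p) n \<in> plain I (B n)) U"
        using ev_edge[OF e]
      proof eventually_elim
        case (elim n)
        then have "map (\<lambda>c. c n) e ! p \<in> plain I (B n)" using pre_gluing.edge_plain[OF pg e(1) _ p] by blast
        then show ?case using pl by simp
      qed
      then show ?thesis unfolding P using edge_can[OF e] pl by (intro lift_setI) auto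
    qed
    show "fo_structure (gadget_lang L k) (ult U H)"
      by (rule ult_fo_structure) (rule pre_gluing.H_structure[OF pg])
    show "lift_set U (\<lambda>n. D n X) \<subseteq> universe (ult U H)" if "X \<in> I" for X
      using pre_gluing.D_universe[OF pg that] unfolding ult_universe_lift_set lift_set_def
      by (auto elim!: eventually_mono)
    show "inj_on (lift1 U J) (plain I (ult U B))"
    proof (rule inj_onI)
      fix b c assume b: "b \<in> plain I (ult U B)" and c: "c \<in> plain I (ult U B)" and eq: "lift1 U J b = lift1 U J c"
      have "eventually (\<lambda>n. b n = c n) U"
        using lift_set_ev[OF b[unfolded P]] lift_set_ev[OF c[unfolded P]] ev_lift1[of U J b] ev_lift1[of U J c]
      proof eventually_elim
        case (elim n)
        then show ?case using inj_onD[OF pre_gluing.J_inj[OF pg], of n "b n" "c n"] eq by simp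
      qed
      then show "b = c" using canon_eqI lift_set_canon[OF b[unfolded P]] lift_set_canon[OF c[unfolded P]] by blast
    qed
    show "universe (ult U M) = lift1 U J ` plain I (ult U B) \<union>
      (\<Union>X\<in>I. {lift2 U K x v |x v. x \<in> auxs (ult U B) X \<and> v \<in> lift_set U (\<lambda>n. D n X)})"
    proof -
      have "(\<Union>X\<in>I. {lift2 U K x v |x v. x \<in> auxs (ult U B) X \<and> v \<in> lift_set U (\<lambda>n. D n X)}) =
        (\<Union>X\<in>I. lift_set U (\<lambda>n. {K n x v |x v. x \<in> auxs (B n) X \<and> v \<in> D n X}))"
        unfolding lift_set_image2 by (intro SUP_cong refl) (simp add: A)
      then show ?thesis
        unfolding ult_universe_lift_set pre_gluing.M_universe[OF pg] lift_set_Un lift_set_UN[OF fin]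
          lift_set_image P by simp
    qed
    show "cst (ult U H) j \<in> lift_set U (\<lambda>n. D n X)" if "X \<in> I" "j \<in> X" for X j
      unfolding ult_cst using pre_gluing.D_root[OF pg that] by (intro canon_lift_set) simp
    show "lift2 U K (last e) (cst (ult U H) (sorted_list_of_set X ! p)) = lift1 U J (e ! p)"
      if e: "X \<in> I" "e \<in> rel (ult U B) (Frag X)" and p: "p < card X" for X e p
    proof (rule canon_eqI[of U])
      define j where "j = sorted_list_of_set X ! p"
      have pl: "p < length e" using edge[OF e] p by simp
      show "eventually (\<lambda>n. lift2 U K (last e) (cst (ult U H) (sorted_list_of_set X ! p)) n = lift1 U J (e ! p) n) U"
        using ev_edge[OF e] ev_lift2[of U K "last e" "cst (ult U H) j"] ev_lift1[of U J "e ! p"]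
          ev_canon[of U "\<lambda>n. cst (H n) j"]
        unfolding j_def[symmetric]
      proof eventually_elim
        case (elim n)
        have "K n (last e n) (cst (H n) j) = J n (map (\<lambda>c. c n) e ! p)"
          using pre_gluing.K_root[OF pg e(1) _ p, of "map (\<lambda>c. c n) e" n] elim(1) unfolding j_def by simp
        then show ?case using elim pl by (simp add: ult_cst)
      qed
    qed (simp_all add: lift2_def)
    have ev_v: "eventually (\<lambda>n. v n \<in> D n X - roots k (H n)) U" "canon U v = v"
      if "v \<in> lift_set U (\<lambda>n. D n X) - roots k (ult U H)" for v X
      using that unfolding roots_ult lift_set_Diff[symmetric] by (rule lift_set_ev, rule lift_set_canon)
    have ev_x: "eventually (\<lambda>n. x n \<in> auxs (B n) X) U" "canon U x = x" if "X \<in> I" "x \<in> auxs (ult U B) X" for x X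
      using that(2) unfolding A[OF that(1)] by (rule lift_set_ev, rule lift_set_canon)
    show "lift2 U K x v \<notin> lift1 U J ` plain I (ult U B)"
      if X: "X \<in> I" "x \<in> auxs (ult U B) X" and v: "v \<in> lift_set U (\<lambda>n. D n X) - roots k (ult U H)" for X x v
    proof
      assume "lift2 U K x v \<in> lift1 U J ` plain I (ult U B)"
      then obtain b where b: "b \<in> lift_set U (\<lambda>n. plain I (B n))" "lift2 U K x v = lift1 U J b" unfolding P by blast
      have "eventually (\<lambda>n. False) U"
        using lift_set_ev[OF b(1)] ev_x(1)[OF X] ev_v(1)[OF v] ev_lift1[of U J b] ev_lift2[of U K x v]
      proof eventually_elim
        case (elim n)
        then have "K n (x n) (v n) = J n (b n)" using b(2) by simp
        then show ?case using pre_gluing.K_not_J[OF pg X(1), of "x n" n "v n"] elim by blast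
      qed
      then show False using ev_const by blast
    qed
    show "v = w \<and> (X = Y \<longrightarrow> x = y)"
      if X: "X \<in> I" "x \<in> auxs (ult U B) X" and v: "v \<in> lift_set U (\<lambda>n. D n X) - roots k (ult U H)"
        and Y: "Y \<in> I" "y \<in> auxs (ult U B) Y" and w: "w \<in> lift_set U (\<lambda>n. D n Y) - roots k (ult U H)"
        and eq: "lift2 U K x v = lift2 U K y w" for X x v Y y w
    proof -
      have ev: "eventually (\<lambda>n. v n = w n \<and> (X = Y \<longrightarrow> x n = y n)) U"
        using ev_x(1)[OF X] ev_v(1)[OF v] ev_x(1)[OF Y] ev_v(1)[OF w] ev_lift2[of U K x v] ev_lift2[of U K y w]
      proof eventually_elim
        case (elim n)
        then have "K n (x n) (v n) = K n (y n) (w n)" using eq by simp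
        then show ?case using pre_gluing.K_inj[OF pg X(1) elim(1,2) Y(1) elim(3,4)] by blast
      qed
      then have "eventually (\<lambda>n. v n = w n) U" "X = Y \<Longrightarrow> eventually (\<lambda>n. x n = y n) U"
        by (auto elim: eventually_mono)
      then show ?thesis using canon_eqI[OF ev_v(2)[OF v] ev_v(2)[OF w]] canon_eqI[OF ev_x(2)[OF X] ev_x(2)[OF Y]] by blast
    qed
    show "\<exists>y\<in>auxs (ult U B) Y. \<forall>w\<in>lift_set U (\<lambda>n. D n X) \<inter> lift_set U (\<lambda>n. D n Y). lift2 U K y w = lift2 U K x w"
      if X: "X \<in> I" "Y \<in> I" "x \<in> auxs (ult U B) X" and v: "v \<in> lift_set U (\<lambda>n. D n X) \<inter> lift_set U (\<lambda>n. D n Y)" for X Y x v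
    proof -
      have "eventually (\<lambda>n. \<exists>y. y \<in> auxs (B n) Y \<and> (\<forall>w\<in>D n X \<inter> D n Y. K n y w = K n (x n) w)) U"
        using lift_set_ev[OF v[unfolded lift_set_Int[symmetric]]] ev_x(1)[OF X(1,3)]
      proof eventually_elim
        case (elim n)
        then show ?case using pre_gluing.K_shift[OF pg X(1,2) elim(2,1)] by blast
      qed
      then obtain y where y: "eventually (\<lambda>n. y n \<in> auxs (B n) Y \<and> (\<forall>w\<in>D n X \<inter> D n Y. K n (y n) w = K n (x n) w)) U"
        unfolding eventually_ex by blast
      have "canon U y \<in> auxs (ult U B) Y"
        unfolding A[OF X(2)] using y by (intro canon_lift_set) (auto elim: eventually_mono)
      moreover have "lift2 U K (canon U y) w = lift2 U K x w"
        if w: "w \<in> lift_set U (\<lambda>n. D n X) \<inter> lift_set U (\<lambda>n. D n Y)" for w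
      proof (rule canon_eqI[of U])
        show "eventually (\<lambda>n. lift2 U K (canon U y) w n = lift2 U K x w n) U"
          using y ev_canon[of U y] lift_set_ev[OF w[unfolded lift_set_Int[symmetric]]]
            ev_lift2[of U K "canon U y" w] ev_lift2[of U K x w]
          by eventually_elim simp
      qed (simp_all add: lift2_def)
      ultimately show ?thesis by blast
    qed
    show "t \<in> rel (ult U M) S \<longleftrightarrow>
      (\<exists>s\<in>rel (ult U B) (Orig S). set s \<subseteq> plain I (ult U B) \<and> t = map (lift1 U J) s) \<or>
      (\<exists>X\<in>I. \<exists>x\<in>auxs (ult U B) X. \<exists>s\<in>rel (ult U H) S. set s \<subseteq> lift_set U (\<lambda>n. D n X) \<and> t = map (lift2 U K x) s)"
      (is "_ \<longleftrightarrow> ?base \<or> ?copy") if S: "S \<in> syms L" for S t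
    proof
      assume t: "t \<in> rel (ult U M) S"
      then have can: "\<And>c. c \<in> set t \<Longrightarrow> canon U c = c" by (simp add: ult_rel)
      define tn where "tn n = map (\<lambda>c. c n) t" for n
      have "eventually (\<lambda>n. tn n \<in> rel (M n) S) U" using t by (simp add: ult_rel tn_def)
      then have "eventually (\<lambda>n. (\<exists>s\<in>rel (B n) (Orig S). set s \<subseteq> plain I (B n) \<and> tn n = map (J n) s) \<or>
        (\<exists>X\<in>I. \<exists>x\<in>auxs (B n) X. \<exists>s\<in>rel (H n) S. set s \<subseteq> D n X \<and> tn n = map (K n x) s)) U"
        unfolding pre_gluing.M_rel[OF pg S] .
      then consider
        (base) "eventually (\<lambda>n. \<exists>s. s \<in> rel (B n) (Orig S) \<and> set s \<subseteq> plain I (B n) \<and> tn n = map (J n) s) U"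
        | (copy) "eventually (\<lambda>n. \<exists>X\<in>I. \<exists>x\<in>auxs (B n) X. \<exists>s\<in>rel (H n) S. set s \<subseteq> D n X \<and> tn n = map (K n x) s) U"
        unfolding ev_disj Bex_def by blast
      then show "?base \<or> ?copy"
      proof cases
        case base
        then obtain s where "eventually (\<lambda>n. s n \<in> rel (B n) (Orig S) \<and> set (s n) \<subseteq> plain I (B n) \<and> tn n = map (J n) (s n)) U"
          unfolding eventually_ex by blast
        from ult_rel_lift1[OF this[unfolded tn_def] can] show ?thesis unfolding P by blast
      next
        case copy
        then obtain X where X: "X \<in> I"
          "eventually (\<lambda>n. \<exists>x\<in>auxs (B n) X. \<exists>s\<in>rel (H n) S. set s \<subseteq> D n X \<and> tn n = map (K n x) s) U"
          unfolding ev_bex_finite[OF fin] by blast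
        have "eventually (\<lambda>n. \<exists>x s. x \<in> auxs (B n) X \<and> s \<in> rel (H n) S \<and> set s \<subseteq> D n X \<and> tn n = map (K n x) s) U"
          using X(2) by (rule eventually_mono) blast
        then obtain x s where xs: "eventually (\<lambda>n. x n \<in> auxs (B n) X \<and> s n \<in> rel (H n) S \<and> set (s n) \<subseteq> D n X \<and> tn n = map (K n (x n)) (s n)) U"
          unfolding eventually_ex by blast
        have cx: "canon U x \<in> auxs (ult U B) X"
          unfolding A[OF X(1)] using xs by (intro canon_lift_set) (auto elim: eventually_mono)
        have "eventually (\<lambda>n. s n \<in> rel (H n) S \<and> set (s n) \<subseteq> D n X \<and> map (\<lambda>c. c n) t = map (K n (canon U x n)) (s n)) U"
          using xs ev_canon[of U x] unfolding tn_def by eventually_elim simp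
        from ult_rel_lift1[OF this can] show ?thesis using X(1) cx unfolding lift2_def by blast
      qed
    next
      assume "?base \<or> ?copy"
      then show "t \<in> rel (ult U M) S"
      proof
        assume ?base
        then obtain s where s: "s \<in> rel (ult U B) (Orig S)" "set s \<subseteq> plain I (ult U B)" "t = map (lift1 U J) s" by blast
        have "eventually (\<lambda>n. map (\<lambda>c. c n) t \<in> rel (M n) S) U"
          using lift1_ult_rel[OF s(1) s(2)[unfolded P], of J] unfolding s(3) pre_gluing.M_rel[OF pg S]
          by (rule eventually_mono) blast
        then show ?thesis unfolding ult_rel s(3) by simp
      next
        assume ?copy
        then obtain X x s where X: "X \<in> I" "x \<in> auxs (ult U B) X"
          and s: "s \<in> rel (ult U H) S" "set s \<subseteq> lift_set U (\<lambda>n. D n X)" "t = map (lift2 U K x) s" by blast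
        have "eventually (\<lambda>n. map (\<lambda>c. c n) t \<in> rel (M n) S) U"
          using lift1_ult_rel[OF s(1,2), of "\<lambda>n. K n (x n)"] ev_x(1)[OF X]
          unfolding s(3) lift2_def pre_gluing.M_rel[OF pg S]
          by eventually_elim (use X(1) in blast)
        then show ?thesis unfolding ult_rel s(3) lift2_def by simp
      qed
    qed
  qed
qed

end

section \<open>The two products as glued structures\<close>

text \<open>Equality of classes becomes a computation once there is a normal form that is invariant
  under the generators and equivalent to its argument.\<close>

lemma eq_class_nf:
  assumes "\<And>x y. r x y \<Longrightarrow> nf x = nf y" "\<And>x. equivclp r x (nf x)"
  shows "eq_class r x = eq_class r y \<longleftrightarrow> nf x = nf y"
proof -
  have 1: "equivclp r x y \<longleftrightarrow> nf x = nf y" for x y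
  proof
    assume "equivclp r x y"
    then show "nf x = nf y"
    proof (induction rule: equivclp_induct)
      case (step y z)
      then show ?case using assms(1)[of y z] assms(1)[of z y] by auto
    qed simp
  next
    assume "nf x = nf y"
    then have "equivclp r (nf x) y" using equivclp_sym[OF assms(2)[of y]] by simp
    then show "equivclp r x y" using equivclp_trans[OF assms(2)[of x]] by blast
  qed
  show ?thesis unfolding eq_class_def 1 by auto
qed

text \<open>Distinctness of the roots is essential: were two roots equal, gluing would identify two
  vertices of an edge of the base.\<close>

lemma glue_class:
  fixes A :: "('a, 'r) fo_struct" and G :: "('g, 'r) fo_struct" and R :: 'r
  assumes inj: "inj_on (cst G) {..<k}"
  defines "cls \<equiv> eq_class (glue R k A G)"
  shows "cls (Inl a) = cls (Inl b) \<longleftrightarrow> a = b"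
    and "e \<in> rel A R \<Longrightarrow> j < k \<Longrightarrow> cls (Inr (e, cst G j)) = cls (Inl (e ! j))"
    and "v \<notin> roots k G \<Longrightarrow> cls (Inr (e, v)) \<noteq> cls (Inl a)"
    and "v \<notin> roots k G \<Longrightarrow> w \<notin> roots k G \<Longrightarrow> cls (Inr (e, v)) = cls (Inr (f, w)) \<longleftrightarrow> e = f \<and> v = w"
proof -
  \<comment> \<open>The normal form moves a root of a copy to the vertex of the base it is glued to
    and fixes everything else.\<close>
  define nf :: "'a + 'a list \<times> 'g \<Rightarrow> 'a + 'a list \<times> 'g" where
    "nf x = (case x of Inl a \<Rightarrow> Inl a | Inr (e, v) \<Rightarrow>
       if e \<in> rel A R \<and> v \<in> roots k G then Inl (e ! inv_into {..<k} (cst G) v) else Inr (e, v))" for x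
  have nf_root: "nf (Inr (e, cst G j)) = Inl (e ! j)" if "e \<in> rel A R" "j < k" for e j
    using that inv_into_f_f[OF inj, of j] by (simp add: nf_def roots_def)
  have nf: "cls x = cls y \<longleftrightarrow> nf x = nf y" for x y
    unfolding cls_def
  proof (rule eq_class_nf)
    fix x y assume "glue R k A G x y"
    then obtain e i where "e \<in> rel A R" "i < k" "x = Inl (e ! i)" "y = Inr (e, cst G i)"
      unfolding glue_def by blast
    then show "nf x = nf y" using nf_root by (simp add: nf_def)
  next
    fix x show "equivclp (glue R k A G) x (nf x)"
    proof (cases "nf x = x")
      case False
      then obtain e v where x: "x = Inr (e, v)" "e \<in> rel A R" "v \<in> roots k G"
        by (auto simp: nf_def split: sum.splits if_splits prod.splits)
      then obtain j where j: "j < k" "v = cst G j" unfolding roots_def by auto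
      have "glue R k A G (nf x) x" unfolding glue_def using nf_root[OF x(2) j(1)] x j by blast
      then show ?thesis using equivclp_sym r_into_equivclp by metis
    qed simp
  qed
  show "cls (Inl a) = cls (Inl b) \<longleftrightarrow> a = b" unfolding nf by (simp add: nf_def)
  show "cls (Inr (e, cst G j)) = cls (Inl (e ! j))" if "e \<in> rel A R" "j < k"
    unfolding nf nf_root[OF that] by (simp add: nf_def)
  show "cls (Inr (e, v)) \<noteq> cls (Inl a)" if "v \<notin> roots k G" unfolding nf using that by (simp add: nf_def)
  show "cls (Inr (e, v)) = cls (Inr (f, w)) \<longleftrightarrow> e = f \<and> v = w" if "v \<notin> roots k G" "w \<notin> roots k G"
    unfolding nf using that by (simp add: nf_def)
qed

lemma gadget_product_structure:
  assumes "relational_lang L" "R \<notin> syms L" "base_structure L R k A" "gadget L k G"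
  shows "fo_structure L (gadget_product L R k A G)"
proof -
  have A: "universe A \<noteq> {}" "\<And>S t. S \<in> syms L \<Longrightarrow> t \<in> rel A S \<Longrightarrow> length t = arity L S \<and> set t \<subseteq> universe A"
    using assms(2,3) unfolding base_structure_def fo_structure_def base_lang_def by auto
  have G: "\<And>S t. S \<in> syms L \<Longrightarrow> t \<in> rel G S \<Longrightarrow> length t = arity L S \<and> set t \<subseteq> universe G"
    using assms(4) unfolding gadget_def fo_structure_def gadget_lang_def by auto
  show ?thesis
    using A G assms(1) unfolding fo_structure_def gadget_product_def relational_lang_def
    by (fastforce simp: Let_def)
qed

text \<open>Each edge \<open>e\<close> of \<open>A\<close> yields one auxiliary vertex per sort, and
  all of them name the same full copy of \<open>G\<close>; so \<open>K\<close> forgets the sort, and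
  exchanging sorts over a fixed \<open>e\<close> is the injection in the second claim. These
  injections are the source of the equal numbers of edges of all sorts.\<close>

lemma gadget_product_pre_gluing:
  fixes A :: "('a, 'r) fo_struct" and G :: "('g, 'r) fo_struct"
  assumes "R \<notin> syms L" "base_structure L R k A" "gadget L k G"
    and I_sub: "\<And>X. X \<in> frag_index k \<sigma> \<Longrightarrow> X \<subseteq> {..<k}"
    and I_disjoint: "\<And>X Y j. X \<in> frag_index k \<sigma> \<Longrightarrow> Y \<in> frag_index k \<sigma> \<Longrightarrow> j \<in> X \<Longrightarrow> j \<in> Y \<Longrightarrow> X = Y"
  shows "\<exists>J K. pre_gluing L k (frag_index k \<sigma>) (fragmentation L R k \<sigma> A) G (gadget_product L R k A G)
    (\<lambda>_. universe G) J K"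
    and "X \<in> frag_index k \<sigma> \<Longrightarrow> Y \<in> frag_index k \<sigma> \<Longrightarrow>
      \<exists>s. inj_on s (auxs (fragmentation L R k \<sigma> A) X) \<and>
        s ` auxs (fragmentation L R k \<sigma> A) X \<subseteq> auxs (fragmentation L R k \<sigma> A) Y"
    and "plain (frag_index k \<sigma>) (fragmentation L R k \<sigma> A) \<noteq> {}"
proof -
  define I where "I = frag_index k \<sigma>"
  define F where "F = fragmentation L R k \<sigma> A"
  define M where "M = gadget_product L R k A G"
  define bc where "bc = eq_class (glue (Orig R) k (embed_base A) (Gad k \<sigma>))"
  define mc where "mc = eq_class (glue R k A G)"
  have A: "universe A \<noteq> {}" "\<And>S t. S \<in> insert R (syms L) \<Longrightarrow> t \<in> rel A S \<Longrightarrow> set t \<subseteq> universe A"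
    "\<And>e. e \<in> rel A R \<Longrightarrow> length e = k"
    using assms(2) unfolding base_structure_def fo_structure_def base_lang_def by auto
  have inj: "inj_on (cst G) {..<k}" using assms(3) unfolding gadget_def by simp
  have Gs: "fo_structure (gadget_lang L k) G" using assms(3) unfolding gadget_def by simp
  have Gu: "cst G j \<in> universe G" if "j < k" for j using Gs that unfolding fo_structure_def by simp
  have eA: "universe (embed_base A) = universe A" "\<And>S. rel (embed_base A) (Orig S) = rel A S"
    "\<And>X. rel (embed_base A) (Frag X) = {}" by (simp_all add: embed_base_def)
  have injR: "inj_on (cst (Gad k \<sigma>)) {..<k}" by (simp add: Gad_def inj_on_def)
  have rootsR: "roots k (Gad k \<sigma>) = Root ` {..<k}" by (simp add: Gad_def roots_def)
  note bcl = glue_class[where A = "embed_base A" and R = "Orig R", OF injR, folded bc_def, unfolded eA rootsR]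
  note mcl = glue_class[where A = A and R = R, OF inj, folded mc_def]
  have cR: "cst (Gad k \<sigma>) j = Root j" for j by (simp add: Gad_def)
  have bc1: "bc (Inl a) = bc (Inl b) \<longleftrightarrow> a = b" for a b by (rule bcl(1))
  have bc2: "bc (Inr (e, Root j)) = bc (Inl (e ! j))" if "e \<in> rel A R" "j < k" for e j
    using bcl(2)[OF that] unfolding cR .
  have bc3: "bc (Inr (e, AuxVertex X)) \<noteq> bc (Inl a)" for e X a by (rule bcl(3)) auto
  have bc4: "bc (Inr (e, AuxVertex X)) = bc (Inr (f, AuxVertex Y)) \<longleftrightarrow> e = f \<and> X = Y" for e f X Y
    using bcl(4)[of "AuxVertex X" "AuxVertex Y" e f] by auto
  have eu: "e ! j \<in> universe A" if "e \<in> rel A R" "j < k" for e j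
    using A(2)[of R e] A(3)[OF that(1)] that nth_mem[of j e] by auto
  define ed where "ed e X = map (\<lambda>j. bc (Inl (e ! j))) (sorted_list_of_set X) @ [bc (Inr (e, AuxVertex X))]" for e X
  have relF: "rel F (Frag X) = {ed e X |e. e \<in> rel A R}" if X: "X \<in> I" for X
  proof -
    have fX: "finite X" using I_sub X finite_subset unfolding I_def by blast
    have *: "map (\<lambda>v. bc (Inr (e, v))) (map Root (sorted_list_of_set X) @ [AuxVertex X]) = ed e X"
      if "e \<in> rel A R" for e
      unfolding ed_def using that bc2 I_sub[OF X[unfolded I_def]] fX by auto
    have "rel (Gad k \<sigma>) (Frag X) = {map Root (sorted_list_of_set X) @ [AuxVertex X]}"
      using X unfolding Gad_def I_def by simp
    then have "(\<exists>e t. u = map (\<lambda>v. bc (Inr (e, v))) t \<and> e \<in> rel A R \<and> t \<in> rel (Gad k \<sigma>) (Frag X)) \<longleftrightarrow>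
        (\<exists>e. u = ed e X \<and> e \<in> rel A R)" for u
      using * by (metis singletonD singletonI)
    then have "{map (\<lambda>v. bc (Inr (e, v))) t |e t. e \<in> rel A R \<and> t \<in> rel (Gad k \<sigma>) (Frag X)} = {ed e X |e. e \<in> rel A R}"
      by auto
    moreover have "Frag X \<in> syms (frag_lang L k \<sigma>)" using X by (simp add: frag_lang_def I_def)
    ultimately show ?thesis
      unfolding F_def fragmentation_def gadget_product_def Let_def bc_def[symmetric] by (simp add: eA)
  qed
  have relO: "rel F (Orig S) = {map (\<lambda>a. bc (Inl a)) t |t. t \<in> rel A S}" if "S \<in> syms L" for S
  proof -
    have "Orig S \<in> syms (frag_lang L k \<sigma>)" using that by (simp add: frag_lang_def)
    moreover have "rel (Gad k \<sigma>) (Orig S) = {}" by (simp add: Gad_def)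
    ultimately show ?thesis
      unfolding F_def fragmentation_def gadget_product_def Let_def bc_def[symmetric] by (simp add: eA)
  qed
  have auxF: "auxs F X = {bc (Inr (e, AuxVertex X)) |e. e \<in> rel A R}" if "X \<in> I" for X
    unfolding auxs_def relF[OF that] ed_def by force
  have univF: "universe F = (\<lambda>a. bc (Inl a)) ` universe A \<union> (\<Union>X\<in>I. auxs F X)"
  proof -
    have "universe F = bc ` (Inl ` universe A \<union> Inr ` (rel A R \<times> (Root ` {..<k} \<union> AuxVertex ` I)))"
      unfolding F_def fragmentation_def gadget_product_def Let_def bc_def[symmetric] by (simp add: eA Gad_def I_def)
    also have "\<dots> = (\<lambda>a. bc (Inl a)) ` universe A \<union> (\<Union>X\<in>I. {bc (Inr (e, AuxVertex X)) |e. e \<in> rel A R})"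
      using bc2 eu by (auto simp: image_iff)
    finally show ?thesis using auxF by simp
  qed
  have plainF: "plain I F = (\<lambda>a. bc (Inl a)) ` universe A"
    unfolding plain_def univF using auxF bc3 by fastforce
  show "plain (frag_index k \<sigma>) (fragmentation L R k \<sigma> A) \<noteq> {}"
    using plainF A(1) unfolding I_def F_def by simp
  \<comment> \<open>The base vertex, respectively the edge, is recovered from its class in the
    fragmentation; it is unique by \<open>bc1\<close> and \<open>bc4\<close>.\<close>
  define J where "J b = mc (Inl (THE a. b = bc (Inl a)))" for b
  define K where "K x v = mc (Inr (THE e. \<exists>X. x = bc (Inr (e, AuxVertex X)), v))" for x v
  have J: "J (bc (Inl a)) = mc (Inl a)" for a unfolding J_def bc1 by simp
  have K: "K (bc (Inr (e, AuxVertex X))) v = mc (Inr (e, v))" for e X v unfolding K_def bc4 by simp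
  have nth_ed: "ed e X ! p = bc (Inl (e ! (sorted_list_of_set X ! p)))" if "p < card X" for e X p
    using that by (simp add: ed_def nth_append)
  have sj: "sorted_list_of_set X ! p < k" if "X \<in> I" "p < card X" for X p
  proof -
    have "finite X" using I_sub that(1) finite_subset unfolding I_def by blast
    then have "sorted_list_of_set X ! p \<in> X" using that(2) nth_mem[of p "sorted_list_of_set X"] by simp
    then show ?thesis using I_sub that(1) unfolding I_def by blast
  qed
  have last_ed: "last (ed e X) = bc (Inr (e, AuxVertex X))" for e X by (simp add: ed_def)
  have "pre_gluing L k I F G M (\<lambda>_. universe G) J K"
  proof
    show "X \<subseteq> {..<k}" if "X \<in> I" for X using I_sub that unfolding I_def .
    show "X = Y" if "X \<in> I" "Y \<in> I" "j \<in> X" "j \<in> Y" for X Y j using I_disjoint that unfolding I_def .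
    show "length e = Suc (card X) \<and> set e \<subseteq> universe F" if X: "X \<in> I" and e: "e \<in> rel F (Frag X)" for X e
    proof
      obtain f where f: "f \<in> rel A R" "e = ed f X" using e unfolding relF[OF X] by blast
      show len: "length e = Suc (card X)" unfolding f(2) ed_def by simp
      show "set e \<subseteq> universe F"
      proof
        fix x assume "x \<in> set e"
        then consider "x = last e" | p where "p < card X" "x = e ! p"
          unfolding f(2) ed_def by (auto simp: in_set_conv_nth nth_append)
        then show "x \<in> universe F"
        proof cases
          case 1
          then have "x \<in> auxs F X" using e unfolding auxs_def by blast
          then show ?thesis unfolding univF using X by blast
        next
          case 2
          then show ?thesis unfolding univF f(2) nth_ed[OF 2(1)] using eu[OF f(1) sj[OF X 2(1)]]
            by blast
        qed
      qed
    qed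
    show "X = Y \<and> e = f" if "X \<in> I" "Y \<in> I" "e \<in> rel F (Frag X)" "f \<in> rel F (Frag Y)" "last e = last f" for X Y e f
      using that unfolding relF[OF that(1)] relF[OF that(2)] by (auto simp: last_ed bc4)
    show "e ! p \<in> plain I F" if "X \<in> I" "e \<in> rel F (Frag X)" "p < card X" for X e p
      using that(2) sj[OF that(1,3)] eu unfolding relF[OF that(1)] plainF by (auto simp: nth_ed[OF that(3)])
    show "inj_on J (plain I F)" unfolding plainF by (auto simp: inj_on_def J mcl(1))
    show "universe M = J ` plain I F \<union> (\<Union>X\<in>I. {K x v |x v. x \<in> auxs F X \<and> v \<in> universe G})"
    proof -
      have "universe M = (\<lambda>a. mc (Inl a)) ` universe A \<union> {mc (Inr (e, v)) |e v. e \<in> rel A R \<and> v \<in> universe G}"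
        unfolding M_def gadget_product_def Let_def mc_def[symmetric] by (simp, blast)
      moreover have "{K x v |x v. x \<in> auxs F X \<and> v \<in> universe G} = {mc (Inr (e, v)) |e v. e \<in> rel A R \<and> v \<in> universe G}"
        if "X \<in> I" for X unfolding auxF[OF that]
        by (auto simp: K; intro exI conjI; (rule K[of _ X, symmetric] | rule refl | assumption))
      \<comment> \<open>All sorts contribute the same copies, so the union gives them once there is
        a sort at all; the sort \<open>{}\<close> is always present.\<close>
      moreover have "{} \<in> I" unfolding I_def frag_index_def by simp
      moreover have "J ` plain I F = (\<lambda>a. mc (Inl a)) ` universe A" unfolding plainF by (simp add: image_image J)
      ultimately show ?thesis by auto
    qed
    show "cst G j \<in> universe G" if "X \<in> I" "j \<in> X" for X j using Gu I_sub that unfolding I_def by blast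
    show "K (last e) (cst G (sorted_list_of_set X ! p)) = J (e ! p)"
      if "X \<in> I" "e \<in> rel F (Frag X)" "p < card X" for X e p
      using that(2) sj[OF that(1,3)] unfolding relF[OF that(1)] by (auto simp: nth_ed[OF that(3)] last_ed K J mcl(2))
    show "K x v \<notin> J ` plain I F" if "X \<in> I" "x \<in> auxs F X" "v \<in> universe G - roots k G" for X x v
      using that(2,3) mcl(3) unfolding auxF[OF that(1)] plainF by (auto simp: K J)
    show "v = w \<and> (X = Y \<longrightarrow> x = y)" if "X \<in> I" "x \<in> auxs F X" "v \<in> universe G - roots k G"
      "Y \<in> I" "y \<in> auxs F Y" "w \<in> universe G - roots k G" "K x v = K y w" for X x v Y y w
      using that mcl(4) unfolding auxF[OF that(1)] auxF[OF that(4)] by (auto simp: K)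
    show "\<exists>y\<in>auxs F Y. \<forall>w\<in>universe G \<inter> universe G. K y w = K x w" if "X \<in> I" "Y \<in> I" "x \<in> auxs F X" for X Y x v
      using that(3) unfolding auxF[OF that(1)] auxF[OF that(2)] by (auto simp: K)
    show "t \<in> rel M S \<longleftrightarrow>
      (\<exists>s\<in>rel F (Orig S). set s \<subseteq> plain I F \<and> t = map J s) \<or>
      (\<exists>X\<in>I. \<exists>x\<in>auxs F X. \<exists>s\<in>rel G S. set s \<subseteq> universe G \<and> t = map (K x) s)" if S: "S \<in> syms L" for S t
    proof -
      have "t \<in> rel M S \<longleftrightarrow> (\<exists>s\<in>rel A S. t = map (\<lambda>a. mc (Inl a)) s) \<or>
          (\<exists>e\<in>rel A R. \<exists>s\<in>rel G S. t = map (\<lambda>v. mc (Inr (e, v))) s)"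
        unfolding M_def gadget_product_def Let_def mc_def[symmetric] using S by auto
      moreover have "(\<exists>s\<in>rel F (Orig S). set s \<subseteq> plain I F \<and> t = map J s) \<longleftrightarrow> (\<exists>s\<in>rel A S. t = map (\<lambda>a. mc (Inl a)) s)"
      proof -
        have 1: "set (map (\<lambda>a. bc (Inl a)) s) \<subseteq> plain I F" if "s \<in> rel A S" for s
          using A(2)[of S s] S that unfolding plainF by auto
        have 2: "map J (map (\<lambda>a. bc (Inl a)) s) = map (\<lambda>a. mc (Inl a)) s" for s by (simp add: J)
        have "rel F (Orig S) = map (\<lambda>a. bc (Inl a)) ` rel A S" unfolding relO[OF S] by (rule Setcompr_eq_image)
        then have "(\<exists>s\<in>rel F (Orig S). set s \<subseteq> plain I F \<and> t = map J s) \<longleftrightarrow>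
            (\<exists>s\<in>rel A S. set (map (\<lambda>a. bc (Inl a)) s) \<subseteq> plain I F \<and> t = map J (map (\<lambda>a. bc (Inl a)) s))"
          by (simp only: bex_simps)
        also have "\<dots> \<longleftrightarrow> (\<exists>s\<in>rel A S. t = map (\<lambda>a. mc (Inl a)) s)"
          by (rule bex_cong[OF refl]) (simp only: 1 2 simp_thms)
        finally show ?thesis .
      qed
      moreover have "(\<exists>X\<in>I. \<exists>x\<in>auxs F X. \<exists>s\<in>rel G S. set s \<subseteq> universe G \<and> t = map (K x) s) \<longleftrightarrow>
          (\<exists>e\<in>rel A R. \<exists>s\<in>rel G S. t = map (\<lambda>v. mc (Inr (e, v))) s)"
      proof -
        have "{} \<in> I" unfolding I_def frag_index_def by simp
        moreover have "set s \<subseteq> universe G" if "s \<in> rel G S" for s using Gs S that unfolding fo_structure_def by simp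
        moreover have 1: "map (K (bc (Inr (e, AuxVertex X)))) s = map (\<lambda>v. mc (Inr (e, v))) s" for e X s by (simp add: K)
        have "(\<exists>x\<in>auxs F X. \<exists>s\<in>rel G S. set s \<subseteq> universe G \<and> t = map (K x) s) \<longleftrightarrow>
            (\<exists>e\<in>rel A R. \<exists>s\<in>rel G S. set s \<subseteq> universe G \<and> t = map (\<lambda>v. mc (Inr (e, v))) s)" if "X \<in> I" for X
          unfolding auxF[OF that] Setcompr_eq_image bex_simps 1 ..
        ultimately show ?thesis by auto
      qed
      ultimately show ?thesis by simp
    qed
  qed (use Gs in simp_all)
  then show "\<exists>J K. pre_gluing L k (frag_index k \<sigma>) (fragmentation L R k \<sigma> A) G (gadget_product L R k A G)
    (\<lambda>_. universe G) J K" unfolding I_def F_def M_def by blast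
  show "\<exists>s. inj_on s (auxs (fragmentation L R k \<sigma> A) X) \<and>
        s ` auxs (fragmentation L R k \<sigma> A) X \<subseteq> auxs (fragmentation L R k \<sigma> A) Y"
    if X: "X \<in> frag_index k \<sigma>" and Y: "Y \<in> frag_index k \<sigma>"
  proof -
    define s where "s x = bc (Inr (THE e. x = bc (Inr (e, AuxVertex X)), AuxVertex Y))" for x
    have s: "s (bc (Inr (e, AuxVertex X))) = bc (Inr (e, AuxVertex Y))" for e unfolding s_def bc4 by simp
    have "inj_on s (auxs F X)" unfolding auxF[OF X[folded I_def]] by (auto simp: inj_on_def s bc4)
    moreover have "s ` auxs F X \<subseteq> auxs F Y"
      unfolding auxF[OF X[folded I_def]] auxF[OF Y[folded I_def]] by (auto simp: s)
    ultimately show ?thesis unfolding F_def by blast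
  qed
qed

section \<open>The parts of a gadget and the product along a fragmentation\<close>

text \<open>If \<sigma> is connectivity of roots, this is the class of the roots in the component of
  \<open>v\<close>, or \<open>{}\<close> for a rootless component: the index of the part containing
  \<open>v\<close>.\<close>

definition root_part :: "'r lang \<Rightarrow> nat \<Rightarrow> ('h, 'r) fo_struct \<Rightarrow> 'h \<Rightarrow> nat set" where
  "root_part L k H v = {j. j < k \<and> (cst H j, v) \<in> (gaifman L H)\<^sup>*}"

lemma root_part_adjacent: "(u, v) \<in> gaifman L H \<Longrightarrow> root_part L k H u = root_part L k H v"
  unfolding root_part_def by (auto intro: rtrancl_into_rtrancl dest: gaifman_sym)

lemma root_part_root: "j < k \<Longrightarrow> j \<in> root_part L k H (cst H j)"
  unfolding root_part_def by simp

lemma root_part_index: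
  assumes "\<And>i j. i < k \<Longrightarrow> j < k \<Longrightarrow> (i, j) \<in> \<sigma> \<longleftrightarrow> (cst H i, cst H j) \<in> (gaifman L H)\<^sup>*" "\<sigma> \<subseteq> {..<k} \<times> {..<k}"
  shows "root_part L k H v \<in> frag_index k \<sigma>"
proof (cases "root_part L k H v = {}")
  case False
  then obtain j where j: "j < k" "(cst H j, v) \<in> (gaifman L H)\<^sup>*" unfolding root_part_def by auto
  have "(cst H i, v) \<in> (gaifman L H)\<^sup>* \<longleftrightarrow> (j, i) \<in> \<sigma>" if "i < k" for i
  proof -
    have "(cst H i, v) \<in> (gaifman L H)\<^sup>* \<longleftrightarrow> (cst H j, cst H i) \<in> (gaifman L H)\<^sup>*"
      using j(2) rtrancl_trans gaifman_rtrancl_sym by metis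
    then show ?thesis using assms(1)[OF j(1) that] by simp
  qed
  then have "root_part L k H v = \<sigma> `` {j}" unfolding root_part_def using assms(2) by auto
  then show ?thesis unfolding frag_index_def using j(1) by (auto intro: quotientI)
qed (simp add: frag_index_def)

text \<open>The roots in a class are connected to each other and to no further root, so the
  components in the union coincide and their vertices see exactly the roots of this class.\<close>

lemma frag_part_eq:
  assumes H: "fo_structure (gadget_lang L k) H"
    and \<sigma>: "\<And>i j. i < k \<Longrightarrow> j < k \<Longrightarrow> (i, j) \<in> \<sigma> \<longleftrightarrow> (cst H i, cst H j) \<in> (gaifman L H)\<^sup>*" "\<sigma> \<subseteq> {..<k} \<times> {..<k}"
    and X: "X \<in> frag_index k \<sigma>"
  shows "frag_part L k H X = {v \<in> universe H. root_part L k H v = X}"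
proof (cases "X = {}")
  case True
  then show ?thesis unfolding frag_part_def component_def root_part_def by auto
next
  case False
  then obtain i where i: "i < k" "X = \<sigma> `` {i}" using X unfolding frag_index_def by (auto elim: quotientE)
  have Xe: "j \<in> X \<longleftrightarrow> j < k \<and> (cst H i, cst H j) \<in> (gaifman L H)\<^sup>*" for j
    using \<sigma>(1)[OF i(1)] \<sigma>(2) unfolding i(2) by auto
  have "root_part L k H v = X \<longleftrightarrow> (\<exists>j\<in>X. (cst H j, v) \<in> (gaifman L H)\<^sup>*)" for v
  proof
    assume "root_part L k H v = X"
    then show "\<exists>j\<in>X. (cst H j, v) \<in> (gaifman L H)\<^sup>*" using False unfolding root_part_def by blast
  next
    assume "\<exists>j\<in>X. (cst H j, v) \<in> (gaifman L H)\<^sup>*"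
    then have iv: "(cst H i, v) \<in> (gaifman L H)\<^sup>*" using Xe rtrancl_trans by metis
    have "j \<in> root_part L k H v \<longleftrightarrow> j \<in> X" for j
      unfolding Xe root_part_def using iv rtrancl_trans gaifman_rtrancl_sym by (smt (verit) mem_Collect_eq)
    then show "root_part L k H v = X" by blast
  qed
  then show ?thesis using False unfolding frag_part_def component_def by auto
qed


lemma frag_glue_class:
  fixes B :: "('b, 'r frag_sym) fo_struct" and H :: "('h, 'r) fo_struct" and \<sigma> :: "(nat \<times> nat) set"
  assumes inj: "inj_on (cst H) {..<k}" and I_sub: "\<And>X. X \<in> frag_index k \<sigma> \<Longrightarrow> X \<subseteq> {..<k}"
  defines "cls \<equiv> eq_class (frag_glue k \<sigma> B H)"
  shows "cls (Inl a) = cls (Inl b) \<longleftrightarrow> a = b"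
    and "X \<in> frag_index k \<sigma> \<Longrightarrow> e \<in> rel B (Frag X) \<Longrightarrow> p < card X \<Longrightarrow>
      cls (Inr (X, e, cst H (sorted_list_of_set X ! p))) = cls (Inl (e ! p))"
    and "v \<notin> roots k H \<Longrightarrow> cls (Inr (X, e, v)) \<noteq> cls (Inl a)"
    and "v \<notin> roots k H \<Longrightarrow> w \<notin> roots k H \<Longrightarrow>
      cls (Inr (X, e, v)) = cls (Inr (Y, f, w)) \<longleftrightarrow> X = Y \<and> e = f \<and> v = w"
proof -
  define pos where "pos X v p \<longleftrightarrow> p < card X \<and> v = cst H (sorted_list_of_set X ! p)" for X v p
  define nf :: "'b + nat set \<times> 'b list \<times> 'h \<Rightarrow> 'b + nat set \<times> 'b list \<times> 'h" where
    "nf x = (case x of Inl a \<Rightarrow> Inl a | Inr (X, e, v) \<Rightarrow>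
       if X \<in> frag_index k \<sigma> \<and> e \<in> rel B (Frag X) \<and> (\<exists>p. pos X v p) then Inl (e ! (THE p. pos X v p)) else Inr (X, e, v))" for x
  have sX: "sorted_list_of_set X ! p \<in> {..<k}" if "X \<in> frag_index k \<sigma>" "p < card X" for X p
  proof -
    have "finite X" using I_sub[OF that(1)] finite_subset by blast
    then show ?thesis using I_sub[OF that(1)] nth_mem[of p "sorted_list_of_set X"] that(2) by auto
  qed
  have uniq: "p = p2" if X: "X \<in> frag_index k \<sigma>" and p: "pos X v p" "pos X v p2" for X v p p2
  proof -
    have "sorted_list_of_set X ! p = sorted_list_of_set X ! p2"
      using inj_onD[OF inj] sX[OF X] p unfolding pos_def by metis
    then show ?thesis using p unfolding pos_def by (simp add: nth_eq_iff_index_eq)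
  qed
  have nf_root: "nf (Inr (X, e, v)) = Inl (e ! p)"
    if "X \<in> frag_index k \<sigma>" "e \<in> rel B (Frag X)" "pos X v p" for X e v p
  proof -
    have "(THE p. pos X v p) = p" using uniq[OF that(1)] that(3) by blast
    then show ?thesis using that by (auto simp: nf_def)
  qed
  have nonroot: "\<not> pos X v p" if "X \<in> frag_index k \<sigma>" "v \<notin> roots k H" for X v p
    using that sX unfolding pos_def roots_def by blast
  have nf: "cls x = cls y \<longleftrightarrow> nf x = nf y" for x y
    unfolding cls_def
  proof (rule eq_class_nf)
    fix x y assume "frag_glue k \<sigma> B H x y"
    then obtain X e p where "X \<in> frag_index k \<sigma>" "e \<in> rel B (Frag X)" "p < card X" "x = Inl (e ! p)"
      "y = Inr (X, e, cst H (sorted_list_of_set X ! p))" unfolding frag_glue_def by blast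
    then show "nf x = nf y" using nf_root[of X e _ p] by (simp add: nf_def pos_def)
  next
    fix x show "equivclp (frag_glue k \<sigma> B H) x (nf x)"
    proof (cases "nf x = x")
      case False
      then obtain X e v p where x: "x = Inr (X, e, v)" "X \<in> frag_index k \<sigma>" "e \<in> rel B (Frag X)" "pos X v p"
        by (auto simp: nf_def split: sum.splits if_splits prod.splits)
      have "frag_glue k \<sigma> B H (nf x) x"
        unfolding frag_glue_def x(1) nf_root[OF x(2-4)] using x(2-4) unfolding pos_def by blast
      then show ?thesis using equivclp_sym r_into_equivclp by metis
    qed simp
  qed
  show "cls (Inl a) = cls (Inl b) \<longleftrightarrow> a = b" unfolding nf by (simp add: nf_def)
  show "cls (Inr (X, e, cst H (sorted_list_of_set X ! p))) = cls (Inl (e ! p))"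
    if "X \<in> frag_index k \<sigma>" "e \<in> rel B (Frag X)" "p < card X"
  proof -
    have "nf (Inr (X, e, cst H (sorted_list_of_set X ! p))) = Inl (e ! p)"
      by (rule nf_root[OF that(1,2)]) (simp add: pos_def that(3))
    then show ?thesis unfolding nf by (simp add: nf_def)
  qed
  have nfn: "nf (Inr (X, e, v)) = Inr (X, e, v)" if "v \<notin> roots k H" for X e v
    using nonroot that by (simp add: nf_def)
  show "cls (Inr (X, e, v)) \<noteq> cls (Inl a)" if "v \<notin> roots k H" unfolding nf nfn[OF that] by (simp add: nf_def)
  show "cls (Inr (X, e, v)) = cls (Inr (Y, f, w)) \<longleftrightarrow> X = Y \<and> e = f \<and> v = w"
    if "v \<notin> roots k H" "w \<notin> roots k H"
    unfolding nf nfn[OF that(1)] nfn[OF that(2)] by simp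
qed

text \<open>The shape of edges in a fragmentation: the last vertex determines the edge and its sort,
  and the other vertices are never auxiliary. The limit \<open>B\<close> need not be a
  fragmentation, so these properties have to be transferred to it.\<close>

definition frag_base :: "nat set set \<Rightarrow> ('b, 'r frag_sym) fo_struct \<Rightarrow> bool" where
  "frag_base I B \<longleftrightarrow>
     (\<forall>X\<in>I. \<forall>e\<in>rel B (Frag X). length e = Suc (card X) \<and> set e \<subseteq> universe B) \<and>
     (\<forall>X\<in>I. \<forall>Y\<in>I. \<forall>e\<in>rel B (Frag X). \<forall>f\<in>rel B (Frag Y). last e = last f \<longrightarrow> X = Y \<and> e = f) \<and>
     (\<forall>X\<in>I. \<forall>e\<in>rel B (Frag X). \<forall>p<card X. e ! p \<in> plain I B)"

lemma frag_baseD: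
  assumes "frag_base I B"
  shows "X \<in> I \<Longrightarrow> e \<in> rel B (Frag X) \<Longrightarrow> length e = Suc (card X) \<and> set e \<subseteq> universe B"
    and "X \<in> I \<Longrightarrow> Y \<in> I \<Longrightarrow> e \<in> rel B (Frag X) \<Longrightarrow> f \<in> rel B (Frag Y) \<Longrightarrow>
      last e = last f \<Longrightarrow> X = Y \<and> e = f"
    and "X \<in> I \<Longrightarrow> e \<in> rel B (Frag X) \<Longrightarrow> p < card X \<Longrightarrow> e ! p \<in> plain I B"
  using assms unfolding frag_base_def by simp_all

lemma frag_product_plain:
  "universe B - aux_vertices k \<sigma> B = plain (frag_index k \<sigma>) B"
  unfolding aux_vertices_def plain_def auxs_def by blast

text \<open>In contrast to the plain gadget product, the copied sets are pairwise disjoint, each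
  sort of edges carrying only its own part of \<open>H\<close>.\<close>

lemma frag_product_pre_gluing:
  fixes B :: "('b, 'r frag_sym) fo_struct" and H :: "('h, 'r) fo_struct"
  assumes B: "fo_structure (frag_lang L k \<sigma>) B" "frag_base (frag_index k \<sigma>) B"
    and H: "fo_structure (gadget_lang L k) H" "inj_on (cst H) {..<k}"
    and I_sub: "\<And>X. X \<in> frag_index k \<sigma> \<Longrightarrow> X \<subseteq> {..<k}"
    and I_disjoint: "\<And>X Y j. X \<in> frag_index k \<sigma> \<Longrightarrow> Y \<in> frag_index k \<sigma> \<Longrightarrow> j \<in> X \<Longrightarrow> j \<in> Y \<Longrightarrow> X = Y"
    and \<sigma>: "\<And>i j. i < k \<Longrightarrow> j < k \<Longrightarrow> (i, j) \<in> \<sigma> \<longleftrightarrow> (cst H i, cst H j) \<in> (gaifman L H)\<^sup>*" "\<sigma> \<subseteq> {..<k} \<times> {..<k}"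
  shows "\<exists>J K. pre_gluing L k (frag_index k \<sigma>) B H (frag_product L k \<sigma> B H)
    (\<lambda>X. {v \<in> universe H. root_part L k H v = X}) J K"
proof -
  define I where "I = frag_index k \<sigma>"
  define cls where "cls = eq_class (frag_glue k \<sigma> B H)"
  define D where "D X = {v \<in> universe H. root_part L k H v = X}" for X
  define J where "J b = cls (Inl b)" for b
  \<comment> \<open>Recovers the sort and the edge from an auxiliary vertex; well-defined by
    \<open>frag_base\<close>.\<close>
  define ed where "ed x = (THE Xe. fst Xe \<in> I \<and> snd Xe \<in> rel B (Frag (fst Xe)) \<and> last (snd Xe) = x)" for x
  define K where "K x v = cls (Inr (fst (ed x), snd (ed x), v))" for x v
  note cl = frag_glue_class[where \<sigma> = \<sigma> and B = B, OF H(2) I_sub, folded cls_def I_def]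
  note B' = frag_baseD[OF B(2), folded I_def]
  have uniq: "X = Y \<and> e = f" if "X \<in> I" "Y \<in> I" "e \<in> rel B (Frag X)" "f \<in> rel B (Frag Y)" "last e = last f" for X Y e f
    using B'(2) that .
  have "ed (last e) = (X, e)" if "X \<in> I" "e \<in> rel B (Frag X)" for X e
    unfolding ed_def
  proof (rule the_equality)
    fix Xe assume "fst Xe \<in> I \<and> snd Xe \<in> rel B (Frag (fst Xe)) \<and> last (snd Xe) = last e"
    then show "Xe = (X, e)" using uniq[OF _ that(1) _ that(2), of "fst Xe" "snd Xe"] by (simp add: prod_eq_iff)
  qed (use that in simp)
  then have K: "K (last e) v = cls (Inr (X, e, v))" if "X \<in> I" "e \<in> rel B (Frag X)" for X e v
    unfolding K_def using that by simp
  have auxE: "(\<exists>x\<in>auxs B X. Q x) \<longleftrightarrow> (\<exists>e\<in>rel B (Frag X). Q (last e))" for X Q unfolding auxs_def by blast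
  have DI: "frag_part L k H X = D X" if "X \<in> I" for X
    unfolding D_def using frag_part_eq[OF H(1) \<sigma>] that unfolding I_def by blast
  have "pre_gluing L k I B H (frag_product L k \<sigma> B H) D J K"
  proof
    show "X \<subseteq> {..<k}" if "X \<in> I" for X using I_sub that unfolding I_def .
    show "X = Y" if "X \<in> I" "Y \<in> I" "j \<in> X" "j \<in> Y" for X Y j using I_disjoint that unfolding I_def .
    show "length e = Suc (card X) \<and> set e \<subseteq> universe B" if "X \<in> I" "e \<in> rel B (Frag X)" for X e
      using B'(1) that .
    show "X = Y \<and> e = f" if "X \<in> I" "Y \<in> I" "e \<in> rel B (Frag X)" "f \<in> rel B (Frag Y)" "last e = last f" for X Y e f
      using uniq that .
    show "e ! p \<in> plain I B" if "X \<in> I" "e \<in> rel B (Frag X)" "p < card X" for X e p using B'(3) that .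
    show "D X \<subseteq> universe H" for X unfolding D_def by blast
    show "inj_on J (plain I B)" unfolding J_def by (simp add: inj_on_def cl(1))
    show "universe (frag_product L k \<sigma> B H) = J ` plain I B \<union> (\<Union>X\<in>I. {K x v |x v. x \<in> auxs B X \<and> v \<in> D X})"
    proof -
      have 1: "{K x v |x v. x \<in> auxs B X \<and> v \<in> D X} = {cls (Inr (X, e, v)) |e v. e \<in> rel B (Frag X) \<and> v \<in> frag_part L k H X}"
        if "X \<in> I" for X
      proof (rule set_eqI)
        fix m
        have "m \<in> {K x v |x v. x \<in> auxs B X \<and> v \<in> D X} \<longleftrightarrow> (\<exists>e\<in>rel B (Frag X). \<exists>v\<in>D X. m = K (last e) v)"
          unfolding auxs_def by blast
        also have "\<dots> \<longleftrightarrow> (\<exists>e\<in>rel B (Frag X). \<exists>v\<in>D X. m = cls (Inr (X, e, v)))"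
          by (intro bex_cong refl) (simp only: K[OF that])
        also have "\<dots> \<longleftrightarrow> m \<in> {cls (Inr (X, e, v)) |e v. e \<in> rel B (Frag X) \<and> v \<in> frag_part L k H X}"
          unfolding DI[OF that] by blast
        finally show "m \<in> {K x v |x v. x \<in> auxs B X \<and> v \<in> D X} \<longleftrightarrow>
          m \<in> {cls (Inr (X, e, v)) |e v. e \<in> rel B (Frag X) \<and> v \<in> frag_part L k H X}" .
      qed
      have "universe (frag_product L k \<sigma> B H) = cls ` (Inl ` plain I B \<union>
          {Inr (X, e, v) |X e v. X \<in> I \<and> e \<in> rel B (Frag X) \<and> v \<in> frag_part L k H X})"
        unfolding frag_product_def Let_def cls_def I_def frag_product_plain by simp
      also have "\<dots> = J ` plain I B \<union> (\<Union>X\<in>I. {cls (Inr (X, e, v)) |e v. e \<in> rel B (Frag X) \<and> v \<in> frag_part L k H X})"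
        unfolding J_def by blast
      also have "(\<Union>X\<in>I. {cls (Inr (X, e, v)) |e v. e \<in> rel B (Frag X) \<and> v \<in> frag_part L k H X}) =
          (\<Union>X\<in>I. {K x v |x v. x \<in> auxs B X \<and> v \<in> D X})"
        by (intro SUP_cong refl 1[symmetric])
      finally show ?thesis .
    qed
    show "cst H j \<in> D X" if X: "X \<in> I" "j \<in> X" for X j
    proof -
      have j: "j < k" using I_sub X unfolding I_def by blast
      then have "cst H j \<in> universe H" using H(1) unfolding fo_structure_def by simp
      moreover have "root_part L k H (cst H j) = X"
        using I_disjoint[OF root_part_index[OF \<sigma>] X(1)[unfolded I_def] root_part_root[OF j] X(2)] .
      ultimately show ?thesis unfolding D_def by blast
    qed
    show "K (last e) (cst H (sorted_list_of_set X ! p)) = J (e ! p)" if "X \<in> I" "e \<in> rel B (Frag X)" "p < card X" for X e p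
      unfolding K[OF that(1,2)] J_def using cl(2) that by blast
    show "K x v \<notin> J ` plain I B" if "X \<in> I" "x \<in> auxs B X" "v \<in> D X - roots k H" for X x v
      using that(2,3) cl(3) unfolding auxs_def J_def by (auto simp: K[OF that(1)])
    show "v = w \<and> (X = Y \<longrightarrow> x = y)" if "X \<in> I" "x \<in> auxs B X" "v \<in> D X - roots k H"
      "Y \<in> I" "y \<in> auxs B Y" "w \<in> D Y - roots k H" "K x v = K y w" for X x v Y y w
      using that(2,3,5,6,7) cl(4) unfolding auxs_def by (auto simp: K[OF that(1)] K[OF that(4)])
    \<comment> \<open>A common vertex forces equal sorts, so \<open>x\<close> itself works.\<close>
    show "\<exists>y\<in>auxs B Y. \<forall>w\<in>D X \<inter> D Y. K y w = K x w" if "x \<in> auxs B X" "v \<in> D X \<inter> D Y" for X Y x v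
      using that unfolding D_def by blast
    show "t \<in> rel (frag_product L k \<sigma> B H) S \<longleftrightarrow>
      (\<exists>s\<in>rel B (Orig S). set s \<subseteq> plain I B \<and> t = map J s) \<or>
      (\<exists>X\<in>I. \<exists>x\<in>auxs B X. \<exists>s\<in>rel H S. set s \<subseteq> D X \<and> t = map (K x) s)" if S: "S \<in> syms L" for S t
    proof -
      have Bu: "set s \<subseteq> universe B" if "s \<in> rel B (Orig S)" for s
        using B(1) S that unfolding fo_structure_def frag_lang_def by auto
      have "rel (frag_product L k \<sigma> B H) S =
          {map (\<lambda>b. cls (Inl b)) s |s. s \<in> rel B (Orig S) \<and> set s \<inter> aux_vertices k \<sigma> B = {}} \<union>
          {map (\<lambda>v. cls (Inr (X, e, v))) s |X e s. X \<in> I \<and> e \<in> rel B (Frag X) \<and> s \<in> rel H S \<and> set s \<subseteq> frag_part L k H X}"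
        unfolding frag_product_def Let_def cls_def I_def using S by simp
      moreover have "t \<in> {map (\<lambda>b. cls (Inl b)) s |s. s \<in> rel B (Orig S) \<and> set s \<inter> aux_vertices k \<sigma> B = {}} \<longleftrightarrow>
          (\<exists>s\<in>rel B (Orig S). set s \<subseteq> plain I B \<and> t = map J s)"
      proof -
        have "set s \<inter> aux_vertices k \<sigma> B = {} \<longleftrightarrow> set s \<subseteq> plain I B" if "s \<in> rel B (Orig S)" for s
          using Bu[OF that] unfolding I_def frag_product_plain[symmetric] by blast
        then show ?thesis unfolding J_def by blast
      qed
      moreover have "t \<in> {map (\<lambda>v. cls (Inr (X, e, v))) s |X e s. X \<in> I \<and> e \<in> rel B (Frag X) \<and> s \<in> rel H S \<and> set s \<subseteq> frag_part L k H X} \<longleftrightarrow>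
          (\<exists>X\<in>I. \<exists>x\<in>auxs B X. \<exists>s\<in>rel H S. set s \<subseteq> D X \<and> t = map (K x) s)"
      proof -
        have 1: "map (K (last e)) s = map (\<lambda>v. cls (Inr (X, e, v))) s" if "X \<in> I" "e \<in> rel B (Frag X)" for X e s
          using K[OF that] by simp
        have "(\<exists>X\<in>I. \<exists>x\<in>auxs B X. \<exists>s\<in>rel H S. set s \<subseteq> D X \<and> t = map (K x) s) \<longleftrightarrow>
          (\<exists>X\<in>I. \<exists>e\<in>rel B (Frag X). \<exists>s\<in>rel H S. set s \<subseteq> frag_part L k H X \<and> t = map (\<lambda>v. cls (Inr (X, e, v))) s)"
          unfolding auxE by (intro bex_cong refl) (simp only: 1 DI)
        then show ?thesis by blast
      qed
      ultimately show ?thesis by simp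
    qed
  qed (rule H(1))
  then show ?thesis unfolding D_def I_def by blast
qed

section \<open>Limits\<close>

text \<open>If \<open>P\<close> and its negation both hold infinitely often, each set of indices
  carries a free ultrafilter, and these two disagree about \<open>P\<close>. So comparing
  ultraproducts along two ultrafilters proves convergence.\<close>

lemma ultrafilter_dichotomy:
  assumes "\<And>U V. free_ultrafilter U \<Longrightarrow> free_ultrafilter V \<Longrightarrow> eventually P U \<Longrightarrow> eventually P V"
  shows "eventually P sequentially \<or> eventually (\<lambda>n. \<not> P n) sequentially"
proof (rule ccontr)
  assume c: "\<not> (eventually P sequentially \<or> eventually (\<lambda>n. \<not> P n) sequentially)"
  have "inf sequentially (principal {n. P n}) \<noteq> bot" "inf sequentially (principal {n. \<not> P n}) \<noteq> bot"
    using c by (simp_all add: trivial_limit_def eventually_inf_principal)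
  then obtain U V where U: "free_ultrafilter U" "U \<le> inf sequentially (principal {n. P n})"
    and V: "free_ultrafilter V" "V \<le> inf sequentially (principal {n. \<not> P n})"
    using free_ultrafilter_exists inf_le1 by metis
  have "eventually P U" "eventually (\<lambda>n. \<not> P n) V"
    by (rule filter_leD[OF U(2)] filter_leD[OF V(2)], simp add: eventually_inf_principal)+
  then show False using assms[OF U(1) V(1)] free_ultrafilter.ev_not[OF V(1)] by blast
qed

lemma convergent_ev:
  assumes "el_convergent L M" "\<phi> \<in> sentences L" "free_ultrafilter U"
  shows "eventually (\<lambda>n. M n \<Turnstile> \<phi>) U \<longleftrightarrow> eventually (\<lambda>n. M n \<Turnstile> \<phi>) sequentially"
proof -
  interpret free_ultrafilter U by (rule assms(3))
  have neg: "M n \<Turnstile> Neg \<phi> \<longleftrightarrow> \<not> M n \<Turnstile> \<phi>" for n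
    using assms(1,2) models_Neg[of \<phi> "M n"] unfolding el_convergent_def fo_structure_def sentences_def by simp
  have "eventually (\<lambda>n. M n \<Turnstile> \<phi>) sequentially \<or> eventually (\<lambda>n. \<not> M n \<Turnstile> \<phi>) sequentially"
    using assms(1,2) unfolding el_convergent_def neg[symmetric] by blast
  then show ?thesis
  proof
    assume "eventually (\<lambda>n. \<not> M n \<Turnstile> \<phi>) sequentially"
    then have "eventually (\<lambda>n. \<not> M n \<Turnstile> \<phi>) U" by (rule ev_sequentially)
    then show ?thesis using ev_not ev_sequentially by blast
  qed (use ev_sequentially in blast)
qed

lemma convergent_bf:
  assumes "el_convergent L M" "finite (syms L)" "free_ultrafilter U" "free_ultrafilter V"
  shows "bf L (ult U M) (ult V M) {}"
proof -
  have M: "fo_structure L (M n)" for n using assms(1) unfolding el_convergent_def by blast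
  show ?thesis
    by (rule ult_bf[OF assms(3,4,2) M M])
      (simp add: free_ultrafilter.ult_models[OF _ M] assms(3,4) convergent_ev[OF assms(1)])
qed

text \<open>An elementary limit need not be saturated, so it is represented by its
  ultrapower.\<close>

lemma limit_bf:
  assumes "el_convergent L M" "el_limit L M N" "finite (syms L)" "free_ultrafilter U"
  shows "bf L (ult U (\<lambda>_. N)) (ult U M) {}"
proof -
  have M: "fo_structure L (M n)" for n using assms(1) unfolding el_convergent_def by blast
  have N: "fo_structure L N" and lim: "\<And>\<phi>. \<phi> \<in> sentences L \<Longrightarrow> N \<Turnstile> \<phi> \<longleftrightarrow> eventually (\<lambda>n. M n \<Turnstile> \<phi>) sequentially"
    using assms(2) unfolding el_limit_def by blast+
  show ?thesis
    by (rule ult_bf[OF assms(4,4,3) N M])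
      (simp add: free_ultrafilter.ult_models[OF assms(4) M] free_ultrafilter.ult_models[OF assms(4) N]
        free_ultrafilter.ev_const[OF assms(4)] convergent_ev[OF assms(1) _ assms(4)] lim)
qed

lemma bf_models:
  assumes "bf L M N {}" "csts L = {}" "\<phi> \<in> sentences L" "universe M \<noteq> {}" "universe N \<noteq> {}"
  shows "M \<Turnstile> \<phi> \<longleftrightarrow> N \<Turnstile> \<phi>"
proof -
  have \<phi>: "wf_formula L \<phi>" "free_vars \<phi> = {}" using assms(3) unfolding sentences_def by auto
  have "sat M undefined \<phi> \<longleftrightarrow> sat N undefined \<phi>"
    by (rule sat_bf[OF assms(2) \<phi>(1) assms(1)]) (simp add: \<phi>(2))
  then show ?thesis
    using models_sentence[OF \<phi>(2) assms(4), of undefined] models_sentence[OF \<phi>(2) assms(5), of undefined] by simp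
qed

context free_ultrafilter
begin

lemma root_path_ult:
  assumes G: "\<And>n. fo_structure (gadget_lang L k) (G n)" and fin: "finite (syms L)"
  shows "(cst (ult U G) i, cst (ult U G) j) \<in> gaifman L (ult U G) ^^ d \<longleftrightarrow>
    eventually (\<lambda>n. (cst (G n) i, cst (G n) j) \<in> gaifman L (G n) ^^ d) U"
proof -
  have "eventually (\<lambda>n. ((cst (ult U G) i n, cst (ult U G) j n) \<in> gaifman L (G n) ^^ d) \<longleftrightarrow>
      (cst (G n) i, cst (G n) j) \<in> gaifman L (G n) ^^ d) U"
    using ev_canon[of U "\<lambda>n. cst (G n) i"] ev_canon[of U "\<lambda>n. cst (G n) j"]
    unfolding ult_cst by eventually_elim simp
  then show ?thesis
    using ult_gaifman_relpow[of "gadget_lang L k" G, OF G, of "cst (ult U G) i" "cst (ult U G) j" d] fin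
    by (simp add: ult_cst ev_iff)
qed

text \<open>Roots of the ultrapower come from constant sequences, so a path of length
  \<open>d\<close> between them exists there exactly if it exists in \<open>H\<close>.\<close>

lemma root_connected_const:
  assumes H: "fo_structure (gadget_lang L k) H" and fin: "finite (syms L)"
  shows "(cst (ult U (\<lambda>_. H)) i, cst (ult U (\<lambda>_. H)) j) \<in> (gaifman L (ult U (\<lambda>_. H)))\<^sup>* \<longleftrightarrow>
    (cst H i, cst H j) \<in> (gaifman L H)\<^sup>*"
  unfolding rtrancl_power root_path_ult[OF H fin] ev_const ..

end

lemma root_connected_bf:
  assumes H: "fo_structure (gadget_lang L k) H" "fo_structure (gadget_lang L k) H'"
    and bf: "bf (gadget_lang L k) H H' {}" and ij: "i < k" "j < k"
  shows "(cst H i, cst H j) \<in> gaifman L H ^^ d \<Longrightarrow> (cst H' i, cst H' j) \<in> gaifman L H' ^^ d"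
    and "(cst H i, cst H j) \<in> (gaifman L H)\<^sup>* \<longleftrightarrow> (cst H' i, cst H' j) \<in> (gaifman L H')\<^sup>*"
proof -
  have "bf (gadget_lang L k) H H' ({} \<union> (\<lambda>c. (cst H c, cst H' c)) ` {i, j})"
    by (rule bf_union_csts[OF bf]) (use H(1) ij in \<open>auto simp: fo_structure_def\<close>)
  then have b: "bf (gadget_lang L k) H H' {(cst H i, cst H' i), (cst H j, cst H' j)}" by simp
  show "(cst H i, cst H j) \<in> gaifman L H ^^ d \<Longrightarrow> (cst H' i, cst H' j) \<in> gaifman L H' ^^ d"
    using bf_gaifman_relpow[OF H(1) b, of "cst H i" "cst H' i" "cst H j" "cst H' j" d] by simp
  show "(cst H i, cst H j) \<in> (gaifman L H)\<^sup>* \<longleftrightarrow> (cst H' i, cst H' j) \<in> (gaifman L H')\<^sup>*"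
    using bf_connected[OF H b, of "cst H i" "cst H' i" "cst H j" "cst H' j"] by simp
qed

text \<open>\<open>lim\<close> has a meaning only once convergence is known. For each
  \<open>d\<close>, the existence of a walk of length \<open>d\<close> between the two roots is
  eventually decided; hence the distances are eventually constant or tend to infinity, and the first
  case is the one in which the ultraproduct has a walk.\<close>

lemma root_connected_iff_lim:
  assumes conv: "el_convergent (gadget_lang L k) G" and fin: "finite (syms L)"
    and U: "free_ultrafilter U" and ij: "i < k" "j < k"
  shows "(cst (ult U G) i, cst (ult U G) j) \<in> (gaifman L (ult U G))\<^sup>* \<longleftrightarrow>
    lim (\<lambda>n. gaifman_dist L (G n) (cst (G n) i) (cst (G n) j)) < \<infinity>"
proof -
  have G: "fo_structure (gadget_lang L k) (G n)" for n using conv unfolding el_convergent_def by blast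
  define P where "P d n \<longleftrightarrow> (cst (G n) i, cst (G n) j) \<in> gaifman L (G n) ^^ d" for d n
  define dist where "dist n = gaifman_dist L (G n) (cst (G n) i) (cst (G n) j)" for n
  have path: "(cst (ult V G) i, cst (ult V G) j) \<in> gaifman L (ult V G) ^^ d \<longleftrightarrow> eventually (P d) V"
    if "free_ultrafilter V" for V d
    using free_ultrafilter.root_path_ult[OF that G fin] unfolding P_def .
  \<comment> \<open>All ultraproducts of the convergent gadgets are back-and-forth equivalent, so
    walks of length \<open>d\<close> between roots exist in all or in none of them.\<close>
  have trans: "eventually (P d) W" if V: "free_ultrafilter V" and W: "free_ultrafilter W" and ev: "eventually (P d) V" for V W d
    using root_connected_bf(1)[OF free_ultrafilter.ult_fo_structure[OF V G] free_ultrafilter.ult_fo_structure[OF W G]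
        convergent_bf[OF conv _ V W] ij, of d] fin ev path[OF V] path[OF W] by simp
  have dich: "eventually (P d) sequentially \<or> eventually (\<lambda>n. \<not> P d n) sequentially" for d
    by (rule ultrafilter_dichotomy) (rule trans)
  have dist: "dist n = (INF d\<in>{d. P d n}. enat d)" for n
    unfolding dist_def gaifman_dist_def P_def ..
  have evU: "eventually (P d) U \<longleftrightarrow> eventually (P d) sequentially" for d
    using dich[of d] free_ultrafilter.ev_sequentially[OF U] free_ultrafilter.ev_not[OF U] by blast
  have conn: "(cst (ult U G) i, cst (ult U G) j) \<in> (gaifman L (ult U G))\<^sup>* \<longleftrightarrow> (\<exists>d. eventually (P d) sequentially)"
    unfolding rtrancl_power path[OF U] evU ..
  have below: "eventually (\<lambda>n. \<forall>d<m. \<not> P d n) sequentially" if "\<And>d. d < m \<Longrightarrow> \<not> eventually (P d) sequentially" for m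
  proof -
    have "eventually (\<lambda>n. \<forall>d\<in>{..<m}. \<not> P d n) sequentially"
      by (rule eventually_ball_finite) (use dich that in auto)
    then show ?thesis by (rule eventually_mono) auto
  qed
  have ge: "enat m \<le> dist n" if "\<forall>d<m. \<not> P d n" for m n
    unfolding dist by (rule INF_greatest) (use that not_le in auto)
  show ?thesis
  proof (cases "\<exists>d. eventually (P d) sequentially")
    case True
    \<comment> \<open>The least eventually realised length is the limit: each of the finitely many
      smaller lengths is eventually absent.\<close>
    define m where "m = (LEAST d. eventually (P d) sequentially)"
    have m: "eventually (P m) sequentially" unfolding m_def using True by (rule LeastI_ex)
    have "eventually (\<lambda>n. \<forall>d<m. \<not> P d n) sequentially"
      by (rule below) (use not_less_Least in \<open>auto simp: m_def\<close>)
    with m have "eventually (\<lambda>n. dist n = enat m) sequentially"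
    proof eventually_elim
      case (elim n)
      have "dist n \<le> enat m" unfolding dist by (rule INF_lower) (use elim in simp)
      then show ?case using ge elim by (simp add: antisym)
    qed
    then have "lim dist = enat m" by (intro limI tendsto_eventually)
    then show ?thesis using conn True unfolding dist_def by simp
  next
    case False
    have "dist \<longlonglongrightarrow> \<infinity>"
    proof (rule order_tendstoI)
      fix a :: enat assume "a < \<infinity>"
      then obtain m where m: "a = enat m" by (cases a) auto
      have "eventually (\<lambda>n. \<forall>d<Suc m. \<not> P d n) sequentially" by (rule below) (use False in blast)
      then show "eventually (\<lambda>n. a < dist n) sequentially"
      proof (rule eventually_mono)
        fix n assume "\<forall>d<Suc m. \<not> P d n"
        from ge[OF this] show "a < dist n" unfolding m by (meson enat_ord_simps(2) lessI less_le_trans)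
      qed
    qed simp
    then have "lim dist = \<infinity>" by (rule limI)
    then show ?thesis using conn False unfolding dist_def by simp
  qed
qed

text \<open>The remaining clauses concern at most two edges, so it suffices to play two edges and to
  read the clauses in the answers.\<close>

lemma frag_base_bf:
  assumes bf: "bf LB B B' {}" and LB: "Frag ` I \<subseteq> syms LB"
    and edge: "\<And>X e. X \<in> I \<Longrightarrow> e \<in> rel B (Frag X) \<Longrightarrow> length e = Suc (card X) \<and> set e \<subseteq> universe B"
    and base: "frag_base I B'"
  shows "frag_base I B"
proof -
  have two: "\<exists>e' f' q. bf LB B B' q \<and> e' \<in> rel B' (Frag X) \<and> f' \<in> rel B' (Frag Y) \<and> length e' = length e \<and>
      length f' = length f \<and> (last e, last e') \<in> q \<and> (last f, last f') \<in> q \<and>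
      (\<forall>p<length e. (e ! p, e' ! p) \<in> q) \<and> (\<forall>p<length f. (f ! p, f' ! p) \<in> q)"
    if XY: "X \<in> I" "Y \<in> I" and ef: "e \<in> rel B (Frag X)" "f \<in> rel B (Frag Y)" for X Y e f
  proof -
    have ne: "e \<noteq> []" "set e \<subseteq> universe B" "f \<noteq> []" "set f \<subseteq> universe B"
      using edge[OF XY(1) ef(1)] edge[OF XY(2) ef(2)] by auto
    have sy: "Frag X \<in> syms LB" "Frag Y \<in> syms LB" using LB XY by auto
    obtain e' where e': "length e' = length e" "e' \<in> rel B' (Frag X)" "bf LB B B' ({} \<union> set (zip e e'))"
      "(last e, last e') \<in> set (zip e e')" "\<And>p. p < length e \<Longrightarrow> (e ! p, e' ! p) \<in> set (zip e e')"
      using bf_edge[OF bf sy(1) ef(1) ne(1,2)] by metis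
    obtain f' where f': "length f' = length f" "f' \<in> rel B' (Frag Y)"
      "bf LB B B' (({} \<union> set (zip e e')) \<union> set (zip f f'))"
      "(last f, last f') \<in> set (zip f f')" "\<And>p. p < length f \<Longrightarrow> (f ! p, f' ! p) \<in> set (zip f f')"
      using bf_edge[OF e'(3) sy(2) ef(2) ne(3,4)] by metis
    show ?thesis
      by (rule exI[of _ e'], rule exI[of _ f'], rule exI[of _ "({} \<union> set (zip e e')) \<union> set (zip f f')"])
        (use e' f' in auto)
  qed
  have "X = Y \<and> e = f" if XY: "X \<in> I" "Y \<in> I" "e \<in> rel B (Frag X)" "f \<in> rel B (Frag Y)" "last e = last f" for X Y e f
  proof -
    obtain e' f' q where q: "bf LB B B' q" "e' \<in> rel B' (Frag X)" "f' \<in> rel B' (Frag Y)" "length e' = length e"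
      "length f' = length f" "(last e, last e') \<in> q" "(last f, last f') \<in> q"
      "\<forall>p<length e. (e ! p, e' ! p) \<in> q" "\<forall>p<length f. (f ! p, f' ! p) \<in> q"
      using two[OF XY(1-4)] by blast
    have "last e' = last f'" using bf_eq[OF q(1,6,7)] XY(5) by simp
    then have ef: "X = Y" "e' = f'" using frag_baseD(2)[OF base XY(1,2) q(2,3)] by auto
    have "e = f"
    proof (rule nth_equalityI)
      show "length e = length f" using q(4,5) ef(2) by simp
      fix p assume "p < length e"
      then show "e ! p = f ! p" using bf_eq[OF q(1), of "e ! p" "e' ! p" "f ! p" "f' ! p"] q(4,5,8,9) ef(2) by simp
    qed
    then show ?thesis using ef(1) by blast
  qed
  moreover have "e ! p \<in> plain I B" if X: "X \<in> I" "e \<in> rel B (Frag X)" "p < card X" for X e p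
  proof -
    have pl: "p < length e" using edge[OF X(1,2)] X(3) by simp
    have "e ! p \<noteq> last f" if Y: "Y \<in> I" "f \<in> rel B (Frag Y)" for Y f
    proof
      assume eq: "e ! p = last f"
      obtain e' f' q where q: "bf LB B B' q" "e' \<in> rel B' (Frag X)" "f' \<in> rel B' (Frag Y)"
        "(last f, last f') \<in> q" "\<forall>p<length e. (e ! p, e' ! p) \<in> q"
        using two[OF X(1) Y(1) X(2) Y(2)] by blast
      have "e' ! p = last f'" using bf_eq[OF q(1) q(5)[rule_format, OF pl] q(4)] eq by blast
      moreover have "e' ! p \<in> plain I B'" using frag_baseD(3)[OF base X(1) q(2) X(3)] .
      ultimately show False using q(3) Y(1) unfolding plain_def auxs_def by auto
    qed
    moreover have "e ! p \<in> universe B" using edge[OF X(1,2)] pl nth_mem by blast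
    ultimately show ?thesis unfolding plain_def auxs_def by auto
  qed
  ultimately show ?thesis using edge unfolding frag_base_def by blast
qed

text \<open>The diagonal map \<open>c\<close> is injective, sends edges to edges and auxiliary
  vertices to auxiliary ones, so violations in \<open>B\<close> would reappear in the
  ultrapower.\<close>

lemma (in free_ultrafilter) frag_base_const:
  fixes B :: "('b, 'r frag_sym) fo_struct"
  assumes edge: "\<And>X e. X \<in> I \<Longrightarrow> e \<in> rel B (Frag X) \<Longrightarrow> length e = Suc (card X) \<and> set e \<subseteq> universe B"
    and base: "frag_base I (ult U (\<lambda>_. B))"
  shows "frag_base I B"
proof -
  define c where "c b = canon U (\<lambda>_. b)" for b :: 'b
  have c: "c a = c b \<longleftrightarrow> a = b" for a b
  proof
    assume eq: "c a = c b"
    have "eventually (\<lambda>n. a = b) U" using ev_canon[of U "\<lambda>_. a"] ev_canon[of U "\<lambda>_. b"]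
    proof eventually_elim
      case (elim n)
      then show ?case using fun_cong[OF eq, of n] unfolding c_def by metis
    qed
    then show "a = b" using ev_const[of "a = b"] by simp
  qed simp
  have ev0: "eventually (\<lambda>n. \<forall>b\<in>set e. c b n = b) U" for e
    unfolding c_def by (intro eventually_ball_finite) (auto intro: ev_canon)
  have ev: "eventually (\<lambda>n. map (\<lambda>d. d n) (map c e) = e) U" for e
    using ev0[of e] by (rule eventually_mono) (simp add: map_idI)
  have rel: "map c e \<in> rel (ult U (\<lambda>_. B)) T" if "e \<in> rel B T" for e T
    unfolding ult_rel using ev[of e] that by (auto simp: c_def elim!: eventually_mono)
  have ne: "e \<noteq> []" if "X \<in> I" "e \<in> rel B (Frag X)" for X e using edge[OF that] by auto
  have "X = Y \<and> e = f" if XY: "X \<in> I" "Y \<in> I" "e \<in> rel B (Frag X)" "f \<in> rel B (Frag Y)" "last e = last f" for X Y e f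
  proof -
    have "last (map c e) = last (map c f)" using ne XY by (simp add: last_map)
    then have "X = Y \<and> map c e = map c f" using frag_baseD(2)[OF base XY(1,2) rel[OF XY(3)] rel[OF XY(4)]] by blast
    moreover have "inj c" by (rule injI) (simp add: c)
    ultimately show ?thesis using inj_map_eq_map by blast
  qed
  moreover have "e ! p \<in> plain I B" if X: "X \<in> I" "e \<in> rel B (Frag X)" "p < card X" for X e p
  proof -
    have pl: "p < length e" using edge[OF X(1,2)] X(3) by simp
    have "c (e ! p) \<in> plain I (ult U (\<lambda>_. B))" using frag_baseD(3)[OF base X(1) rel[OF X(2)] X(3)] pl by simp
    moreover have "c (last f) \<in> auxs (ult U (\<lambda>_. B)) Y" if "Y \<in> I" "f \<in> rel B (Frag Y)" for Y f
      unfolding auxs_def using rel[OF that(2)] ne[OF that] by (metis imageI last_map)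
    moreover have "e ! p \<in> universe B" using edge[OF X(1,2)] pl nth_mem by blast
    ultimately show ?thesis unfolding plain_def auxs_def by fastforce
  qed
  ultimately show ?thesis using edge unfolding frag_base_def by blast
qed

lemma frag_index_properties:
  assumes "equiv {..<k} \<sigma>"
  shows "finite (frag_index k \<sigma>)"
    and "X \<in> frag_index k \<sigma> \<Longrightarrow> X \<subseteq> {..<k}"
    and "X \<in> frag_index k \<sigma> \<Longrightarrow> Y \<in> frag_index k \<sigma> \<Longrightarrow> j \<in> X \<Longrightarrow> j \<in> Y \<Longrightarrow> X = Y"
proof -
  have sub: "\<sigma> \<subseteq> {..<k} \<times> {..<k}" using assms by (rule equiv_type)
  show "finite (frag_index k \<sigma>)" unfolding frag_index_def using finite_quotient[OF _ sub] by simp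
  show "X \<in> frag_index k \<sigma> \<Longrightarrow> X \<subseteq> {..<k}"
    unfolding frag_index_def using in_quotient_imp_subset[OF assms] by auto
  show "X \<in> frag_index k \<sigma> \<Longrightarrow> Y \<in> frag_index k \<sigma> \<Longrightarrow> j \<in> X \<Longrightarrow> j \<in> Y \<Longrightarrow> X = Y"
    unfolding frag_index_def using quotient_disj[OF assms, of X Y] by auto
qed

lemma syms_frag_lang: "syms (frag_lang L k \<sigma>) = Orig ` syms L \<union> Frag ` frag_index k \<sigma>"
  by (simp add: frag_lang_def)

lemma frag_lang_edge:
  assumes "fo_structure (frag_lang L k \<sigma>) B" "X \<in> frag_index k \<sigma>" "e \<in> rel B (Frag X)"
  shows "length e = Suc (card X) \<and> set e \<subseteq> universe B"
proof -
  have "Frag X \<in> syms (frag_lang L k \<sigma>)" using assms(2) by (simp add: syms_frag_lang)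
  then have "length e = arity (frag_lang L k \<sigma>) (Frag X) \<and> set e \<subseteq> universe B"
    using assms(1,3) unfolding fo_structure_def by blast
  then show ?thesis by (simp add: frag_lang_def)
qed

lemma frag_lang_tuple:
  assumes "fo_structure (frag_lang L k \<sigma>) B" "S \<in> syms L" "t \<in> rel B (Orig S)"
  shows "length t = arity L S \<and> set t \<subseteq> universe B"
proof -
  have "Orig S \<in> syms (frag_lang L k \<sigma>)" using assms(2) by (simp add: syms_frag_lang)
  then have "length t = arity (frag_lang L k \<sigma>) (Orig S) \<and> set t \<subseteq> universe B"
    using assms(1,3) unfolding fo_structure_def by blast
  then show ?thesis by (simp add: frag_lang_def)
qed

lemma frag_product_structure:
  assumes "relational_lang L" "fo_structure (frag_lang L k \<sigma>) B" "fo_structure (gadget_lang L k) H"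
    "plain (frag_index k \<sigma>) B \<noteq> {}"
  shows "fo_structure L (frag_product L k \<sigma> B H)"
proof -
  note B = frag_lang_tuple[OF assms(2)]
  have H: "\<And>S t. S \<in> syms L \<Longrightarrow> t \<in> rel H S \<Longrightarrow> length t = arity L S"
    using assms(3) unfolding fo_structure_def gadget_lang_def by auto
  define cls where "cls = eq_class (frag_glue k \<sigma> B H)"
  have U: "universe (frag_product L k \<sigma> B H) = cls ` (Inl ` (universe B - aux_vertices k \<sigma> B) \<union>
      {Inr (X, e, v) |X e v. X \<in> frag_index k \<sigma> \<and> e \<in> rel B (Frag X) \<and> v \<in> frag_part L k H X})"
    unfolding frag_product_def Let_def cls_def by simp
  have "length t = arity L S \<and> set t \<subseteq> universe (frag_product L k \<sigma> B H)"
    if S: "S \<in> syms L" and t: "t \<in> rel (frag_product L k \<sigma> B H) S" for S t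
  proof -
    from t S consider s where "s \<in> rel B (Orig S)" "set s \<inter> aux_vertices k \<sigma> B = {}" "t = map (\<lambda>b. cls (Inl b)) s"
      | X e s where "X \<in> frag_index k \<sigma>" "e \<in> rel B (Frag X)" "s \<in> rel H S" "set s \<subseteq> frag_part L k H X"
        "t = map (\<lambda>v. cls (Inr (X, e, v))) s"
      unfolding frag_product_def Let_def cls_def by auto
    then show ?thesis
    proof cases
      case 1
      have "set t \<subseteq> cls ` Inl ` (universe B - aux_vertices k \<sigma> B)" using B[OF S 1(1)] 1(2,3) by auto
      then show ?thesis unfolding U using B[OF S 1(1)] 1(3) by (auto simp: image_Un)
    next
      case 2
      have "set t \<subseteq> cls ` {Inr (X, e, v) |X e v. X \<in> frag_index k \<sigma> \<and> e \<in> rel B (Frag X) \<and> v \<in> frag_part L k H X}"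
        unfolding 2(5) using 2(1,2,4) by auto
      then show ?thesis unfolding U using H[OF S 2(3)] 2(5) by (auto simp: image_Un)
    qed
  qed
  moreover have "universe (frag_product L k \<sigma> B H) \<noteq> {}"
    using assms(4) unfolding U frag_product_plain by auto
  moreover have "csts L = {}" using assms(1) unfolding relational_lang_def by blast
  ultimately show ?thesis unfolding fo_structure_def by simp
qed


theorem theorem3p5:
  fixes L :: "'r lang" and R :: 'r and k :: nat
    and A :: "nat \<Rightarrow> ('a, 'r) fo_struct"
    and G :: "nat \<Rightarrow> ('g, 'r) fo_struct"
    and \<sigma> :: "(nat \<times> nat) set"
  assumes "relational_lang L" and "finite (syms L)" and "R \<notin> syms L" and "k \<ge> 1"
    and "\<And>n. base_structure L R k (A n)"
    and "\<And>n. gadget L k (G n)"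
    and "el_convergent (gadget_lang L k) G"
    and "\<sigma> = {(i, j). i < k \<and> j < k \<and>
           lim (\<lambda>n. gaifman_dist L (G n) (cst (G n) i) (cst (G n) j)) < \<infinity>}"
    and "el_convergent (frag_lang L k \<sigma>) (\<lambda>n. fragmentation L R k \<sigma> (A n))"
  shows "el_convergent L (\<lambda>n. gadget_product L R k (A n) (G n)) \<and>
    (\<forall>(B :: ('b, 'r frag_sym) fo_struct) (H :: ('h, 'r) fo_struct) (M :: ('m, 'r) fo_struct).
       el_limit (frag_lang L k \<sigma>) (\<lambda>n. fragmentation L R k \<sigma> (A n)) B \<longrightarrow>
       el_limit (gadget_lang L k) G H \<longrightarrow>
       el_limit L (\<lambda>n. gadget_product L R k (A n) (G n)) M \<longrightarrow>
       elem_equiv L M (frag_product L k \<sigma> B H))"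
proof -
  define I where "I = frag_index k \<sigma>"
  define F where "F n = fragmentation L R k \<sigma> (A n)" for n
  define P where "P n = gadget_product L R k (A n) (G n)" for n
  have csts: "csts L = {}" using assms(1) unfolding relational_lang_def by blast
  have G: "fo_structure (gadget_lang L k) (G n)" for n using assms(6) unfolding gadget_def by blast
  have P: "fo_structure L (P n)" for n
    unfolding P_def using gadget_product_structure[OF assms(1,3,5,6)] .
  have convF: "el_convergent (frag_lang L k \<sigma>) F" using assms(9) unfolding F_def .
  have \<sigma>_sub: "\<sigma> \<subseteq> {..<k} \<times> {..<k}" using assms(8) by auto
  have \<sigma>: "(i, j) \<in> \<sigma> \<longleftrightarrow> (cst (ult U G) i, cst (ult U G) j) \<in> (gaifman L (ult U G))\<^sup>*"
    if "free_ultrafilter U" "i < k" "j < k" for U i j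
    using root_connected_iff_lim[OF assms(7,2) that] that(2,3) assms(8) by simp
  obtain U where U: "free_ultrafilter U" using free_ultrafilter_exists[of sequentially] by auto
  interpret U: free_ultrafilter U by (rule U)
  \<comment> \<open>In any one ultraproduct of the gadgets, \<sigma> is connectivity of the roots,
    hence an equivalence.\<close>
  have eq\<sigma>: "equiv {..<k} \<sigma>"
  proof (rule equivI)
    show "refl_on {..<k} \<sigma>"
    proof (rule refl_onI)
      fix i assume "i \<in> {..<k}"
      then show "(i, i) \<in> \<sigma>" using \<sigma>[OF U, of i i] by simp
    qed
    show "sym \<sigma>"
    proof (rule symI)
      fix i j assume ij: "(i, j) \<in> \<sigma>"
      then have "i < k" "j < k" using \<sigma>_sub by auto
      then show "(j, i) \<in> \<sigma>" using \<sigma>[OF U, of i j] \<sigma>[OF U, of j i] ij gaifman_rtrancl_sym by simp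
    qed
    show "trans \<sigma>"
    proof (rule transI)
      fix i j l assume ij: "(i, j) \<in> \<sigma>" and jl: "(j, l) \<in> \<sigma>"
      then have "i < k" "j < k" "l < k" using \<sigma>_sub by auto
      then show "(i, l) \<in> \<sigma>"
        using \<sigma>[OF U, of i j] \<sigma>[OF U, of j l] \<sigma>[OF U, of i l] ij jl
        by (meson rtrancl_trans)
    qed
  qed (rule \<sigma>_sub)
  note I = frag_index_properties[OF eq\<sigma>]
  have LBfin: "finite (syms (frag_lang L k \<sigma>))" using assms(2) I(1) by (simp add: syms_frag_lang)
  have LB: "Orig ` syms L \<union> Frag ` I \<subseteq> syms (frag_lang L k \<sigma>)" by (simp add: syms_frag_lang I_def)
  have "\<exists>J K. pre_gluing L k I (F n) (G n) (P n) (\<lambda>_. universe (G n)) J K" for n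
    unfolding I_def F_def P_def by (rule gadget_product_pre_gluing(1)[OF assms(3,5,6)]) (fact I(2), fact I(3))
  then obtain Jn Kn where pg: "\<And>n. pre_gluing L k I (F n) (G n) (P n) (\<lambda>_. universe (G n)) (Jn n) (Kn n)" by metis
  have card_ult: "\<exists>F'\<subseteq>auxs (ult V F) Y. finite F' \<and> card F' = card E"
    if V: "free_ultrafilter V" and XY: "X \<in> I" "Y \<in> I" "finite E" "E \<subseteq> auxs (ult V F) X" for V X Y E
  proof (rule free_ultrafilter.auxs_card_ult[OF V _ _ XY])
    show "length e = Suc (card X)" if "X \<in> I" "e \<in> rel (F n) (Frag X)" for n X e
      using pre_gluing.edge[OF pg that] by blast
    show "\<exists>s. inj_on s (auxs (F n) X) \<and> s ` auxs (F n) X \<subseteq> auxs (F n) Y" if "X \<in> I" "Y \<in> I" for n X Y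
      unfolding F_def by (rule gadget_product_pre_gluing(2)[OF assms(3,5,6)])
        (fact I(2), fact I(3), use that in \<open>simp_all add: I_def\<close>)
  qed
  have pgV: "pre_gluing L k I (ult V F) (ult V G) (ult V P) (\<lambda>X. lift_set V (\<lambda>n. universe (G n))) (lift1 V Jn) (lift2 V Kn)"
    if V: "free_ultrafilter V" for V
    by (rule free_ultrafilter.pre_gluing_ult[OF V _ pg]) (simp add: I_def I(1))
  \<comment> \<open>Each copied set is the whole gadget, so every sort may carry every vertex, and
    the parts can be cut along the components of the ultraproduct.\<close>
  have glV: "gluing L k I (ult V F) (ult V G) (ult V P) (root_part L k (ult V G)) (lift1 V Jn) (lift2 V Kn)"
    if V: "free_ultrafilter V" for V
  proof (rule pre_gluing.gluing[OF pgV[OF V]])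
    show "root_part L k (ult V G) v \<in> I \<and> v \<in> lift_set V (\<lambda>n. universe (G n))" if "v \<in> universe (ult V G)" for v
      using root_part_index[OF \<sigma>[OF V] \<sigma>_sub] that unfolding I_def ult_universe_lift_set by blast
  qed (fact card_ult[OF V] root_part_adjacent root_part_root)+
  have ne: "universe (ult V P) \<noteq> {}" if "free_ultrafilter V" for V
    using free_ultrafilter.ult_fo_structure[where M = P, OF that P] unfolding fo_structure_def by blast
  have bfP: "bf L (ult V P) (ult W P) {}" if V: "free_ultrafilter V" and W: "free_ultrafilter W" for V W
  proof -
    interpret gluing_pair L k I "ult V F" "ult V G" "ult V P" "root_part L k (ult V G)" "lift1 V Jn" "lift2 V Kn"
      "ult W F" "ult W G" "ult W P" "root_part L k (ult W G)" "lift1 W Jn" "lift2 W Kn" "frag_lang L k \<sigma>"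
      using glV[OF V] glV[OF W] LB convergent_bf[OF convF LBfin V W] convergent_bf[OF assms(7) _ V W] assms(2)
      unfolding gluing_pair_def gluing_pair_axioms_def by simp
    show ?thesis using bf_glued[OF csts] .
  qed
  have conv: "el_convergent L P"
    unfolding el_convergent_def
  proof (intro conjI allI ballI)
    fix n show "fo_structure L (P n)" by (rule P)
  next
    fix \<phi> assume \<phi>: "\<phi> \<in> sentences L"
    have "eventually (\<lambda>n. P n \<Turnstile> \<phi>) sequentially \<or> eventually (\<lambda>n. \<not> P n \<Turnstile> \<phi>) sequentially"
    proof (rule ultrafilter_dichotomy)
      fix V W assume V: "free_ultrafilter V" and W: "free_ultrafilter W" and ev: "eventually (\<lambda>n. P n \<Turnstile> \<phi>) V"
      have "ult V P \<Turnstile> \<phi>" using free_ultrafilter.ult_models[where M = P, OF V P \<phi>] ev by simp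
      then have "ult W P \<Turnstile> \<phi>" using bf_models[OF bfP[OF V W] csts \<phi> ne[OF V] ne[OF W]] by simp
      then show "eventually (\<lambda>n. P n \<Turnstile> \<phi>) W" using free_ultrafilter.ult_models[where M = P, OF W P \<phi>] by simp
    qed
    moreover have "P n \<Turnstile> Neg \<phi> \<longleftrightarrow> \<not> P n \<Turnstile> \<phi>" for n
      using models_Neg[of \<phi> "P n"] \<phi> P[of n] unfolding sentences_def fo_structure_def by simp
    ultimately show "eventually (\<lambda>n. P n \<Turnstile> \<phi>) sequentially \<or> eventually (\<lambda>n. P n \<Turnstile> Neg \<phi>) sequentially" by simp
  qed
  have "elem_equiv L M (frag_product L k \<sigma> B H)"
    if limB: "el_limit (frag_lang L k \<sigma>) F B" and limH: "el_limit (gadget_lang L k) G H" and limM: "el_limit L P M"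
    for B :: "('b, 'r frag_sym) fo_struct" and H :: "('h, 'r) fo_struct" and M :: "('m, 'r) fo_struct"
  proof -
    define N where "N = frag_product L k \<sigma> B H"
    let ?B = "ult U (\<lambda>_. B)" and ?H = "ult U (\<lambda>_. H)" and ?N = "ult U (\<lambda>_. N)"
    have B: "fo_structure (frag_lang L k \<sigma>) B" and H: "fo_structure (gadget_lang L k) H" and M: "fo_structure L M"
      using limB limH limM unfolding el_limit_def by blast+
    have bfB: "bf (frag_lang L k \<sigma>) ?B (ult U F) {}" by (rule limit_bf[OF convF limB LBfin U])
    have bfH: "bf (gadget_lang L k) ?H (ult U G) {}" by (rule limit_bf[OF assms(7) limH _ U]) (simp add: assms(2))
    have sB: "fo_structure (frag_lang L k \<sigma>) ?B" by (rule U.ult_fo_structure) (rule B)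
    have sH: "fo_structure (gadget_lang L k) ?H" by (rule U.ult_fo_structure) (rule H)
    have sG: "fo_structure (gadget_lang L k) (ult U G)" by (rule U.ult_fo_structure) (rule G)
    \<comment> \<open>Distinctness of the roots reaches \<open>H\<close> through the sentences
      saying that two constants differ.\<close>
    have inj: "inj_on (cst H) {..<k}"
    proof (rule inj_onI)
      fix i j assume ij: "i \<in> {..<k}" "j \<in> {..<k}" "cst H i = cst H j"
      show "i = j"
      proof (rule ccontr)
        assume "i \<noteq> j"
        define \<phi> :: "'r fo_formula" where "\<phi> = Neg (Eq (Cst i) (Cst j))"
        have \<phi>: "\<phi> \<in> sentences (gadget_lang L k)" using ij unfolding \<phi>_def sentences_def by simp
        have "G n \<Turnstile> \<phi>" for n
          using assms(6)[of n] ij \<open>i \<noteq> j\<close> unfolding gadget_def \<phi>_def models_def by (auto dest: inj_onD)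
        then have "H \<Turnstile> \<phi>" using limH \<phi> unfolding el_limit_def by simp
        moreover obtain a where "a \<in> universe H" using H unfolding fo_structure_def by blast
        ultimately show False using ij(3) unfolding \<phi>_def models_def by auto
      qed
    qed
    have \<sigma>H: "(i, j) \<in> \<sigma> \<longleftrightarrow> (cst H i, cst H j) \<in> (gaifman L H)\<^sup>*" if "i < k" "j < k" for i j
      using \<sigma>[OF U that] root_connected_bf(2)[OF sH sG bfH that] U.root_connected_const[OF H assms(2)] by blast
    have baseF: "frag_base I (ult U F)"
      using pre_gluing.edge[OF pgV[OF U]] pre_gluing.edge_unique[OF pgV[OF U]] pre_gluing.edge_plain[OF pgV[OF U]]
      unfolding frag_base_def by blast
    have edgeB: "length e = Suc (card X) \<and> set e \<subseteq> universe ?B" if "X \<in> I" "e \<in> rel ?B (Frag X)" for X e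
      using frag_lang_edge[OF sB] that unfolding I_def by blast
    have "frag_base I ?B" by (rule frag_base_bf[OF bfB _ edgeB baseF]) (use LB in auto)
    then have baseB: "frag_base I B"
      by (rule U.frag_base_const[rotated]) (use frag_lang_edge[OF B] in \<open>auto simp: I_def\<close>)
    define D where "D X = {v \<in> universe H. root_part L k H v = X}" for X
    have "\<exists>J K. pre_gluing L k I B H N D J K"
      unfolding I_def N_def D_def
      by (rule frag_product_pre_gluing[OF B baseB[unfolded I_def] H inj _ _ _ \<sigma>_sub]) (fact I(2), fact I(3), fact \<sigma>H)
    then obtain J K where pgN: "pre_gluing L k I B H N D J K" by blast
    have pgU: "pre_gluing L k I ?B ?H ?N (\<lambda>X. lift_set U (\<lambda>_. D X)) (lift1 U (\<lambda>_. J)) (lift2 U (\<lambda>_. K))"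
      by (rule U.pre_gluing_ult[OF _ pgN]) (simp add: I_def I(1))
    \<comment> \<open>The limit of the parts computed in \<open>H\<close>, a single value because
      \<open>I\<close> is finite. \<open>root_part\<close> of the ultrapower could not be used: a
      sequence running away from the roots of its component is rootless there, but \<open>N\<close>
      copies it at edges of the original sort.\<close>
    define part where "part v = {j. eventually (\<lambda>n. j \<in> root_part L k H (v n)) U}" for v
    have part_eq: "part v = X" if "eventually (\<lambda>n. root_part L k H (v n) = X) U" for v X
    proof -
      have "eventually (\<lambda>n. j \<in> root_part L k H (v n)) U \<longleftrightarrow> j \<in> X" for j
      proof -
        have "eventually (\<lambda>n. j \<in> root_part L k H (v n) \<longleftrightarrow> j \<in> X) U" using that by (rule eventually_mono) simp
        then show ?thesis unfolding U.ev_iff U.ev_const .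
      qed
      then show ?thesis unfolding part_def by blast
    qed
    have gl: "gluing L k I ?B ?H ?N part (lift1 U (\<lambda>_. J)) (lift2 U (\<lambda>_. K))"
    proof (rule pre_gluing.gluing[OF pgU])
      fix X Y E assume XY: "X \<in> I" "Y \<in> I" and E: "finite E" "E \<subseteq> auxs ?B X"
      have FX: "Frag X \<in> syms (frag_lang L k \<sigma>)" "Frag Y \<in> syms (frag_lang L k \<sigma>)" using LB XY by auto
      have edge1: "e \<noteq> [] \<and> set e \<subseteq> universe ?B" if "e \<in> rel ?B (Frag X)" for e using edgeB[OF XY(1) that] by auto
      have edge2: "e \<noteq> [] \<and> set e \<subseteq> universe (ult U F)" if "e \<in> rel (ult U F) (Frag Y)" for e
        using pre_gluing.edge[OF pgV[OF U] XY(2) that] by auto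
      obtain E1 where E1: "E1 \<subseteq> auxs (ult U F) X" "finite E1" "card E1 = card E"
        using bf_auxs_card[OF bfB FX(1) edge1 E] by blast
      obtain E2 where E2: "E2 \<subseteq> auxs (ult U F) Y" "finite E2" "card E2 = card E1"
        using card_ult[OF U XY E1(2,1)] by blast
      have bfB': "bf (frag_lang L k \<sigma>) (ult U F) ?B {}" using bf_converse[OF bfB] by simp
      show "\<exists>F'\<subseteq>auxs ?B Y. finite F' \<and> card F' = card E"
        using bf_auxs_card[OF bfB' FX(2) edge2 E2(2,1)] E1(3) E2(3) by simp
    next
      fix v assume v: "v \<in> universe ?H"
      have "eventually (\<lambda>n. \<exists>X\<in>I. root_part L k H (v n) = X) U"
        using root_part_index[OF \<sigma>H \<sigma>_sub] unfolding I_def by simp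
      then obtain X where X: "X \<in> I" "eventually (\<lambda>n. root_part L k H (v n) = X) U"
        using U.ev_bex_finite[OF I(1)[folded I_def], of "\<lambda>X n. root_part L k H (v n) = X"] by auto
      have "eventually (\<lambda>n. v n \<in> D X) U"
        using X(2) universe_ev[OF v] by eventually_elim (simp add: D_def)
      then show "part v \<in> I \<and> v \<in> lift_set U (\<lambda>_. D (part v))"
        using X part_eq[OF X(2)] universe_canon[OF v] by (simp add: lift_setI)
    next
      fix u v assume uv: "(u, v) \<in> gaifman L ?H"
      then have "u \<in> universe ?H" "v \<in> universe ?H" using gaifman_universe[OF sH] by simp_all
      then have "canon U u = u" "canon U v = v" by (auto dest: universe_canon)
      then have "eventually (\<lambda>n. (u n, v n) \<in> gaifman L H) U"
        using U.ult_gaifman[of "gadget_lang L k" "\<lambda>_. H", OF H, of u v] uv assms(2) by simp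
      then have ev: "eventually (\<lambda>n. root_part L k H (u n) = root_part L k H (v n)) U"
        by (rule eventually_mono) (rule root_part_adjacent)
      have "eventually (\<lambda>n. j \<in> root_part L k H (u n) \<longleftrightarrow> j \<in> root_part L k H (v n)) U" for j
        using ev by (rule eventually_mono) simp
      then show "part u = part v" unfolding part_def U.ev_iff by simp
    next
      fix j assume j: "j < k"
      have "eventually (\<lambda>n. root_part L k H (cst ?H j n) = root_part L k H (cst H j)) U"
        unfolding ult_cst using ev_canon[of U "\<lambda>_. cst H j"] by (rule eventually_mono) simp
      then show "j \<in> part (cst ?H j)" using part_eq root_part_root[OF j] by metis
    qed
    interpret gluing_pair L k I ?B ?H ?N part "lift1 U (\<lambda>_. J)" "lift2 U (\<lambda>_. K)"
      "ult U F" "ult U G" "ult U P" "root_part L k (ult U G)" "lift1 U Jn" "lift2 U Kn" "frag_lang L k \<sigma>"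
      using gl glV[OF U] LB bfB bfH unfolding gluing_pair_def gluing_pair_axioms_def by simp
    \<comment> \<open>Gives \<open>N\<close> a nonempty universe. The base structures are nonempty,
      so the ultraproduct of the fragmentations has a point that is not auxiliary, and the game
      carries it back to the ultrapower of \<open>B\<close>.\<close>
    have "plain I B \<noteq> {}"
    proof -
      have len: "length e = Suc (card X)" if "X \<in> I" "e \<in> rel (F n) (Frag X)" for n X e
        using pre_gluing.edge[OF pg that] by blast
      have lenB: "length e = Suc (card X)" if "X \<in> I" "e \<in> rel B (Frag X)" for X e
        using frag_baseD(1)[OF baseB that] by blast
      have plF: "plain I (ult U F) = lift_set U (\<lambda>n. plain I (F n))"
        by (rule U.plain_ult[OF I(1)[folded I_def]]) (fact len)
      have plB: "plain I ?B = lift_set U (\<lambda>_. plain I B)"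
        by (rule U.plain_ult[OF I(1)[folded I_def]]) (fact lenB)
      have "plain I (F n) \<noteq> {}" for n
        unfolding I_def F_def by (rule gadget_product_pre_gluing(3)[OF assms(3,5,6)]) (fact I(2), fact I(3))
      then have "\<forall>n. \<exists>b. b \<in> plain I (F n)" by blast
      then obtain b where "\<And>n. b n \<in> plain I (F n)" by metis
      then have b: "canon U b \<in> plain I (ult U F)"
        unfolding plF by (intro canon_lift_set) simp
      then have "canon U b \<in> universe (ult U F)" unfolding plain_def by blast
      then obtain a where a: "bf (frag_lang L k \<sigma>) ?B (ult U F) {(a, canon U b)}" using bf_back[OF bfB] by blast
      then have "a \<in> plain I ?B" using plain_bf[OF a, of a "canon U b"] b by blast
      then have "eventually (\<lambda>n. a n \<in> plain I B) U"
        unfolding plB by (rule lift_set_ev)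
      then show ?thesis using U.ev_happens by blast
    qed
    then have N: "fo_structure L N"
      unfolding N_def I_def using frag_product_structure[OF assms(1) B H] by blast
    have neN: "universe ?N \<noteq> {}" using U.ult_fo_structure[of L "\<lambda>_. N", OF N] unfolding fo_structure_def by blast
    have "M \<Turnstile> \<phi> \<longleftrightarrow> N \<Turnstile> \<phi>" if \<phi>: "\<phi> \<in> sentences L" for \<phi>
    proof -
      have "N \<Turnstile> \<phi> \<longleftrightarrow> ?N \<Turnstile> \<phi>" using U.ult_models[of L "\<lambda>_. N", OF N \<phi>] U.ev_const by simp
      also have "\<dots> \<longleftrightarrow> ult U P \<Turnstile> \<phi>" by (rule bf_models[OF bf_glued[OF csts] csts \<phi> neN ne[OF U]])
      also have "\<dots> \<longleftrightarrow> eventually (\<lambda>n. P n \<Turnstile> \<phi>) U" by (rule U.ult_models[OF P \<phi>])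
      also have "\<dots> \<longleftrightarrow> eventually (\<lambda>n. P n \<Turnstile> \<phi>) sequentially" by (rule convergent_ev[OF conv \<phi> U])
      also have "\<dots> \<longleftrightarrow> M \<Turnstile> \<phi>" using limM \<phi> unfolding el_limit_def by blast
      finally show ?thesis by simp
    qed
    then show ?thesis using M N unfolding elem_equiv_def N_def by blast
  qed
  then show ?thesis using conv unfolding P_def F_def by blast
qed

end
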